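(* Let $d\le 3$ and $\varepsilon>0$. Let $\mu=\sum_{j=1}^Nc_j\delta_{x_j}$, where $N\in\mathbb{N}$, $x_1,\ldots,x_N$ are $N$ distinct points in $\mathbb{R}^d$ and $c_1,\ldots,c_N$ are real numbers different from zero. Then the following holds: (a) The real number $-\alpha<0$ is an eigenvalue of $-\Delta+\varepsilon^2\Delta^2+\mu$ if and only if $$\det\left(\frac{\delta_{jk}}{c_k}+g_{\varepsilon,\alpha}(x_j-x_k)\right)_{1\le j,k\le N}=0.$$ (b) For every eigenvalue $-\alpha<0$ of $-\Delta+\varepsilon^2\Delta^2+\mu$, the corresponding eigenfunctions have the form $$\sum_{k=1}^Nh_k\,g_{\varepsilon,\alpha}(\cdot-x_k),\qquad (h_k)_{1\le k\le N}^T\in\ker\left(\frac{\delta_{jk}}{c_k}+g_{\varepsilon,\alpha}(x_j-x_k)\right)_{1\le j,k\le N}.$$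
   Context: $\delta_{x}$ is the Dirac measure at $x$ and $\delta_{jk}$ the Kronecker delta. For $d\le 3$ every $f\in H^2(\mathbb{R}^d)$ has a unique continuous representative $\tilde f$. $-\Delta+\varepsilon^2\Delta^2+\mu$ denotes the lower semibounded self-adjoint operator in $L^2(\mathbb{R}^d,dx)$ associated to the lower semibounded closed quadratic form $$\mathcal{E}_\varepsilon^\mu(f,f)=\varepsilon^2(\Delta f,\Delta f)+(\nabla f,\nabla f)+\int|\tilde f|^2\,d\mu,\qquad f\in H^2(\mathbb{R}^d).$$ For $\varepsilon,\alpha>0$ and $d\le3$, $g_{\varepsilon,\alpha}$ is the (continuous, radially symmetric) Green function of $-\Delta+\varepsilon^2\Delta^2+\alpha$, i.e. $g_{\varepsilon,\alpha}(x-y)$ is the integral kernel of $(-\Delta+\varepsilon^2\Delta^2+\alpha)^{-1}$ in $L^2(\mathbb{R}^d,dx)$: $$g_{\varepsilon,\alpha}(x)=(2\pi)^{-d}\int_{\mathbb{R}^d}\frac{e^{ip\cdot x}}{\varepsilon^2|p|^4+|p|^2+\alpha}\,dp .$$ *)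

theory Defs
  imports "HOL-Probability.Probability"
begin

subsection \<open>Square-integrable functions\<close>

text \<open>Elements of \<open>L\<^sup>2\<close> are represented by Borel functions; equality in \<open>L\<^sup>2\<close> is
  equality almost everywhere with respect to Lebesgue measure.\<close>

definition L2 :: "('a::euclidean_space \<Rightarrow> complex) set" where
  "L2 = {f \<in> borel_measurable lborel. integrable lborel (\<lambda>x. (cmod (f x))\<^sup>2)}"

definition L2_inner :: "('a::euclidean_space \<Rightarrow> complex) \<Rightarrow> ('a \<Rightarrow> complex) \<Rightarrow> complex" where
  "L2_inner f g = (LINT x|lborel. f x * cnj (g x))"


subsection \<open>Weak derivatives and the Sobolev space of order two\<close>

text \<open>A list \<open>bs\<close> of basis vectors plays the role of a multi-index: \<open>iter_partial bs f\<close> is the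
  classical iterated partial derivative of \<open>f\<close> in the directions \<open>bs\<close> (the last entry is
  applied first). It is meaningful only where the derivatives involved exist, which
  \<open>test_function\<close> ensures for all \<open>bs\<close>.\<close>

fun iter_partial :: "'a::euclidean_space list \<Rightarrow> ('a \<Rightarrow> complex) \<Rightarrow> 'a \<Rightarrow> complex" where
  "iter_partial [] f = f"
| "iter_partial (b # bs) f = (\<lambda>x. frechet_derivative (iter_partial bs f) (at x) b)"

definition test_function :: "('a::euclidean_space \<Rightarrow> complex) \<Rightarrow> bool" where
  "test_function \<phi> \<longleftrightarrow>
     (\<forall>bs. set bs \<subseteq> Basis \<longrightarrow> iter_partial bs \<phi> differentiable_on UNIV) \<and>
     compact (closure {x. \<phi> x \<noteq> 0})"

definition has_weak_deriv ::
  "('a::euclidean_space \<Rightarrow> complex) \<Rightarrow> 'a list \<Rightarrow> ('a \<Rightarrow> complex) \<Rightarrow> bool" where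
  "has_weak_deriv f bs g \<longleftrightarrow>
     (\<forall>\<phi>. test_function \<phi> \<longrightarrow>
        (LINT x|lborel. f x * iter_partial bs \<phi> x) =
        (- 1) ^ length bs * (LINT x|lborel. g x * \<phi> x))"

definition H2 :: "('a::euclidean_space \<Rightarrow> complex) set" where
  "H2 = {f \<in> L2. \<forall>bs. set bs \<subseteq> Basis \<and> length bs \<le> 2 \<longrightarrow> (\<exists>g\<in>L2. has_weak_deriv f bs g)}"

text \<open>For \<open>f\<close> in \<open>H2\<close> and \<open>length bs \<le> 2\<close> the weak derivative exists in \<open>L2\<close> and is unique up
  to null sets; the choice of a representative is immaterial below.\<close>

definition weak_deriv :: "'a::euclidean_space list \<Rightarrow> ('a \<Rightarrow> complex) \<Rightarrow> 'a \<Rightarrow> complex" where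
  "weak_deriv bs f = (SOME g. g \<in> L2 \<and> has_weak_deriv f bs g)"

definition weak_laplacian :: "('a::euclidean_space \<Rightarrow> complex) \<Rightarrow> 'a \<Rightarrow> complex" where
  "weak_laplacian f = (\<lambda>x. \<Sum>b\<in>Basis. weak_deriv [b, b] f x)"

definition grad_inner :: "('a::euclidean_space \<Rightarrow> complex) \<Rightarrow> ('a \<Rightarrow> complex) \<Rightarrow> complex" where
  "grad_inner f g = (\<Sum>b\<in>Basis. L2_inner (weak_deriv [b] f) (weak_deriv [b] g))"

definition cont_rep :: "('a::euclidean_space \<Rightarrow> complex) \<Rightarrow> 'a \<Rightarrow> complex" where
  "cont_rep f = (THE h. continuous_on UNIV h \<and> (AE x in lborel. h x = f x))"


subsection \<open>The operator associated to a quadratic form\<close>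

text \<open>\<open>form_operator D E\<close> is the graph of the operator that the representation theorem
  associates to the sesquilinear form \<open>E\<close> with domain \<open>D\<close>. It respects equality almost
  everywhere in the second component.\<close>

definition form_operator ::
  "('a::euclidean_space \<Rightarrow> complex) set \<Rightarrow> (('a \<Rightarrow> complex) \<Rightarrow> ('a \<Rightarrow> complex) \<Rightarrow> complex) \<Rightarrow>
   (('a \<Rightarrow> complex) \<times> ('a \<Rightarrow> complex)) set" where
  "form_operator D E = {(f, h). f \<in> D \<and> h \<in> L2 \<and> (\<forall>g\<in>D. E f g = L2_inner h g)}"

definition eigenfunction ::
  "(('a::euclidean_space \<Rightarrow> complex) \<times> ('a \<Rightarrow> complex)) set \<Rightarrow> complex \<Rightarrow> ('a \<Rightarrow> complex) \<Rightarrow> bool" where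
  "eigenfunction T l f \<longleftrightarrow> (f, \<lambda>x. l * f x) \<in> T \<and> \<not> (AE x in lborel. f x = 0)"

definition eigenvalue ::
  "(('a::euclidean_space \<Rightarrow> complex) \<times> ('a \<Rightarrow> complex)) set \<Rightarrow> complex \<Rightarrow> bool" where
  "eigenvalue T l \<longleftrightarrow> (\<exists>f. eigenfunction T l f)"


subsection \<open>Point interactions\<close>

text \<open>Integration with respect to the signed measure \<open>\<Sum>j. c j \<delta>\<^bsub>x j\<^esub>\<close>; the measure
  \<open>return borel a\<close> is the Dirac measure at \<open>a\<close>.\<close>

definition point_integral ::
  "('N::finite \<Rightarrow> real) \<Rightarrow> ('N \<Rightarrow> 'a::euclidean_space) \<Rightarrow> ('a \<Rightarrow> complex) \<Rightarrow> complex" where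
  "point_integral c x u = (\<Sum>j\<in>UNIV. complex_of_real (c j) * (LINT y|return borel (x j). u y))"

text \<open>The sesquilinear form obtained by polarization from the quadratic form
  \<open>\<epsilon>\<^sup>2 (\<Delta>f, \<Delta>f) + (\<nabla>f, \<nabla>f) + \<integral> \<bar>f\<bar>\<^sup>2 d\<mu>\<close>.\<close>

definition point_form ::
  "real \<Rightarrow> ('N::finite \<Rightarrow> real) \<Rightarrow> ('N \<Rightarrow> 'a::euclidean_space) \<Rightarrow>
   ('a \<Rightarrow> complex) \<Rightarrow> ('a \<Rightarrow> complex) \<Rightarrow> complex" where
  "point_form \<epsilon> c x f g =
     complex_of_real (\<epsilon>\<^sup>2) * L2_inner (weak_laplacian f) (weak_laplacian g) + grad_inner f g +
     point_integral c x (\<lambda>y. cont_rep f y * cnj (cont_rep g y))"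

definition point_operator ::
  "real \<Rightarrow> ('N::finite \<Rightarrow> real) \<Rightarrow> ('N \<Rightarrow> 'a::euclidean_space) \<Rightarrow>
   (('a \<Rightarrow> complex) \<times> ('a \<Rightarrow> complex)) set" where
  "point_operator \<epsilon> c x = form_operator H2 (point_form \<epsilon> c x)"

definition green :: "real \<Rightarrow> real \<Rightarrow> 'a::euclidean_space \<Rightarrow> complex" where
  "green \<epsilon> \<alpha> x =
     complex_of_real (1 / (2 * pi) ^ DIM('a)) *
     (LINT p|lborel. exp (\<i> * complex_of_real (p \<bullet> x)) /
        complex_of_real (\<epsilon>\<^sup>2 * norm p ^ 4 + (norm p)\<^sup>2 + \<alpha>))"

definition green_matrix ::
  "real \<Rightarrow> real \<Rightarrow> ('N::finite \<Rightarrow> real) \<Rightarrow> ('N \<Rightarrow> 'a::euclidean_space) \<Rightarrow> complex^'N^'N" where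
  "green_matrix \<epsilon> \<alpha> c x =
     (\<chi> j k. (if j = k then complex_of_real (1 / c k) else 0) + green \<epsilon> \<alpha> (x j - x k))"

end

theory Submission
  imports Defs "HOL-Real_Asymp.Real_Asymp"
begin

text \<open>
  Let \<open>E\<close> be the sesquilinear form \<open>\<epsilon>\<^sup>2 (\<Delta>f, \<Delta>g) + (\<nabla>f, \<nabla>g) + \<alpha> (f, g)\<close> on \<open>H\<^sup>2\<close> and \<open>G\<^sub>y = g\<^sub>\<epsilon>\<^sub>\<alpha>(\<cdot> - y)\<close>.
  Everything follows from the reproducing property: \<open>G\<^sub>y\<close> lies in \<open>H\<^sup>2\<close> and \<open>E(G\<^sub>y, g)\<close> is the conjugate
  of the value at \<open>y\<close> of the continuous representative of \<open>g\<close>.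
  Indeed \<open>f\<close> is an eigenfunction to \<open>- \<alpha>\<close> iff \<open>E(f, g) = \<Sum>\<^sub>j h\<^sub>j cnj (g(x\<^sub>j))\<close> with \<open>h\<^sub>j = - c\<^sub>j f(x\<^sub>j)\<close>;
  as \<open>E\<close> is definite this means \<open>f = \<Sum>\<^sub>k h\<^sub>k G\<^bsub>x\<^sub>k\<^esub>\<close>, and evaluation at the points \<open>x\<^sub>j\<close> turns the
  definition of \<open>h\<close> into the kernel equation.

  For the reproducing property no Fourier analysis on \<open>L\<^sup>2\<close> is needed: with the heat kernel \<open>p\<^sub>t\<close> and the
  solution \<open>k\<close> of \<open>\<epsilon>\<^sup>2 k'' + k' + \<alpha> k = 0\<close>, \<open>k(0) = 0\<close>, \<open>k'(0) = 1 / \<epsilon>\<^sup>2\<close>, whose Laplace transform is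
  \<open>1 / (\<epsilon>\<^sup>2 s\<^sup>2 + s + \<alpha>)\<close>, the Green function is \<open>\<integral> k(t) p\<^sub>t dt\<close>. Since \<open>\<partial>\<^sub>t p\<^sub>t = \<Delta> p\<^sub>t\<close>, two integrations by
  parts in \<open>t\<close> reduce \<open>E(G\<^sub>y, g)\<close> to the limit of \<open>(p\<^sub>t(\<cdot> - y), g)\<close> as \<open>t \<rightarrow> 0\<close>. That limit exists
  uniformly in \<open>y\<close> because its \<open>t\<close>-derivative \<open>(p\<^sub>t(\<cdot> - y), \<Delta>g)\<close> is \<open>O(t\<^sup>-\<^sup>d\<^sup>/\<^sup>4)\<close> and \<open>d < 4\<close>; this also
  gives the continuous representative.
\<close>

section \<open>Smooth functions and test functions\<close>

text \<open>The Green function is not smooth at its pole, so its derivatives cannot be moved onto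
  \<open>g\<close> directly. At each fixed time the heat kernel is smooth and square integrable, and
  integration by parts in space takes place there, before the time integral. Each space derivative
  of the heat kernel costs t^(-1/2), and its L2 norm is of order t^(-d/4). Two derivatives thus cost
  t^(-1), which the simple zero of \<open>k\<close> at t = 0 repays; the remaining t^(-d/4) is
  integrable at 0 for d \<le> 3. This is why the Green function reaches H2 and why the bound on
  \<open>k\<close> has to retain a factor t. The Laplace transform is taken at s = |p|^2, so that 1
  / (\<epsilon>^2 |p|^4 + |p|^2 + \<alpha>) becomes a superposition of Gaussians in p, whose Fourier
  transforms are heat kernels. In the oscillatory case 4 \<epsilon>^2 \<alpha> > 1 the function
  \<open>k\<close> changes sign, hence only absolute bounds on it enter. The Laplacian of
  \<open>g\<close> has no further weak derivatives at its disposal: in the fourth-order term one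
  Laplacian stays on the heat kernel, where it acts as a time derivative.\<close>

definition smooth_real :: "(real \<Rightarrow> real) \<Rightarrow> bool" where
  "smooth_real h \<longleftrightarrow> (\<exists>D. D 0 = h \<and> (\<forall>n s. (D n has_real_derivative D (Suc n) s) (at s)))"

text \<open>Choosing a derivative inside \<open>P\<close> and iterating the choice yields the whole
  sequence of derivatives. Smoothness of a concrete family thus reduces to one derivative
  computation that stays inside the family.\<close>

lemma smooth_real_coinduct:
  assumes "P h"
    and step: "\<And>h. P h \<Longrightarrow> \<exists>h'. P h' \<and> (\<forall>s. (h has_real_derivative h' s) (at s))"
  shows "smooth_real h"
proof -
  obtain F where F: "\<And>h. P h \<Longrightarrow> P (F h) \<and> (\<forall>s. (h has_real_derivative F h s) (at s))"
    using step by metis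
  have P: "P ((F ^^ n) h)" for n
    by (induction n) (use \<open>P h\<close> F in auto)
  show ?thesis
    unfolding smooth_real_def using F[OF P]
    by (intro exI[of _ "\<lambda>n. (F ^^ n) h"]) auto
qed

lemma smooth_real_deriv:
  assumes "smooth_real h"
  obtains h' where "smooth_real h'" "\<And>s. (h has_real_derivative h' s) (at s)"
proof -
  obtain D where D: "D 0 = h" "\<And>n s. (D n has_real_derivative D (Suc n) s) (at s)"
    using assms unfolding smooth_real_def by blast
  have "smooth_real (D 1)"
    unfolding smooth_real_def by (rule exI[of _ "\<lambda>n. D (Suc n)"]) (use D in auto)
  then show ?thesis using that[of "D 1"] D by (metis One_nat_def)
qed

lemma smooth_real_affine:
  assumes "smooth_real h"
  shows "smooth_real (\<lambda>s. h (c * s + d))"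
\<comment> \<open>Each differentiation brings out a factor \<open>c\<close>, so the invariant family
  carries a free scalar \<open>a\<close>.\<close>
proof (rule smooth_real_coinduct[where P="\<lambda>f. \<exists>h a. smooth_real h \<and> f = (\<lambda>s. a * h (c * s + d))"])
  show "\<exists>h' a. smooth_real h' \<and> (\<lambda>s. h (c * s + d)) = (\<lambda>s. a * h' (c * s + d))"
    using assms by (intro exI[of _ h] exI[of _ 1]) auto
next
  fix f assume "\<exists>h a. smooth_real h \<and> f = (\<lambda>s. a * h (c * s + d))"
  then obtain h a where h: "smooth_real h" and f: "f = (\<lambda>s. a * h (c * s + d))" by blast
  obtain h' where h': "smooth_real h'" "\<And>s. (h has_real_derivative h' s) (at s)"
    using smooth_real_deriv[OF h] by blast
  have "(f has_real_derivative (a * c) * h' (c * s + d)) (at s)" for s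
    unfolding f by (auto intro!: derivative_eq_intros DERIV_chain2[OF h'(2)])
  then show "\<exists>h'. (\<exists>h a. smooth_real h \<and> h' = (\<lambda>s. a * h (c * s + d))) \<and>
      (\<forall>s. (f has_real_derivative h' s) (at s))"
    using h'(1) by blast
qed

text \<open>Polynomials times the Gaussian are closed under differentiation: \<open>p\<close>
  becomes p' - 2 a s p.\<close>

lemma smooth_real_gauss: "smooth_real (\<lambda>s. exp (- (a * s\<^sup>2)))"
proof (rule smooth_real_coinduct[where P="\<lambda>f. \<exists>p. f = (\<lambda>s. poly p s * exp (- (a * s\<^sup>2)))"])
  show "\<exists>p. (\<lambda>s. exp (- (a * s\<^sup>2))) = (\<lambda>s. poly p s * exp (- (a * s\<^sup>2)))"
    by (rule exI[of _ 1]) simp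
next
  fix f :: "real \<Rightarrow> real" assume "\<exists>p. f = (\<lambda>s. poly p s * exp (- (a * s\<^sup>2)))"
  then obtain p where f: "f = (\<lambda>s. poly p s * exp (- (a * s\<^sup>2)))" by blast
  have "(f has_real_derivative poly (pderiv p + [:0, - 2 * a:] * p) s * exp (- (a * s\<^sup>2))) (at s)" for s
    unfolding f by (auto intro!: derivative_eq_intros simp: algebra_simps)
  then show "\<exists>h'. (\<exists>p. h' = (\<lambda>s. poly p s * exp (- (a * s\<^sup>2)))) \<and> (\<forall>s. (f has_real_derivative h' s) (at s))"
    by blast
qed

text \<open>The classical function that is smooth but not analytic at 0; the compactly supported
  bumps are products of its rescalings.\<close>

definition flat_exp :: "real \<Rightarrow> real" where
  "flat_exp s = (if s > 0 then exp (- (1 / s)) else 0)"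

lemma flat_exp_bounds: "0 \<le> flat_exp s" "flat_exp s \<le> 1" "s \<le> 0 \<Longrightarrow> flat_exp s = 0" "s > 0 \<Longrightarrow> flat_exp s > 0"
  by (auto simp: flat_exp_def)

lemma tendsto_poly_exp_neg: "((\<lambda>u::real. poly p u * exp (- u)) \<longlongrightarrow> 0) at_top"
proof -
  have "((\<lambda>u. \<Sum>i\<le>degree p. coeff p i * (u ^ i / exp u)) \<longlongrightarrow> (\<Sum>i\<le>degree p. coeff p i * 0)) at_top"
    by (intro tendsto_intros tendsto_power_div_exp_0)
  moreover have "(\<lambda>u. \<Sum>i\<le>degree p. coeff p i * (u ^ i / exp u)) = (\<lambda>u. poly p u * exp (- u))"
    by (auto simp: poly_altdef exp_minus field_simps sum_divide_distrib)
  ultimately show ?thesis by simp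
qed

text \<open>The invariant family consists of p(1/s) exp(-1/s), extended by 0 to s \<le> 0. Its
  derivative replaces p by X^2 (p - p'), since differentiating 1/s brings out -1/s^2. Only the point
  0 needs a limit argument.\<close>

lemma smooth_real_flat_exp: "smooth_real flat_exp"
proof -
  define f where "f p s = (if s > 0 then poly p (1 / s) * exp (- (1 / s)) else (0::real))" for p s
  have deriv: "(f p has_real_derivative f (monom 1 2 * (p - pderiv p)) s) (at s)" for p s
  proof -
    consider "s > 0" | "s < 0" | "s = 0" by linarith
    then show ?thesis
    proof cases
      case 1
      have "((\<lambda>s. poly p (1 / s) * exp (- (1 / s))) has_real_derivative f (monom 1 2 * (p - pderiv p)) s) (at s)"
        using 1 by (auto intro!: derivative_eq_intros DERIV_chain2[OF poly_DERIV]
            simp: f_def poly_monom field_simps power2_eq_square)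
      then show ?thesis
        by (rule DERIV_cong_ev[THEN iffD1, rotated -1])
          (use 1 eventually_nhds_in_open[of "{0<..}" s] in \<open>auto simp: f_def elim!: eventually_mono\<close>)
    next
      case 2
      have "((\<lambda>s. 0) has_real_derivative f (monom 1 2 * (p - pderiv p)) s) (at s)"
        using 2 by (auto simp: f_def)
      then show ?thesis
        by (rule DERIV_cong_ev[THEN iffD1, rotated -1])
          (use 2 eventually_nhds_in_open[of "{..<0}" s] in \<open>auto simp: f_def elim!: eventually_mono\<close>)
    next
      case 3
      have "((\<lambda>h. f p h / h) \<longlongrightarrow> 0) (at_right 0)"
      proof -
        \<comment> \<open>Dividing by h multiplies the polynomial by its argument 1/h, which is what
          \<open>pCons 0 p\<close> expresses.\<close>
        have "((\<lambda>h::real. poly (pCons 0 p) (inverse h) * exp (- inverse h)) \<longlongrightarrow> 0) (at_right 0)"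
          by (rule filterlim_compose[OF tendsto_poly_exp_neg filterlim_inverse_at_top_right])
        then show ?thesis
          by (rule Lim_transform_eventually)
            (auto simp: f_def eventually_at_right_field divide_inverse intro!: exI[of _ 1])
      qed
      moreover have "((\<lambda>h. f p h / h) \<longlongrightarrow> 0) (at_left 0)"
        by (rule Lim_transform_eventually[OF tendsto_const])
          (auto simp: f_def eventually_at_left_field intro!: exI[of _ "-1"])
      ultimately have "((\<lambda>h. f p h / h) \<longlongrightarrow> 0) (at 0)"
        by (simp add: filterlim_split_at)
      then show ?thesis using 3 by (simp add: has_field_derivative_iff f_def)
    qed
  qed
  have "flat_exp = f 1" by (auto simp: flat_exp_def f_def fun_eq_iff)
  then show ?thesis
    by (intro smooth_real_coinduct[where P="\<lambda>h. \<exists>p. h = f p"]) (use deriv in blast)+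
qed

text \<open>The smoothness half of \<open>test_function\<close>, separated from the support
  condition so that it also covers the heat kernel.\<close>

definition smooth_fun :: "('a::euclidean_space \<Rightarrow> complex) \<Rightarrow> bool" where
  "smooth_fun f \<longleftrightarrow> (\<forall>bs. set bs \<subseteq> Basis \<longrightarrow> iter_partial bs f differentiable_on UNIV)"

lemma iter_partial_append: "iter_partial (as @ bs) f = iter_partial as (iter_partial bs f)"
  by (induction as) auto

text \<open>The several-variable analogue of \<open>smooth_real_coinduct\<close>: the hypotheses
  concern a single partial derivative, and induction over the list of directions supplies the
  rest.\<close>

lemma smooth_fun_coinduct:
  assumes "P f"
    and diff: "\<And>f. P f \<Longrightarrow> f differentiable_on UNIV"
    and step: "\<And>f b. P f \<Longrightarrow> b \<in> Basis \<Longrightarrow> P (iter_partial [b] f)"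
  shows "smooth_fun f"
proof -
  have "set bs \<subseteq> Basis \<Longrightarrow> P (iter_partial bs f)" for bs
  proof (induction bs)
    case Nil
    then show ?case using \<open>P f\<close> by simp
  next
    case (Cons b bs)
    then have "P (iter_partial [b] (iter_partial bs f))" by (intro step) auto
    then show ?case by simp
  qed
  then show ?thesis unfolding smooth_fun_def using diff by blast
qed

lemma smooth_fun_partial:
  fixes f :: "'a::euclidean_space \<Rightarrow> complex"
  shows "smooth_fun f \<Longrightarrow> b \<in> Basis \<Longrightarrow> smooth_fun (iter_partial [b] f)"
  unfolding smooth_fun_def
proof (intro allI impI)
  fix bs :: "'a list" assume a: "\<forall>bs. set bs \<subseteq> Basis \<longrightarrow> iter_partial bs f differentiable_on UNIV"
    "b \<in> Basis" "set bs \<subseteq> Basis"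
  then have "iter_partial (bs @ [b]) f differentiable_on UNIV" by simp
  then show "iter_partial bs (iter_partial [b] f) differentiable_on UNIV"
    by (simp only: iter_partial_append)
qed

lemma smooth_fun_differentiable_on: "smooth_fun f \<Longrightarrow> f differentiable_on UNIV"
  unfolding smooth_fun_def by (metis empty_subsetI iter_partial.simps(1) set_empty2)

lemma smooth_fun_has_derivative:
  "smooth_fun f \<Longrightarrow> (f has_derivative frechet_derivative f (at x)) (at x)"
  by (meson UNIV_I differentiable_on_def frechet_derivative_works smooth_fun_differentiable_on
      differentiable_within_subset top_greatest)

lemma smooth_fun_continuous_on: "smooth_fun f \<Longrightarrow> continuous_on A f"
  by (meson continuous_on_subset differentiable_imp_continuous_on smooth_fun_differentiable_on top_greatest)

lemma smooth_fun_measurable: "smooth_fun f \<Longrightarrow> f \<in> borel_measurable borel"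
  by (intro borel_measurable_continuous_onI smooth_fun_continuous_on)

lemma iter_partial_eqI:
  assumes "\<And>x. (f has_derivative f' x) (at x)"
  shows "iter_partial [b] f = (\<lambda>x. f' x b)"
  using frechet_derivative_at[OF assms] by auto

lemma iter_partial_mult:
  "smooth_fun f \<Longrightarrow> smooth_fun g \<Longrightarrow>
    iter_partial [b] (\<lambda>x. f x * g x) = (\<lambda>x. f x * iter_partial [b] g x + iter_partial [b] f x * g x)"
  by (rule iter_partial_eqI[THEN trans])
    (auto intro!: has_derivative_mult smooth_fun_has_derivative)

text \<open>By the Leibniz rule, finite sums of products of smooth functions are closed under partial
  derivatives, so coinduction applies to them but not to single products.\<close>

inductive smooth_alg :: "('a::euclidean_space \<Rightarrow> complex) \<Rightarrow> bool" where
  base: "smooth_fun f \<Longrightarrow> smooth_alg f"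
| mult: "smooth_fun f \<Longrightarrow> smooth_fun g \<Longrightarrow> smooth_alg (\<lambda>x. f x * g x)"
| add: "smooth_alg f \<Longrightarrow> smooth_alg g \<Longrightarrow> smooth_alg (\<lambda>x. f x + g x)"

lemma smooth_alg_differentiable: "smooth_alg f \<Longrightarrow> f differentiable_on UNIV"
proof (induction rule: smooth_alg.induct)
  case (mult f g)
  then show ?case by (intro differentiable_on_mult smooth_fun_differentiable_on)
qed (auto intro: differentiable_on_add smooth_fun_differentiable_on)

lemma smooth_alg_partial: "smooth_alg f \<Longrightarrow> b \<in> Basis \<Longrightarrow> smooth_alg (iter_partial [b] f)"
proof (induction rule: smooth_alg.induct)
  case (base f)
  then show ?case by (intro smooth_alg.base smooth_fun_partial)
next
  case (mult f g)
  then show ?case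
    unfolding iter_partial_mult[OF mult(1,2)]
    by (intro smooth_alg.intros smooth_fun_partial)
next
  case (add f g)
  have D: "(h has_derivative frechet_derivative h (at x)) (at x)" if "smooth_alg h" for h :: "'a \<Rightarrow> complex" and x
    using smooth_alg_differentiable[OF that]
    by (meson UNIV_I differentiable_on_def frechet_derivative_works differentiable_within_subset top_greatest)
  have "iter_partial [b] (\<lambda>x. f x + g x) = (\<lambda>x. iter_partial [b] f x + iter_partial [b] g x)"
    by (rule iter_partial_eqI[THEN trans]) (auto intro!: has_derivative_add D add)
  then show ?case using add by (auto intro: smooth_alg.add)
qed

lemma smooth_alg_smooth: "smooth_alg f \<Longrightarrow> smooth_fun f"
  by (rule smooth_fun_coinduct[where P=smooth_alg])
    (auto intro: smooth_alg_differentiable smooth_alg_partial[simplified])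

lemma smooth_fun_mult: "smooth_fun f \<Longrightarrow> smooth_fun g \<Longrightarrow> smooth_fun (\<lambda>x. f x * g x)"
  by (rule smooth_alg_smooth[OF smooth_alg.mult])

lemma smooth_fun_const: "smooth_fun (\<lambda>x. c)"
  by (rule smooth_fun_coinduct[where P="\<lambda>f. \<exists>c. f = (\<lambda>x. c)"]) (auto simp: frechet_derivative_const)

lemma smooth_fun_prod:
  "finite A \<Longrightarrow> (\<And>i. i \<in> A \<Longrightarrow> smooth_fun (f i)) \<Longrightarrow> smooth_fun (\<lambda>x. \<Prod>i\<in>A. f i x)"
  by (induction A rule: finite_induct) (auto intro: smooth_fun_const smooth_fun_mult)

text \<open>Functions of one linear coordinate are the building blocks here: the bumps and the heat
  kernel are both products of such functions over the basis. A derivative in direction b only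
  contributes the scalar \<open>b \<bullet> v\<close>.\<close>

lemma smooth_fun_real:
  assumes "smooth_real h"
  shows "smooth_fun (\<lambda>x. complex_of_real (h (x \<bullet> v)))"
proof (rule smooth_fun_coinduct[where P="\<lambda>f. \<exists>h a. smooth_real h \<and> f = (\<lambda>x. a * complex_of_real (h (x \<bullet> v)))"])
  show "\<exists>h' a. smooth_real h' \<and> (\<lambda>x. complex_of_real (h (x \<bullet> v))) = (\<lambda>x. a * complex_of_real (h' (x \<bullet> v)))"
    using assms by (intro exI[of _ h] exI[of _ 1]) auto
next
  have D: "\<exists>h'. smooth_real h' \<and> (\<forall>x. (f has_derivative (\<lambda>w. a * complex_of_real ((w \<bullet> v) * h' (x \<bullet> v)))) (at x))"
    if h: "smooth_real h" and f: "f = (\<lambda>x. a * complex_of_real (h (x \<bullet> v)))" for f :: "'a \<Rightarrow> complex" and h a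
  proof -
    obtain h' where h': "smooth_real h'" "\<And>s. (h has_real_derivative h' s) (at s)"
      using smooth_real_deriv[OF h] by blast
    have "((\<lambda>x. h (x \<bullet> v)) has_derivative (\<lambda>w. (w \<bullet> v) * h' (x \<bullet> v))) (at x)" for x
      using has_derivative_compose[OF has_derivative_inner_left[OF has_derivative_ident]
          h'(2)[THEN has_field_derivative_imp_has_derivative]] by (simp add: mult.commute)
    then have "(f has_derivative (\<lambda>w. a * complex_of_real ((w \<bullet> v) * h' (x \<bullet> v)))) (at x)" for x
      unfolding f by (intro has_derivative_mult_right has_derivative_of_real)
    then show ?thesis using h'(1) by blast
  qed
  fix f :: "'a \<Rightarrow> complex" assume "\<exists>h a. smooth_real h \<and> f = (\<lambda>x. a * complex_of_real (h (x \<bullet> v)))"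
  then obtain h a h' where h': "smooth_real h'"
      "\<And>x. (f has_derivative (\<lambda>w. a * complex_of_real ((w \<bullet> v) * h' (x \<bullet> v)))) (at x)"
    using D by blast
  show "f differentiable_on UNIV"
    using h'(2) by (meson differentiable_at_imp_differentiable_on differentiable_def)
  fix b :: 'a
  have "iter_partial [b] f = (\<lambda>x. (a * complex_of_real (b \<bullet> v)) * complex_of_real (h' (x \<bullet> v)))"
    using iter_partial_eqI[OF h'(2)] by (auto simp: algebra_simps)
  then show "\<exists>h a. smooth_real h \<and> iter_partial [b] f = (\<lambda>x. a * complex_of_real (h (x \<bullet> v)))"
    using h'(1) by metis
qed

text \<open>Difference quotients are the form of the derivative to which dominated convergence
  applies.\<close>

lemma has_vector_derivative_iff_quotient:
  fixes f :: "real \<Rightarrow> 'b::real_normed_vector"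
  shows "(f has_vector_derivative D) (at x) \<longleftrightarrow> ((\<lambda>h. (f (x + h) - f x) /\<^sub>R h) \<longlongrightarrow> D) (at 0)"
proof -
  have eq: "norm (f (x + h) - f x - h *\<^sub>R D) / norm h = norm ((f (x + h) - f x) /\<^sub>R h - D)" if "h \<noteq> 0" for h
  proof -
    have "(f (x + h) - f x) /\<^sub>R h - D = (f (x + h) - f x - h *\<^sub>R D) /\<^sub>R h"
      using that by (simp add: algebra_simps)
    then show ?thesis by (simp add: divide_inverse mult.commute)
  qed
  have "(f has_vector_derivative D) (at x) \<longleftrightarrow> ((\<lambda>h. norm (f (x + h) - f x - h *\<^sub>R D) / norm h) \<longlongrightarrow> 0) (at 0)"
    by (simp add: has_vector_derivative_def has_derivative_at bounded_linear_scaleR_left)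
  also have "\<dots> \<longleftrightarrow> ((\<lambda>h. norm ((f (x + h) - f x) /\<^sub>R h - D)) \<longlongrightarrow> 0) (at 0)"
    by (intro filterlim_cong refl) (unfold eventually_at_filter, use eq in \<open>auto intro: always_eventually\<close>)
  also have "\<dots> \<longleftrightarrow> ((\<lambda>h. (f (x + h) - f x) /\<^sub>R h) \<longlongrightarrow> D) (at 0)"
    by (simp add: tendsto_norm_zero_iff LIM_zero_iff)
  finally show ?thesis .
qed

section \<open>The space of square-integrable functions\<close>

lemma L2_measurable: "f \<in> L2 \<Longrightarrow> f \<in> borel_measurable borel"
  by (auto simp: L2_def)

lemma L2_square_integrable: "f \<in> L2 \<Longrightarrow> integrable lborel (\<lambda>x. (cmod (f x))\<^sup>2)"
  by (auto simp: L2_def)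

lemma L2_I:
  assumes "f \<in> borel_measurable borel" "integrable lborel g" "\<And>x. (cmod (f x))\<^sup>2 \<le> g x"
  shows "f \<in> L2"
proof -
  note assms(1)[measurable]
  have "integrable lborel (\<lambda>x. (cmod (f x))\<^sup>2)"
    by (rule Bochner_Integration.integrable_bound[OF assms(2)]) (use assms(3) in \<open>auto intro: order_trans[OF _ abs_ge_self]\<close>)
  then show ?thesis using assms(1) by (simp add: L2_def)
qed

lemma L2_bound:
  assumes "f \<in> borel_measurable borel" "g \<in> L2" "\<And>x. cmod (f x) \<le> cmod (g x)"
  shows "f \<in> L2"
  by (rule L2_I[OF assms(1) L2_square_integrable[OF assms(2)]]) (simp add: assms(3) power_mono)

lemma L2_add: "f \<in> L2 \<Longrightarrow> g \<in> L2 \<Longrightarrow> (\<lambda>x. f x + g x) \<in> L2"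
proof (rule L2_I[where g="\<lambda>x. 2 * (cmod (f x))\<^sup>2 + 2 * (cmod (g x))\<^sup>2"])
  assume fg: "f \<in> L2" "g \<in> L2"
  show "(\<lambda>x. f x + g x) \<in> borel_measurable borel"
    using fg[THEN L2_measurable] by simp
  show "integrable lborel (\<lambda>x. 2 * (cmod (f x))\<^sup>2 + 2 * (cmod (g x))\<^sup>2)"
    using fg[THEN L2_square_integrable] by simp
  fix x
  have "(cmod (f x + g x))\<^sup>2 \<le> (cmod (f x) + cmod (g x))\<^sup>2"
    by (intro power_mono norm_triangle_ineq) auto
  also have "\<dots> \<le> 2 * (cmod (f x))\<^sup>2 + 2 * (cmod (g x))\<^sup>2"
    using zero_le_power2[of "cmod (f x) - cmod (g x)"] by (simp add: power2_sum power2_diff)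
  finally show "(cmod (f x + g x))\<^sup>2 \<le> \<dots>" .
qed

lemma L2_cmult: "f \<in> L2 \<Longrightarrow> (\<lambda>x. c * f x) \<in> L2"
  by (auto simp: L2_def norm_mult power_mult_distrib)

lemma L2_zero: "(\<lambda>x. 0) \<in> L2"
  by (simp add: L2_def)

lemma L2_sum: "(\<And>i. i \<in> A \<Longrightarrow> f i \<in> L2) \<Longrightarrow> (\<lambda>x. \<Sum>i\<in>A. f i x) \<in> L2"
  by (induction A rule: infinite_finite_induct) (auto intro: L2_zero L2_add)

lemma L2_cnj: "f \<in> L2 \<Longrightarrow> (\<lambda>x. cnj (f x)) \<in> L2"
  by (auto simp: L2_def intro: borel_measurable_continuous_on[OF continuous_on_cnj[OF continuous_on_id]])

lemma L2_cmod: "f \<in> L2 \<Longrightarrow> (\<lambda>x. complex_of_real (cmod (f x))) \<in> L2"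
  by (auto simp: L2_def)

lemma L2_diff: "f \<in> L2 \<Longrightarrow> g \<in> L2 \<Longrightarrow> (\<lambda>x. f x - g x) \<in> L2"
  using L2_add[OF _ L2_cmult[of g "-1"], of f] by simp

lemma L2_mult_integrable:
  assumes "f \<in> L2" "g \<in> L2"
  shows "integrable lborel (\<lambda>x. f x * g x)"
proof (rule Bochner_Integration.integrable_bound)
  show "integrable lborel (\<lambda>x. (cmod (f x))\<^sup>2 + (cmod (g x))\<^sup>2)"
    using assms[THEN L2_square_integrable] by simp
  show "(\<lambda>x. f x * g x) \<in> borel_measurable lborel"
    using assms[THEN L2_measurable] by simp
  have "a * b \<le> a\<^sup>2 + b\<^sup>2" if "a \<ge> 0" "b \<ge> 0" for a b :: real
    using that sum_squares_bound[of a b] mult_nonneg_nonneg[OF that] by linarith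
  then show "AE x in lborel. norm (f x * g x) \<le> norm ((cmod (f x))\<^sup>2 + (cmod (g x))\<^sup>2)"
    by (auto simp: norm_mult)
qed

definition L2_norm :: "('a::euclidean_space \<Rightarrow> complex) \<Rightarrow> real" where
  "L2_norm f = sqrt (LINT x|lborel. (cmod (f x))\<^sup>2)"

lemma L2_norm_nonneg: "L2_norm f \<ge> 0"
  by (simp add: L2_norm_def)

text \<open>Follows from the inequality for nonnegative integrals applied to the moduli. The pairing
  is bilinear, without conjugation, to match the pairings that define weak derivatives and heat
  convolutions.\<close>

lemma Cauchy_Schwarz_L2:
  assumes "f \<in> L2" "g \<in> L2"
  shows "cmod (LINT x|lborel. f x * g x) \<le> L2_norm f * L2_norm g"
proof -
  note [measurable] = assms[THEN L2_measurable]
  let ?I = "LINT x|lborel. cmod (f x) * cmod (g x)"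
  have int: "integrable lborel (\<lambda>x. cmod (f x) * cmod (g x))"
    using integrable_norm[OF L2_mult_integrable[OF assms]] by (simp add: norm_mult)
  have "ennreal (?I\<^sup>2) = (\<integral>\<^sup>+x. ennreal (cmod (f x)) * ennreal (cmod (g x)) \<partial>lborel)\<^sup>2"
    using int by (simp add: nn_integral_eq_integral ennreal_power flip: ennreal_mult)
  also have "\<dots> \<le> (\<integral>\<^sup>+x. (ennreal (cmod (f x)))\<^sup>2 \<partial>lborel) * (\<integral>\<^sup>+x. (ennreal (cmod (g x)))\<^sup>2 \<partial>lborel)"
    by (rule Cauchy_Schwarz_nn_integral) auto
  also have "\<dots> = ennreal ((L2_norm f)\<^sup>2) * ennreal ((L2_norm g)\<^sup>2)"
    using assms[THEN L2_square_integrable] by (simp add: nn_integral_eq_integral ennreal_power L2_norm_def)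
  also have "\<dots> = ennreal ((L2_norm f * L2_norm g)\<^sup>2)"
    by (simp add: power_mult_distrib flip: ennreal_mult)
  finally have "?I\<^sup>2 \<le> (L2_norm f * L2_norm g)\<^sup>2"
    by (subst (asm) ennreal_le_iff) auto
  then have "?I \<le> L2_norm f * L2_norm g"
    by (rule power2_le_imp_le) (simp add: L2_norm_nonneg)
  moreover have "cmod (LINT x|lborel. f x * g x) \<le> ?I"
    using integral_norm_bound[of lborel "\<lambda>x. f x * g x"] by (simp add: norm_mult)
  ultimately show ?thesis by linarith
qed

section \<open>Test functions and integration by parts\<close>

lemma test_function_iff: "test_function \<phi> \<longleftrightarrow> smooth_fun \<phi> \<and> compact (closure {x. \<phi> x \<noteq> 0})"
  by (simp add: test_function_def smooth_fun_def)

lemma test_functionI: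
  assumes "smooth_fun \<phi>" "compact K" "\<And>x. x \<notin> K \<Longrightarrow> \<phi> x = 0"
  shows "test_function \<phi>"
proof -
  have "closure {x. \<phi> x \<noteq> 0} \<subseteq> K"
    by (intro closure_minimal compact_imp_closed assms) (use assms(3) in blast)
  then show ?thesis
    using assms(1,2) by (auto simp: test_function_iff compact_eq_bounded_closed intro: bounded_subset)
qed

lemma test_function_smooth: "test_function \<phi> \<Longrightarrow> smooth_fun \<phi>"
  by (simp add: test_function_iff)

lemma test_function_mult:
  assumes "smooth_fun f" "test_function \<phi>"
  shows "test_function (\<lambda>x. f x * \<phi> x)"
  using assms closure_subset[of "{x. \<phi> x \<noteq> 0}"]
  by (intro test_functionI[where K="closure {x. \<phi> x \<noteq> 0}"] smooth_fun_mult)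
    (auto simp: test_function_iff)

lemma test_function_partial:
  assumes "test_function \<phi>" "b \<in> Basis"
  shows "test_function (iter_partial [b] \<phi>)"
proof (rule test_functionI[where K="closure {x. \<phi> x \<noteq> 0}"])
  show "smooth_fun (iter_partial [b] \<phi>)" "compact (closure {x. \<phi> x \<noteq> 0})"
    using assms by (auto simp: test_function_iff intro: smooth_fun_partial[simplified])
  fix x assume x: "x \<notin> closure {x. \<phi> x \<noteq> 0}"
  have "((\<lambda>x. 0) has_derivative (\<lambda>h. 0)) (at x)" by simp
  then have "(\<phi> has_derivative (\<lambda>h. 0)) (at x)"
    by (rule has_derivative_transform_within_open[where s="- closure {x. \<phi> x \<noteq> 0}"])
      (use x closure_subset[of "{x. \<phi> x \<noteq> 0}"] in auto)
  then show "iter_partial [b] \<phi> x = 0"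
    using iter_partial.simps by (metis frechet_derivative_at)
qed

lemma test_function_support:
  assumes "test_function \<phi>"
  obtains R where "R > 0" "\<And>x. norm x > R \<Longrightarrow> \<phi> x = 0"
proof -
  have "bounded {x. \<phi> x \<noteq> 0}"
    using assms by (simp add: test_function_iff)
  then obtain R where "R > 0" "\<And>x. x \<in> {x. \<phi> x \<noteq> 0} \<Longrightarrow> norm x \<le> R"
    by (meson bounded_normE)
  then show ?thesis by (intro that[of R]) (auto, metis not_le)
qed

lemma test_function_bounded:
  assumes "test_function \<phi>"
  obtains B where "B \<ge> 0" "\<And>x. cmod (\<phi> x) \<le> B"
proof -
  have "bounded (\<phi> ` closure {x. \<phi> x \<noteq> 0})"
    using assms by (intro compact_imp_bounded compact_continuous_image smooth_fun_continuous_on)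
      (auto simp: test_function_iff)
  then obtain B where "B > 0" "\<And>x. x \<in> closure {x. \<phi> x \<noteq> 0} \<Longrightarrow> cmod (\<phi> x) \<le> B"
    unfolding bounded_pos by blast
  moreover have "\<phi> x = 0" if "x \<notin> closure {x. \<phi> x \<noteq> 0}" for x
    using that closure_subset[of "{x. \<phi> x \<noteq> 0}"] by auto
  ultimately have "cmod (\<phi> x) \<le> B" for x
    by (metis less_imp_le norm_zero)
  then show ?thesis using \<open>B > 0\<close> that[of B] by (simp only: less_imp_le)
qed

lemma integrable_cball_const: "integrable lborel (\<lambda>x::'a::euclidean_space. B * indicator (cball 0 R) x :: real)"
  by (intro integrable_mult_right integrable_real_indicator emeasure_lborel_cball_finite) simp

lemma test_function_L2:
  assumes "test_function \<phi>"
  shows "\<phi> \<in> L2"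
proof -
  obtain R where R: "\<And>x. norm x > R \<Longrightarrow> \<phi> x = 0" using test_function_support[OF assms] by blast
  obtain B where B: "B \<ge> 0" "\<And>x. cmod (\<phi> x) \<le> B" using test_function_bounded[OF assms] by blast
  show ?thesis
  proof (rule L2_I[OF _ integrable_cball_const[of "B\<^sup>2" R]])
    show "(cmod (\<phi> x))\<^sup>2 \<le> B\<^sup>2 * indicator (cball 0 R) x" for x
      using R[of x] B by (auto simp: indicator_def intro: power_mono)
  qed (rule smooth_fun_measurable[OF test_function_smooth[OF assms]])
qed

lemma test_function_integrable:
  assumes "test_function \<phi>"
  shows "integrable lborel \<phi>"
proof -
  obtain R where R: "\<And>x. norm x > R \<Longrightarrow> \<phi> x = 0" using test_function_support[OF assms] by blast
  obtain B where B: "B \<ge> 0" "\<And>x. cmod (\<phi> x) \<le> B" using test_function_bounded[OF assms] by blast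
  show ?thesis
  proof (rule Bochner_Integration.integrable_bound[OF integrable_cball_const[of B R]])
    have "norm (\<phi> x) \<le> norm (B * indicator (cball 0 R) x :: real)" for x
      using R[of x] B by (auto simp: indicator_def)
    then show "AE x in lborel. norm (\<phi> x) \<le> norm (B * indicator (cball 0 R) x :: real)" by simp
  qed (use smooth_fun_measurable[OF test_function_smooth[OF assms]] in simp)
qed

text \<open>The first partial derivatives are test functions and hence bounded. The sum of their
  bounds controls the full derivative, and the mean value inequality turns this into a global
  Lipschitz constant.\<close>

lemma test_function_lipschitz:
  assumes "test_function \<phi>"
  obtains L where "L \<ge> 0" "\<And>x y. cmod (\<phi> x - \<phi> y) \<le> L * norm (x - y)"
proof -
  have "\<exists>B\<ge>0. \<forall>x. cmod (iter_partial [b] \<phi> x) \<le> B" if "b \<in> Basis" for b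
    using test_function_bounded[OF test_function_partial[OF assms that]] by metis
  then obtain B where B: "\<And>b. b \<in> Basis \<Longrightarrow> B b \<ge> 0"
      "\<And>b x. b \<in> Basis \<Longrightarrow> cmod (frechet_derivative \<phi> (at x) b) \<le> B b"
    by (metis iter_partial.simps)
  let ?L = "sum B Basis"
  have D: "(\<phi> has_derivative frechet_derivative \<phi> (at x)) (at x)" for x
    by (intro smooth_fun_has_derivative test_function_smooth assms)
  have le: "cmod (frechet_derivative \<phi> (at x) v) \<le> ?L * norm v" for x v
  proof -
    have "frechet_derivative \<phi> (at x) v = frechet_derivative \<phi> (at x) (\<Sum>b\<in>Basis. (v \<bullet> b) *\<^sub>R b)"
      by (simp add: euclidean_representation)
    also have "\<dots> = (\<Sum>b\<in>Basis. (v \<bullet> b) *\<^sub>R frechet_derivative \<phi> (at x) b)"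
      using has_derivative_linear[OF D] by (simp add: linear_sum linear_cmul)
    also have "cmod \<dots> \<le> (\<Sum>b\<in>Basis. norm v * B b)"
      by (intro sum_norm_le) (auto intro!: mult_mono B Basis_le_norm)
    finally show ?thesis by (simp add: sum_distrib_left mult.commute)
  qed
  show ?thesis
  proof (rule that[of ?L])
    show "0 \<le> ?L" by (intro sum_nonneg B)
    show "cmod (\<phi> x - \<phi> y) \<le> ?L * norm (x - y)" for x y
      by (rule differentiable_bound[of UNIV _ "\<lambda>x. frechet_derivative \<phi> (at x)"])
        (auto intro!: D onorm_le le)
  qed
qed

lemma partial_quotient_tendsto:
  assumes "smooth_fun f"
  shows "((\<lambda>h. (f (x + h *\<^sub>R b) - f x) /\<^sub>R h) \<longlongrightarrow> iter_partial [b] f x) (at 0)"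
proof -
  have "((\<lambda>t. f (x + t *\<^sub>R b)) has_derivative (\<lambda>t. frechet_derivative f (at x) (t *\<^sub>R b))) (at 0)"
    by (rule has_derivative_compose[where g=f and f="\<lambda>t. x + t *\<^sub>R b"])
      (auto intro!: derivative_eq_intros smooth_fun_has_derivative assms)
  moreover have "frechet_derivative f (at x) (t *\<^sub>R b) = t *\<^sub>R frechet_derivative f (at x) b" for t
    using has_derivative_linear[OF smooth_fun_has_derivative[OF assms]] by (simp add: linear_cmul)
  ultimately show ?thesis
    using has_vector_derivative_iff_quotient[of "\<lambda>t. f (x + t *\<^sub>R b)" "frechet_derivative f (at x) b" 0]
    by (simp add: has_vector_derivative_def)
qed

lemma lborel_integral_shift:
  fixes f :: "'a::euclidean_space \<Rightarrow> 'b::{banach, second_countable_topology}"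
  assumes "f \<in> borel_measurable borel"
  shows "(LINT x|lborel. f (c + x)) = (LINT x|lborel. f x)"
proof -
  have "(LINT x|lborel. f x) = (LINT x|distr lborel borel ((+) c). f x)"
    by (simp add: lborel_distr_plus)
  also have "\<dots> = (LINT x|lborel. f (c + x))"
    using assms by (intro integral_distr) auto
  finally show ?thesis ..
qed

lemma lborel_integrable_shift:
  fixes f :: "'a::euclidean_space \<Rightarrow> 'b::{banach, second_countable_topology}"
  assumes "integrable lborel f"
  shows "integrable lborel (\<lambda>x. f (c + x))"
  using assms integrable_distr_eq[of "(+) c" lborel borel f] by (simp add: lborel_distr_plus)

text \<open>By translation invariance every difference quotient of \<open>\<phi>\<close> has
  integral 0. The Lipschitz bound and the compact support dominate the quotients, so the limit may
  be taken under the integral.\<close>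

lemma integral_partial_eq_0:
  fixes \<phi> :: "'a::euclidean_space \<Rightarrow> complex"
  assumes "test_function \<phi>" "b \<in> Basis"
  shows "(LINT x|lborel. iter_partial [b] \<phi> x) = 0"
proof -
  obtain R where R: "R > 0" "\<And>x. norm x > R \<Longrightarrow> \<phi> x = 0" using test_function_support[OF assms(1)] by blast
  obtain L where L: "L \<ge> 0" "\<And>x y. cmod (\<phi> x - \<phi> y) \<le> L * norm (x - y)"
    using test_function_lipschitz[OF assms(1)] by blast
  note sm = test_function_smooth[OF assms(1)]
  note [measurable] = smooth_fun_measurable[OF sm] smooth_fun_measurable[OF smooth_fun_partial[OF sm assms(2)], simplified]
  define h :: "nat \<Rightarrow> real" where "h n = inverse (Suc n)" for n
  have h: "h n > 0" "h n \<le> 1" for n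
    by (auto simp: h_def field_simps)
  have nb: "norm b = 1" using assms(2) by simp
  have h_lim: "filterlim h (at 0) sequentially"
  proof -
    have "h \<longlonglongrightarrow> 0" unfolding h_def by (rule LIMSEQ_inverse_real_of_nat)
    then show ?thesis using h(1) by (auto simp: filterlim_at less_imp_neq[symmetric])
  qed
  have "(\<lambda>n. LINT x|lborel. (\<phi> (x + h n *\<^sub>R b) - \<phi> x) /\<^sub>R h n) \<longlonglongrightarrow> (LINT x|lborel. iter_partial [b] \<phi> x)"
  \<comment> \<open>The shifts have length at most 1, so every quotient vanishes outside the ball of
    radius R + 1.\<close>
  proof (rule integral_dominated_convergence[where w="\<lambda>x. L * indicator (cball 0 (R + 1)) x"])
    show "AE x in lborel. (\<lambda>n. (\<phi> (x + h n *\<^sub>R b) - \<phi> x) /\<^sub>R h n) \<longlonglongrightarrow> iter_partial [b] \<phi> x"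
      using filterlim_compose[OF partial_quotient_tendsto[OF sm] h_lim] by blast
    show "AE x in lborel. norm ((\<phi> (x + h n *\<^sub>R b) - \<phi> x) /\<^sub>R h n) \<le> L * indicator (cball 0 (R + 1)) x" for n
    proof (intro AE_I2)
      fix x :: 'a
      show "norm ((\<phi> (x + h n *\<^sub>R b) - \<phi> x) /\<^sub>R h n) \<le> L * indicator (cball 0 (R + 1)) x"
      proof (cases "norm x \<le> R + 1")
        case True
        have "norm ((\<phi> (x + h n *\<^sub>R b) - \<phi> x) /\<^sub>R h n) \<le> (L * norm (h n *\<^sub>R b)) / h n"
          using L(2)[of "x + h n *\<^sub>R b" x] h[of n] by (simp add: divide_inverse mult.commute)
        then show ?thesis using True h[of n] nb by simp
      next
        case False
        have "norm x \<le> norm (x + h n *\<^sub>R b) + norm (h n *\<^sub>R b)"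
          by (metis add_diff_cancel_right' norm_triangle_ineq4)
        then have "norm (x + h n *\<^sub>R b) > R" using False h[of n] nb by simp
        then show ?thesis using False R by simp
      qed
    qed
  qed (use integrable_cball_const[of L "R + 1"] in auto)
  moreover have "(LINT x|lborel. (\<phi> (x + h n *\<^sub>R b) - \<phi> x) /\<^sub>R h n) = 0" for n
  proof -
    note int = test_function_integrable[OF assms(1)]
    have "(LINT x|lborel. \<phi> (x + h n *\<^sub>R b)) = (LINT x|lborel. \<phi> x)"
      using lborel_integral_shift[of \<phi> "h n *\<^sub>R b"] by (simp add: add.commute)
    moreover have "integrable lborel (\<lambda>x. \<phi> (x + h n *\<^sub>R b))"
      using lborel_integrable_shift[OF int, of "h n *\<^sub>R b"] by (simp add: add.commute)
    ultimately show ?thesis using int by simp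
  qed
  ultimately show ?thesis by (simp only: LIMSEQ_const_iff)
qed

text \<open>The product of \<open>f\<close> and \<open>\<phi>\<close> is itself a test function, so
  its partial derivative integrates to 0; the product rule splits that integral.\<close>

lemma integral_by_parts_test:
  assumes "smooth_fun f" "test_function \<phi>" "b \<in> Basis"
  shows "(LINT x|lborel. f x * iter_partial [b] \<phi> x) = - (LINT x|lborel. iter_partial [b] f x * \<phi> x)"
proof -
  note T = test_function_mult[OF assms(1,2)]
  have I: "integrable lborel (\<lambda>x. f x * iter_partial [b] \<phi> x)" "integrable lborel (\<lambda>x. iter_partial [b] f x * \<phi> x)"
    by (intro test_function_integrable test_function_mult test_function_partial smooth_fun_partial assms)+
  have "0 = (LINT x|lborel. iter_partial [b] (\<lambda>x. f x * \<phi> x) x)"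
    by (rule integral_partial_eq_0[OF T assms(3), symmetric])
  also have "\<dots> = (LINT x|lborel. f x * iter_partial [b] \<phi> x + iter_partial [b] f x * \<phi> x)"
    by (subst iter_partial_mult) (use assms in \<open>auto simp: test_function_smooth\<close>)
  also have "\<dots> = (LINT x|lborel. f x * iter_partial [b] \<phi> x) + (LINT x|lborel. iter_partial [b] f x * \<phi> x)"
    by (rule Bochner_Integration.integral_add[OF I])
  finally show ?thesis by (simp add: eq_neg_iff_add_eq_0)
qed

text \<open>For r > 0 it is positive exactly on the open box with corners \<open>a\<close> and
  \<open>b\<close>: each coordinate contributes one factor per face. As \<open>r\<close> grows the
  bumps tend pointwise to the indicator of the box.\<close>

definition bump :: "real \<Rightarrow> 'a::euclidean_space \<Rightarrow> 'a \<Rightarrow> 'a \<Rightarrow> real" where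
  "bump r a b x = (\<Prod>i\<in>Basis. flat_exp (r * (x \<bullet> i - a \<bullet> i)) * flat_exp (r * (b \<bullet> i - x \<bullet> i)))"

lemma bump_nonneg: "0 \<le> bump r a b x"
  unfolding bump_def by (intro prod_nonneg mult_nonneg_nonneg) (auto simp: flat_exp_bounds)

lemma bump_le_1: "bump r a b x \<le> 1"
  unfolding bump_def by (intro prod_le_1) (auto simp: flat_exp_bounds intro!: mult_le_one)

lemma bump_outside:
  assumes "r > 0" "x \<notin> box a b"
  shows "bump r a b x = 0"
proof -
  obtain i where "i \<in> Basis" "x \<bullet> i \<le> a \<bullet> i \<or> b \<bullet> i \<le> x \<bullet> i"
    using assms(2) by (auto simp: box_def not_less)
  then have "\<exists>i\<in>Basis. flat_exp (r * (x \<bullet> i - a \<bullet> i)) * flat_exp (r * (b \<bullet> i - x \<bullet> i)) = 0"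
    using assms(1) by (intro bexI[of _ i]) (auto simp: flat_exp_bounds mult_nonneg_nonpos)
  then show ?thesis unfolding bump_def by (simp add: prod_zero_iff)
qed

lemma smooth_fun_bump: "smooth_fun (\<lambda>x. complex_of_real (bump r a b x))"
proof -
  have "smooth_fun (\<lambda>x. complex_of_real (flat_exp (r * (x \<bullet> i) + - r * (a \<bullet> i))))"
    "smooth_fun (\<lambda>x. complex_of_real (flat_exp (- r * (x \<bullet> i) + r * (b \<bullet> i))))" for i
    by (intro smooth_fun_real[of "\<lambda>s. flat_exp (c * s + d)" for c d] smooth_real_affine smooth_real_flat_exp)+
  then have "smooth_fun (\<lambda>x. \<Prod>i\<in>Basis. complex_of_real (flat_exp (r * (x \<bullet> i) + - r * (a \<bullet> i))) *
      complex_of_real (flat_exp (- r * (x \<bullet> i) + r * (b \<bullet> i))))"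
    by (intro smooth_fun_prod smooth_fun_mult) auto
  then show ?thesis
    by (simp add: bump_def algebra_simps)
qed

lemma test_function_bump: "r > 0 \<Longrightarrow> test_function (\<lambda>x. complex_of_real (bump r a b x))"
  by (rule test_functionI[OF smooth_fun_bump compact_cbox[of a b]])
    (use bump_outside box_subset_cbox in force)

lemma flat_exp_tendsto_1:
  assumes "(s::real) > 0"
  shows "(\<lambda>n. flat_exp (real (Suc n) * s)) \<longlonglongrightarrow> 1"
proof -
  have "(\<lambda>n. exp (- (1 / s * inverse (real (Suc n))))) \<longlonglongrightarrow> exp (- (1 / s * 0))"
    by (intro tendsto_intros LIMSEQ_inverse_real_of_nat)
  then show ?thesis using assms by (simp add: flat_exp_def divide_inverse ac_simps del: of_nat_Suc)
qed

lemma bump_tendsto_indicator: "(\<lambda>n. bump (Suc n) a b x) \<longlonglongrightarrow> indicator (box a b) x"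
proof (cases "x \<in> box a b")
  case True
  have "(\<lambda>n. bump (Suc n) a b x) \<longlonglongrightarrow> (\<Prod>i\<in>(Basis::'a set). 1 * 1)"
    unfolding bump_def using True
    by (intro tendsto_prod tendsto_mult flat_exp_tendsto_1) (auto simp: box_def simp del: of_nat_Suc)
  then show ?thesis using True by simp
next
  case False
  then show ?thesis by (simp add: bump_outside)
qed

section \<open>Weak derivatives\<close>

text \<open>Bumps are test functions and converge boundedly to indicators of boxes, so the integral
  over every box is 0. Boxes are stable under intersection and generate the Borel sets, so all
  integrals over Borel subsets of a large cube vanish. Local integrability is the right generality:
  it is later applied to the difference of a continuous function and an L2 function.\<close>

lemma fundamental_lemma:
  fixes u :: "'a::euclidean_space \<Rightarrow> complex"
  assumes u: "u \<in> borel_measurable borel"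
    and loc: "\<And>R. integrable lborel (\<lambda>x. indicator (cball 0 R) x *\<^sub>R u x)"
    and zero: "\<And>\<phi>. test_function \<phi> \<Longrightarrow> (LINT x|lborel. u x * \<phi> x) = 0"
  shows "AE x in lborel. u x = 0"
proof -
  note u[measurable]
  have box0: "(LINT x|lborel. indicator (box a b) x *\<^sub>R u x) = 0" for a b
  proof -
    obtain R where R: "box a b \<subseteq> cball 0 R"
      using bounded_box[of a b] by (auto simp: bounded_iff subset_iff)
    have [measurable]: "(\<lambda>x. bump (Suc n) a b x) \<in> borel_measurable borel" for n
      using smooth_fun_measurable[OF smooth_fun_bump[of "Suc n" a b]] by (simp add: borel_measurable_complex_iff)
    have "(\<lambda>n. LINT x|lborel. bump (Suc n) a b x *\<^sub>R u x) \<longlonglongrightarrow> (LINT x|lborel. indicator (box a b) x *\<^sub>R u x)"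
    proof (rule integral_dominated_convergence[where w="\<lambda>x. norm (indicator (cball 0 R) x *\<^sub>R u x)"])
      show "AE x in lborel. (\<lambda>n. bump (Suc n) a b x *\<^sub>R u x) \<longlonglongrightarrow> indicator (box a b) x *\<^sub>R u x"
        by (intro AE_I2 tendsto_scaleR bump_tendsto_indicator tendsto_const)
      show "AE x in lborel. norm (bump (Suc n) a b x *\<^sub>R u x) \<le> norm (indicator (cball 0 R) x *\<^sub>R u x)" for n
      proof (intro AE_I2)
        fix x
        have "bump (Suc n) a b x \<le> indicator (cball 0 R) x"
        proof (cases "x \<in> box a b")
          case True
          then have "x \<in> cball 0 R" using R by blast
          then show ?thesis using bump_le_1[of "Suc n" a b x] by (simp only: indicator_simps)
        next
          case False
          then show ?thesis using bump_outside[of "Suc n" x a b] by simp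
        qed
        then show "norm (bump (Suc n) a b x *\<^sub>R u x) \<le> norm (indicator (cball 0 R) x *\<^sub>R u x)"
          using bump_nonneg[of "Suc n" a b x] by (auto intro!: mult_right_mono)
      qed
    qed (use integrable_norm[OF loc] in \<open>auto simp del: of_nat_Suc\<close>)
    moreover have "(LINT x|lborel. bump (Suc n) a b x *\<^sub>R u x) = 0" for n
      using zero[OF test_function_bump[of "Suc n" a b]] by (simp add: scaleR_conv_of_real mult.commute)
    ultimately show ?thesis by (simp only: LIMSEQ_const_iff)
  qed
  \<comment> \<open>The cutoff to a cube makes the function globally integrable, as both
    \<open>density_zero\<close> and the complement step of the induction require; countably many
    cubes exhaust the space.\<close>
  have "AE x in lborel. indicator (box (- real m *\<^sub>R One) (real m *\<^sub>R One)) x *\<^sub>R u x = 0" for m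
  proof (rule sigma_finite_measure.density_zero[OF sigma_finite_lborel])
    let ?C = "box (- real m *\<^sub>R One) (real m *\<^sub>R One :: 'a)"
    let ?f = "\<lambda>x. indicator ?C x *\<^sub>R u x"
    obtain R where R: "?C \<subseteq> cball 0 R"
      using bounded_box[of "- real m *\<^sub>R One" "real m *\<^sub>R One :: 'a"] by (auto simp: bounded_iff subset_iff)
    show int: "integrable lborel ?f"
      by (rule Bochner_Integration.integrable_bound[OF loc[of R]])
        (use R in \<open>auto simp: indicator_def subset_iff simp del: mem_box intro!: AE_I2\<close>)
    fix A :: "'a set" assume "A \<in> sets lborel"
    then have A: "A \<in> sigma_sets UNIV (range (\<lambda>(a, b). box a b))"
      by (simp add: borel_eq_box)
    have "Int_stable (range (\<lambda>(a, b). box a b :: 'a set))"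
      by (auto simp: Int_stable_def box_Int_box)
    moreover have "range (\<lambda>(a, b). box a b :: 'a set) \<subseteq> Pow UNIV" by simp
    ultimately show "set_lebesgue_integral lborel A ?f = 0" using A
    proof (induction rule: sigma_sets_induct_disjoint)
      case (basic A)
      then obtain a b where A: "A = box a b" by auto
      obtain c d where cd: "A \<inter> ?C = box c d" unfolding A box_Int_box by blast
      have "indicator A x *\<^sub>R ?f x = indicator (box c d) x *\<^sub>R u x" for x
        unfolding cd[symmetric] by (auto simp: indicator_def)
      then show ?case using box0[of c d] by (simp only: set_lebesgue_integral_def)
    next
      case empty
      then show ?case by (simp add: set_lebesgue_integral_def)
    next
      case (compl A)
      then have [measurable]: "A \<in> sets borel" by (simp add: borel_eq_box)
      have "indicator (UNIV - A) x *\<^sub>R ?f x = ?f x - indicator A x *\<^sub>R ?f x" for x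
        by (auto simp: indicator_def)
      then have "set_lebesgue_integral lborel (UNIV - A) ?f = (LINT x|lborel. ?f x) - set_lebesgue_integral lborel A ?f"
        unfolding set_lebesgue_integral_def
        by (simp only:) (intro Bochner_Integration.integral_diff int integrable_mult_indicator, auto)
      then show ?case using compl(2) box0 by simp
    next
      case (union A)
      then have A: "A i \<in> sets lborel" for i by (auto simp: borel_eq_box)
      then have "set_integrable lborel (\<Union>i. A i) ?f"
        unfolding set_integrable_def by (intro integrable_mult_indicator int sets.countable_UN) auto
      then have "set_lebesgue_integral lborel (\<Union>i. A i) ?f = (\<Sum>i. set_lebesgue_integral lborel (A i) ?f)"
        using union(1) A unfolding disjoint_family_on_def
        by (intro lebesgue_integral_countable_add) auto
      then show ?case using union(3) by simp
    qed
  qed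
  then have "AE x in lborel. \<forall>m. indicator (box (- real m *\<^sub>R One) (real m *\<^sub>R One)) x *\<^sub>R u x = 0"
    unfolding AE_all_countable by blast
  then show ?thesis
  proof eventually_elim
    case (elim x)
    obtain m :: nat where m: "norm x < real m" using reals_Archimedean2 by blast
    have "x \<in> box (- real m *\<^sub>R One) (real m *\<^sub>R One)"
      using m Basis_le_norm[of _ x] by (force simp: box_def abs_less_iff intro: le_less_trans)
    then show ?case using elim[rule_format, of m] by simp
  qed
qed

lemma test_function_iter_partial:
  "test_function \<phi> \<Longrightarrow> set bs \<subseteq> Basis \<Longrightarrow> test_function (iter_partial bs \<phi>)"
proof (induction bs)
  case (Cons b bs)
  then have "test_function (iter_partial [b] (iter_partial bs \<phi>))"
    by (intro test_function_partial) auto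
  then show ?case by simp
qed simp

lemma L2_locally_integrable:
  assumes "u \<in> L2"
  shows "integrable lborel (\<lambda>x. indicator (cball 0 R) x *\<^sub>R u x)"
proof -
  have "(\<lambda>x. complex_of_real (indicator (cball 0 R) x)) \<in> L2"
    by (rule L2_I[OF _ integrable_cball_const[of 1 R]]) (auto simp: indicator_def)
  from L2_mult_integrable[OF this assms] show ?thesis
    by (simp add: scaleR_conv_of_real)
qed

lemma has_weak_deriv_unique:
  fixes g :: "'a::euclidean_space \<Rightarrow> complex"
  assumes "has_weak_deriv f bs g" "has_weak_deriv f bs g'" "g \<in> L2" "g' \<in> L2"
  shows "AE x in lborel. g x = g' x"
proof -
  have "AE x in lborel. g x - g' x = 0"
  proof (rule fundamental_lemma)
    have d: "(\<lambda>x. g x - g' x) \<in> L2" by (intro L2_diff assms)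
    then show "(\<lambda>x. g x - g' x) \<in> borel_measurable borel" by (rule L2_measurable)
    show "integrable lborel (\<lambda>x. indicator (cball 0 R) x *\<^sub>R (g x - g' x))" for R
      by (rule L2_locally_integrable[OF d])
    fix \<phi> :: "'a \<Rightarrow> complex" assume \<phi>: "test_function \<phi>"
    note I = assms(3,4)[THEN L2_mult_integrable[OF _ test_function_L2[OF \<phi>]]]
    have "(- 1) ^ length bs * (LINT x|lborel. g x * \<phi> x) = (- 1) ^ length bs * (LINT x|lborel. g' x * \<phi> x)"
      using assms(1,2) \<phi> unfolding has_weak_deriv_def by metis
    then show "(LINT x|lborel. (g x - g' x) * \<phi> x) = 0"
      using I by (simp add: left_diff_distrib)
  qed
  then show ?thesis by simp
qed

text \<open>One L2 candidate makes the choice in \<open>weak_deriv\<close> succeed, and uniqueness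
  identifies the chosen function with the candidate up to a null set.\<close>

lemma weak_deriv_props:
  assumes "g \<in> L2" "has_weak_deriv f bs g"
  shows "weak_deriv bs f \<in> L2" "has_weak_deriv f bs (weak_deriv bs f)"
    "AE x in lborel. weak_deriv bs f x = g x"
proof -
  have "\<exists>g. g \<in> L2 \<and> has_weak_deriv f bs g" using assms by blast
  from someI_ex[OF this] show 1: "weak_deriv bs f \<in> L2" and 2: "has_weak_deriv f bs (weak_deriv bs f)"
    by (simp_all add: weak_deriv_def)
  show "AE x in lborel. weak_deriv bs f x = g x"
    by (rule has_weak_deriv_unique[OF 2 assms(2) 1 assms(1)])
qed

lemma has_weak_deriv_cmult: "has_weak_deriv f bs g \<Longrightarrow> has_weak_deriv (\<lambda>x. c * f x) bs (\<lambda>x. c * g x)"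
  by (simp add: has_weak_deriv_def mult.assoc mult.left_commute)

lemma has_weak_deriv_add:
  assumes "has_weak_deriv f bs g" "has_weak_deriv f' bs g'" "f \<in> L2" "g \<in> L2" "f' \<in> L2" "g' \<in> L2"
    "set bs \<subseteq> Basis"
  shows "has_weak_deriv (\<lambda>x. f x + f' x) bs (\<lambda>x. g x + g' x)"
  unfolding has_weak_deriv_def
proof (intro allI impI)
  fix \<phi> :: "'a \<Rightarrow> complex" assume \<phi>: "test_function \<phi>"
  note I = L2_mult_integrable[OF assms(3) test_function_L2[OF test_function_iter_partial[OF \<phi> assms(7)]]]
    L2_mult_integrable[OF assms(5) test_function_L2[OF test_function_iter_partial[OF \<phi> assms(7)]]]
    L2_mult_integrable[OF assms(4) test_function_L2[OF \<phi>]] L2_mult_integrable[OF assms(6) test_function_L2[OF \<phi>]]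
  show "(LINT x|lborel. (f x + f' x) * iter_partial bs \<phi> x) = (- 1) ^ length bs * (LINT x|lborel. (g x + g' x) * \<phi> x)"
    using I assms(1,2) \<phi> by (simp add: has_weak_deriv_def distrib_right distrib_left)
qed

text \<open>Test the first weak derivative of \<open>f\<close> against the derivative of
  \<open>\<phi>\<close> in direction \<open>b'\<close>. The last entry of the list acts first, which
  is why \<open>[b, b']\<close> peels off in this order.\<close>

lemma has_weak_deriv_partial:
  assumes "has_weak_deriv f [b] g" "has_weak_deriv f [b, b'] h" "b' \<in> Basis"
  shows "has_weak_deriv g [b'] h"
proof -
  have "(LINT x|lborel. g x * iter_partial [b'] \<phi> x) = - (LINT x|lborel. h x * \<phi> x)"
    if \<phi>: "test_function \<phi>" for \<phi>
  proof -
    have "test_function (iter_partial [b'] \<phi>)" by (rule test_function_partial[OF \<phi> assms(3)])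
    then have "(LINT x|lborel. f x * iter_partial [b] (iter_partial [b'] \<phi>) x) = - (LINT x|lborel. g x * iter_partial [b'] \<phi> x)"
      using assms(1) by (simp add: has_weak_deriv_def del: iter_partial.simps)
    moreover have "(LINT x|lborel. f x * iter_partial [b, b'] \<phi> x) = (LINT x|lborel. h x * \<phi> x)"
      using assms(2) \<phi> by (simp add: has_weak_deriv_def del: iter_partial.simps)
    moreover have "iter_partial [b] (iter_partial [b'] \<phi>) = iter_partial [b, b'] \<phi>" by simp
    ultimately show ?thesis by (metis minus_minus)
  qed
  then show ?thesis by (simp add: has_weak_deriv_def)
qed

text \<open>Cut off \<open>f\<close> by dilations of one fixed bump \<open>c0\<close>; their derivatives are \<open>O(1/n)\<close>. The bump need
  not be 1 near the origin since its value \<open>k\<close> there cancels in the limit.\<close>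

lemma weak_deriv_by_parts:
  fixes u :: "'a::euclidean_space \<Rightarrow> complex"
  assumes u: "u \<in> L2" "u' \<in> L2" "has_weak_deriv u [b] u'" and b: "b \<in> Basis"
    and f: "smooth_fun f" "f \<in> L2" "iter_partial [b] f \<in> L2"
  shows "(LINT x|lborel. u x * iter_partial [b] f x) = - (LINT x|lborel. u' x * f x)"
proof -
  define c0 where "c0 x = complex_of_real (bump 1 (- One) One x)" for x :: 'a
  define X where "X n x = c0 (x /\<^sub>R real (Suc n))" for n x
  define k where "k = c0 0"
  have "bump 1 (- One) One (0::'a) > 0"
    unfolding bump_def by (intro prod_pos mult_pos_pos) (auto intro!: flat_exp_bounds)
  then have k: "k \<noteq> 0" by (simp add: k_def c0_def)
  have test: "test_function c0" unfolding c0_def by (rule test_function_bump) simp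
  note sm = test_function_smooth[OF test]
  \<comment> \<open>A dilated bump is again a bump, on the enlarged box and with steepness 1/(n+1);
    this yields its test function property.\<close>
  have Xeq: "X n = (\<lambda>x. complex_of_real (bump (1 / real (Suc n)) (- real (Suc n) *\<^sub>R One) (real (Suc n) *\<^sub>R One) x))" for n
  proof -
    have "1 * ((x /\<^sub>R m) \<bullet> i - (- One) \<bullet> i) = 1 / m * (x \<bullet> i - (- m *\<^sub>R One) \<bullet> i)"
      "1 * (One \<bullet> i - (x /\<^sub>R m) \<bullet> i) = 1 / m * ((m *\<^sub>R One) \<bullet> i - x \<bullet> i)"
      if "i \<in> Basis" "m > 0" for i x :: 'a and m :: real
      using that by (simp_all add: inner_diff_left field_simps)
    then show ?thesis
      unfolding X_def c0_def bump_def by (intro ext arg_cong[of _ _ complex_of_real] prod.cong refl) (simp only: of_nat_0_less_iff zero_less_Suc)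
  qed
  have Xtest: "test_function (X n)" for n unfolding Xeq by (rule test_function_bump) simp
  note Xsm = test_function_smooth[OF Xtest]
  have Xle: "cmod (X n x) \<le> 1" for n x
    by (simp add: X_def c0_def bump_nonneg bump_le_1)
  have Xp: "iter_partial [b] (X n) x = iter_partial [b] c0 (x /\<^sub>R real (Suc n)) /\<^sub>R real (Suc n)" for n x
  proof -
    have D: "(X n has_derivative (\<lambda>h. frechet_derivative c0 (at (x /\<^sub>R real (Suc n))) (h /\<^sub>R real (Suc n)))) (at x)" for x
      unfolding X_def
      by (rule has_derivative_compose[where g=c0 and f="\<lambda>x. x /\<^sub>R real (Suc n)"])
        (auto intro!: derivative_eq_intros smooth_fun_has_derivative sm)
    show ?thesis
      by (subst iter_partial_eqI[OF D])
        (use has_derivative_linear[OF smooth_fun_has_derivative[OF sm]] in \<open>simp add: linear_cmul del: of_nat_Suc\<close>)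
  qed
  obtain L where L: "L \<ge> 0" "\<And>x. cmod (iter_partial [b] c0 x) \<le> L"
    using test_function_bounded[OF test_function_partial[OF test b]] by blast
  have XpL: "cmod (iter_partial [b] (X n) x) \<le> L / real (Suc n)" for n x
    unfolding Xp using L(2)[of "x /\<^sub>R real (Suc n)"] by (simp add: divide_inverse mult.commute mult_left_mono del: of_nat_Suc iter_partial.simps)
  have Xp0: "(\<lambda>n. iter_partial [b] (X n) x) \<longlonglongrightarrow> 0" for x
  proof (rule Lim_null_comparison[OF always_eventually])
    show "\<forall>n. norm (iter_partial [b] (X n) x) \<le> L * inverse (real (Suc n))"
      using XpL by (simp add: divide_inverse)
    show "(\<lambda>n. L * inverse (real (Suc n))) \<longlonglongrightarrow> 0"
      using tendsto_mult_left[OF LIMSEQ_inverse_real_of_nat, of L] by simp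
  qed
  have Xk: "(\<lambda>n. X n x) \<longlonglongrightarrow> k" for x
  proof -
    have "isCont c0 0"
      using smooth_fun_continuous_on[OF sm, of UNIV] by (simp add: continuous_on_eq_continuous_at)
    moreover have "(\<lambda>n. inverse (real (Suc n)) *\<^sub>R x) \<longlonglongrightarrow> 0 *\<^sub>R x"
      by (intro tendsto_scaleR LIMSEQ_inverse_real_of_nat tendsto_const)
    ultimately show ?thesis
      unfolding X_def k_def using isCont_tendsto_compose[of 0 c0 "\<lambda>n. x /\<^sub>R real (Suc n)" sequentially]
      by (simp del: of_nat_Suc)
  qed
  note [measurable] = u(1,2)[THEN L2_measurable] f(2,3)[THEN L2_measurable]
    smooth_fun_measurable[OF Xsm] smooth_fun_measurable[OF smooth_fun_partial[OF Xsm b]]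
  have int: "integrable lborel (\<lambda>x. cmod (u x * iter_partial [b] f x))" "integrable lborel (\<lambda>x. cmod (u x * f x))"
    "integrable lborel (\<lambda>x. cmod (u' x * f x))"
    by (intro integrable_norm L2_mult_integrable u f)+
  have eq: "(LINT x|lborel. u x * (f x * iter_partial [b] (X n) x + iter_partial [b] f x * X n x)) =
      - (LINT x|lborel. u' x * (f x * X n x))" for n
    using u(3)[unfolded has_weak_deriv_def, rule_format, OF test_function_mult[OF f(1) Xtest[of n]]]
    unfolding iter_partial_mult[OF f(1) Xsm] by simp
  have "(\<lambda>n. LINT x|lborel. u x * (f x * iter_partial [b] (X n) x + iter_partial [b] f x * X n x)) \<longlonglongrightarrow>
      (LINT x|lborel. u x * (f x * 0 + iter_partial [b] f x * k))"
  proof (rule integral_dominated_convergence[where w="\<lambda>x. cmod (u x * f x) * L + cmod (u x * iter_partial [b] f x)"])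
    show "AE x in lborel. (\<lambda>n. u x * (f x * iter_partial [b] (X n) x + iter_partial [b] f x * X n x))
        \<longlonglongrightarrow> u x * (f x * 0 + iter_partial [b] f x * k)"
      by (intro AE_I2 tendsto_intros Xk Xp0)
    show "AE x in lborel. norm (u x * (f x * iter_partial [b] (X n) x + iter_partial [b] f x * X n x))
        \<le> cmod (u x * f x) * L + cmod (u x * iter_partial [b] f x)" for n
    proof (intro AE_I2)
      fix x
      have "L / real (Suc n) \<le> L" using L(1) by (simp add: field_simps mult_left_mono)
      then have "cmod (iter_partial [b] (X n) x) \<le> L" using XpL[of n x] by linarith
      then have "cmod (u x * f x) * cmod (iter_partial [b] (X n) x) + cmod (u x * iter_partial [b] f x) * cmod (X n x)
          \<le> cmod (u x * f x) * L + cmod (u x * iter_partial [b] f x) * 1"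
        by (intro add_mono mult_left_mono Xle) auto
      moreover have "norm (u x * (f x * iter_partial [b] (X n) x + iter_partial [b] f x * X n x))
          \<le> cmod (u x * f x) * cmod (iter_partial [b] (X n) x) + cmod (u x * iter_partial [b] f x) * cmod (X n x)"
        unfolding distrib_left mult.assoc[symmetric] norm_mult[symmetric] by (rule norm_triangle_ineq)
      ultimately show "norm (u x * (f x * iter_partial [b] (X n) x + iter_partial [b] f x * X n x))
        \<le> cmod (u x * f x) * L + cmod (u x * iter_partial [b] f x)" by linarith
    qed
    show "integrable lborel (\<lambda>x. cmod (u x * f x) * L + cmod (u x * iter_partial [b] f x))"
      by (intro Bochner_Integration.integrable_add integrable_mult_left int)
  qed (simp_all del: iter_partial.simps)
  moreover have "(\<lambda>n. - (LINT x|lborel. u' x * (f x * X n x))) \<longlonglongrightarrow> - (LINT x|lborel. u' x * (f x * k))"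
  proof (intro tendsto_minus integral_dominated_convergence[where w="\<lambda>x. cmod (u' x * f x)"])
    show "AE x in lborel. (\<lambda>n. u' x * (f x * X n x)) \<longlonglongrightarrow> u' x * (f x * k)"
      by (intro AE_I2 tendsto_intros Xk)
    show "AE x in lborel. norm (u' x * (f x * X n x)) \<le> cmod (u' x * f x)" for n
      using mult_left_mono[OF Xle[of n] norm_ge_zero[of "u' y * f y" for y]]
      by (intro AE_I2) (simp add: norm_mult mult.assoc[symmetric])
  qed (use int in simp_all)
  ultimately have "(LINT x|lborel. u x * (f x * 0 + iter_partial [b] f x * k)) = - (LINT x|lborel. u' x * (f x * k))"
    unfolding eq by (rule LIMSEQ_unique)
  then have "k * (LINT x|lborel. u x * iter_partial [b] f x) = k * - (LINT x|lborel. u' x * f x)"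
    by (simp add: mult.assoc[symmetric] mult.commute[of k] del: iter_partial.simps)
  then show ?thesis by (rule mult_left_cancel[OF k, THEN iffD1])
qed

section \<open>The heat kernel\<close>

text \<open>Lebesgue measure is the image of the product of one-dimensional Lebesgue measures under
  the map from coordinates to vectors. Integrals of products over the coordinates therefore
  factor.\<close>

lemma
  fixes f :: "'a::euclidean_space \<Rightarrow> real \<Rightarrow> 'b::{real_normed_field,banach,second_countable_topology}"
  assumes int: "\<And>i. i \<in> Basis \<Longrightarrow> integrable lborel (f i)"
  shows lborel_integrable_prod: "integrable lborel (\<lambda>x. \<Prod>i\<in>Basis. f i (x \<bullet> i))"
    and lborel_integral_prod: "(LINT x|lborel. (\<Prod>i\<in>Basis. f i (x \<bullet> i))) = (\<Prod>i\<in>Basis. (LINT s|lborel. f i s))"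
proof -
  interpret product_sigma_finite "\<lambda>_::'a. lborel :: real measure" by standard
  have [measurable]: "f i \<in> borel_measurable borel" if "i \<in> Basis" for i
    using borel_measurable_integrable[OF int[OF that]] by simp
  have m: "(\<lambda>x. \<Prod>i\<in>Basis. f i (x \<bullet> i)) \<in> borel_measurable borel"
    by (intro borel_measurable_prod) (use borel_measurable_inner in measurable)
  have T: "(\<lambda>g. \<Sum>b\<in>Basis. g b *\<^sub>R b) \<in> (\<Pi>\<^sub>M b\<in>(Basis::'a set). (lborel::real measure)) \<rightarrow>\<^sub>M borel"
    by measurable
  have eq: "(\<Prod>i\<in>Basis. f i ((\<Sum>b\<in>Basis. g b *\<^sub>R b) \<bullet> i)) = (\<Prod>i\<in>Basis. f i (g i))" for g
    by (intro prod.cong refl) (simp add: inner_sum_left_Basis)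
  have "integrable (\<Pi>\<^sub>M b\<in>(Basis::'a set). (lborel::real measure)) (\<lambda>g. \<Prod>i\<in>Basis. f i (g i))"
    by (intro product_integrable_prod int) auto
  then show "integrable lborel (\<lambda>x. \<Prod>i\<in>Basis. f i (x \<bullet> i))"
    by (subst lborel_eq) (simp add: integrable_distr_eq[OF T m] eq)
  have "(\<integral>g. (\<Prod>i\<in>Basis. f i (g i)) \<partial>(\<Pi>\<^sub>M b\<in>(Basis::'a set). (lborel::real measure))) = (\<Prod>i\<in>Basis. (LINT s|lborel. f i s))"
    by (intro product_integral_prod int) auto
  then show "(LINT x|lborel. (\<Prod>i\<in>Basis. f i (x \<bullet> i))) = (\<Prod>i\<in>Basis. (LINT s|lborel. f i s))"
    by (subst lborel_eq) (simp add: integral_distr[OF T m] eq)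
qed

text \<open>The fundamental solution of du/dt = \<Delta> u, a Gaussian of variance 2t in each
  coordinate. Only t > 0 is meaningful; time integrals below carry a factor that vanishes for t
  \<le> 0.\<close>

definition heat :: "real \<Rightarrow> 'a::euclidean_space \<Rightarrow> real" where
  "heat t x = (1 / sqrt (4 * pi * t)) ^ DIM('a) * exp (- ((norm x)\<^sup>2 / (4 * t)))"

lemma norm_squared_Basis: "(norm (x::'a::euclidean_space))\<^sup>2 = (\<Sum>i\<in>Basis. (x \<bullet> i)\<^sup>2)"
  unfolding power2_norm_eq_inner by (subst euclidean_inner) (simp add: power2_eq_square)

lemma heat_prod: "heat t (x::'a::euclidean_space) = (\<Prod>i\<in>Basis. 1 / sqrt (4 * pi * t) * exp (- ((x \<bullet> i)\<^sup>2 / (4 * t))))"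
proof -
  have "exp (- ((norm x)\<^sup>2 / (4 * t))) = (\<Prod>i\<in>Basis. exp (- ((x \<bullet> i)\<^sup>2 / (4 * t))))"
    by (simp add: norm_squared_Basis exp_sum[symmetric] sum_divide_distrib sum_negf)
  then show ?thesis by (simp only: heat_def prod.distrib prod_constant)
qed

lemma heat_pos: "t > 0 \<Longrightarrow> heat t x > 0"
  by (simp add: heat_def)

lemma heat_measurable[measurable]: "(\<lambda>(t, x). heat t x) \<in> borel_measurable (borel \<Otimes>\<^sub>M borel)"
  unfolding heat_def by measurable

lemma heat_integral:
  assumes "t > 0"
  shows "integrable lborel (heat t :: 'a::euclidean_space \<Rightarrow> real)" "(LINT x|lborel. heat t (x::'a)) = 1"
proof -
  have eq: "(\<lambda>s. 1 / sqrt (4 * pi * t) * exp (- (s\<^sup>2 / (4 * t)))) = normal_density 0 (sqrt (2 * t))"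
    using assms by (auto simp: normal_density_def fun_eq_iff)
  have "integrable lborel (\<lambda>x::'a. \<Prod>i\<in>Basis. normal_density 0 (sqrt (2 * t)) (x \<bullet> i))"
    by (rule lborel_integrable_prod) (use assms in simp)
  then show "integrable lborel (heat t :: 'a \<Rightarrow> real)"
    unfolding heat_prod[abs_def] eq[symmetric, THEN fun_cong] .
  have "(LINT x|lborel. (\<Prod>i\<in>(Basis::'a set). normal_density 0 (sqrt (2 * t)) (x \<bullet> i))) = (\<Prod>i\<in>(Basis::'a set). 1)"
    by (subst lborel_integral_prod) (use assms in simp_all)
  then show "(LINT x|lborel. heat t (x::'a)) = 1"
    unfolding heat_prod[abs_def] eq[symmetric, THEN fun_cong] by simp
qed

text \<open>After rescaling the variable this is the characteristic function of the standard normal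
  distribution.\<close>

lemma gauss_fourier_real:
  assumes "s > 0"
  shows "(LINT u|lborel. exp (\<i> * complex_of_real (u * v)) * complex_of_real (exp (- (s * u\<^sup>2)))) =
      complex_of_real (2 * pi * (1 / sqrt (4 * pi * s) * exp (- (v\<^sup>2 / (4 * s)))))" (is "(LINT u|lborel. ?f u) = _")
    and "integrable lborel (\<lambda>u. exp (\<i> * complex_of_real (u * v)) * complex_of_real (exp (- (s * u\<^sup>2))))"
proof -
  \<comment> \<open>The scale with s c^2 = 1/2, which turns exp(-s u^2) into the exponential of the
    standard normal density.\<close>
  define c where "c = 1 / sqrt (2 * s)"
  have c: "c > 0" "s * c\<^sup>2 = 1 / 2" using assms by (auto simp: c_def power_divide)
  have "(LINT u|lborel. ?f u) = c *\<^sub>R (LINT u|lborel. ?f (0 + c * u))"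
    using lborel_integral_real_affine[of c ?f 0] c by simp
  also have "(LINT u|lborel. ?f (0 + c * u)) = (LINT u|lborel. sqrt (2 * pi) *\<^sub>R (std_normal_density u *\<^sub>R iexp ((c * v) * u)))"
  proof (intro Bochner_Integration.integral_cong refl)
    fix u
    have "s * (c * u)\<^sup>2 = u\<^sup>2 / 2" using c(2) by (simp add: power_mult_distrib mult.assoc[symmetric])
    then show "?f (0 + c * u) = sqrt (2 * pi) *\<^sub>R (std_normal_density u *\<^sub>R iexp ((c * v) * u))"
      by (simp add: std_normal_density_def scaleR_conv_of_real algebra_simps)
  qed
  also have "\<dots> = sqrt (2 * pi) *\<^sub>R (LINT u|lborel. std_normal_density u *\<^sub>R iexp ((c * v) * u))"
    by (rule integral_scaleR_right)
  also have "(LINT u|lborel. std_normal_density u *\<^sub>R iexp ((c * v) * u)) = char std_normal_distribution (c * v)"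
    unfolding char_def by (subst integral_density) auto
  also have "\<dots> = complex_of_real (exp (- (c * v)\<^sup>2 / 2))"
    by (simp add: char_std_normal_distribution)
  also have "c *\<^sub>R (sqrt (2 * pi) *\<^sub>R complex_of_real (exp (- (c * v)\<^sup>2 / 2))) =
      complex_of_real (2 * pi * (1 / sqrt (4 * pi * s) * exp (- (v\<^sup>2 / (4 * s)))))"
  proof -
    have "c * sqrt (2 * pi) = 2 * pi * (1 / sqrt (4 * pi * s))"
    proof -
      define a where "a = sqrt (2 * pi)"
      define b where "b = sqrt (2 * s)"
      have a: "a > 0" "2 * pi = a * a" by (simp_all add: a_def)
      have "sqrt (4 * pi * s) = a * b"
        unfolding a_def b_def by (subst real_sqrt_mult[symmetric]) simp
      then show ?thesis unfolding c_def a_def[symmetric] b_def[symmetric] a(2) using a(1) by simp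
    qed
    moreover have "- (c * v)\<^sup>2 / 2 = - (v\<^sup>2 / (4 * s))"
      using assms by (simp add: c_def power_mult_distrib power_divide)
    ultimately show ?thesis by (simp add: scaleR_conv_of_real mult.assoc[symmetric] flip: of_real_mult)
  qed
  finally show "(LINT u|lborel. ?f u) = complex_of_real (2 * pi * (1 / sqrt (4 * pi * s) * exp (- (v\<^sup>2 / (4 * s)))))"
    using c by (simp add: scaleR_conv_of_real)
  have "integrable lborel (\<lambda>u. sqrt (pi / s) * normal_density 0 (1 / sqrt (2 * s)) u)"
    using assms by (intro integrable_mult_right integrable_normal_density) auto
  moreover have "sqrt (pi / s) * normal_density 0 (1 / sqrt (2 * s)) u = exp (- (s * u\<^sup>2))" for u
    using assms by (simp add: normal_density_def power_divide real_sqrt_divide field_simps)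
  ultimately have "integrable lborel (\<lambda>u. exp (- (s * u\<^sup>2)))" by simp
  then show "integrable lborel ?f"
    by (rule Bochner_Integration.integrable_bound) (auto simp: norm_mult)
qed

text \<open>Both sides factor over the coordinates. Integrability of the Gaussian is read off from
  the case x = 0, where the oscillating factor is 1.\<close>

lemma gauss_fourier:
  fixes x :: "'a::euclidean_space"
  assumes "s > 0"
  shows "(LINT p|lborel. exp (\<i> * complex_of_real (p \<bullet> x)) * complex_of_real (exp (- (s * (norm p)\<^sup>2)))) =
      complex_of_real ((2 * pi) ^ DIM('a) * heat s x)"
    and "integrable lborel (\<lambda>p::'a. exp (- (s * (norm p)\<^sup>2)))"
proof -
  have eq: "exp (\<i> * complex_of_real (p \<bullet> x)) * complex_of_real (exp (- (s * (norm p)\<^sup>2))) =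
      (\<Prod>i\<in>Basis. exp (\<i> * complex_of_real ((p \<bullet> i) * (x \<bullet> i))) * complex_of_real (exp (- (s * (p \<bullet> i)\<^sup>2))))" for p x :: 'a
  proof -
    have "complex_of_real (exp (- (s * (norm p)\<^sup>2))) = (\<Prod>i\<in>Basis. complex_of_real (exp (- (s * (p \<bullet> i)\<^sup>2))))"
      by (simp add: norm_squared_Basis exp_sum[symmetric] sum_distrib_left sum_negf flip: of_real_prod)
    moreover have "exp (\<i> * complex_of_real (p \<bullet> x)) = (\<Prod>i\<in>Basis. exp (\<i> * complex_of_real ((p \<bullet> i) * (x \<bullet> i))))"
      by (subst euclidean_inner) (simp add: exp_sum[symmetric] sum_distrib_left)
    ultimately show ?thesis by (simp add: prod.distrib)
  qed
  show "(LINT p|lborel. exp (\<i> * complex_of_real (p \<bullet> x)) * complex_of_real (exp (- (s * (norm p)\<^sup>2)))) =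
      complex_of_real ((2 * pi) ^ DIM('a) * heat s x)"
    unfolding eq
    by (subst lborel_integral_prod, rule gauss_fourier_real(2)[OF assms])
      (simp only: gauss_fourier_real(1)[OF assms] of_real_prod[symmetric] heat_prod prod.distrib prod_constant power_mult_distrib)
  have "integrable lborel (\<lambda>p::'a. exp (\<i> * complex_of_real (p \<bullet> 0)) * complex_of_real (exp (- (s * (norm p)\<^sup>2))))"
    unfolding eq by (intro lborel_integrable_prod gauss_fourier_real[OF assms])
  then have "integrable lborel (\<lambda>p::'a. complex_of_real (exp (- (s * (norm p)\<^sup>2))))" by simp
  then show "integrable lborel (\<lambda>p::'a. exp (- (s * (norm p)\<^sup>2)))"
    by (rule integrable_norm[THEN back_subst[of "integrable lborel"]]) (simp add: fun_eq_iff)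
qed

text \<open>The iterated partial derivatives of the heat kernel, with junk value 0 beyond order two.\<close>

fun heatD :: "real \<Rightarrow> 'a::euclidean_space list \<Rightarrow> 'a \<Rightarrow> real" where
  "heatD t [] x = heat t x"
| "heatD t [b] x = - (x \<bullet> b) / (2 * t) * heat t x"
| "heatD t [a, b] x = ((x \<bullet> a) * (x \<bullet> b) / (4 * t\<^sup>2) - (a \<bullet> b) / (2 * t)) * heat t x"
| "heatD t (a # b # c # bs) x = 0"

lemma list_length_le_2_cases:
  assumes "length bs \<le> 2"
  obtains "bs = []" | b where "bs = [b]" | a b where "bs = [a, b]"
proof (cases bs)
  case (Cons a as)
  then show ?thesis using assms that by (cases as) auto
qed (use that in auto)

lemma heatD_measurable_pair[measurable]: "(\<lambda>(t, x). heatD t bs x) \<in> borel_measurable (borel \<Otimes>\<^sub>M borel)"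
proof -
  consider "bs = []" | b where "bs = [b]" | a b where "bs = [a, b]" | a b c cs where "bs = a # b # c # cs"
    by (metis list.exhaust)
  then show ?thesis by cases (simp_all add: split_beta')
qed

lemma heatD_shift_measurable[measurable]:
  "(\<lambda>(t, x). heatD t bs (x - y)) \<in> borel_measurable (borel \<Otimes>\<^sub>M borel)"
proof -
  have "(\<lambda>p. (fst p, snd p - y)) \<in> borel \<Otimes>\<^sub>M borel \<rightarrow>\<^sub>M borel \<Otimes>\<^sub>M borel" by measurable
  from measurable_compose[OF this heatD_measurable_pair] show ?thesis by (simp add: split_beta')
qed

lemma heat_has_derivative:
  "t > 0 \<Longrightarrow> ((\<lambda>x. heat t (x - y)) has_derivative (\<lambda>h. - ((x - y) \<bullet> h) / (2 * t) * heat t (x - y))) (at x)"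
  unfolding heat_def power2_norm_eq_inner
  by (auto intro!: derivative_eq_intros simp: fun_eq_iff algebra_simps inner_commute divide_simps)

lemma heatD_has_derivative:
  assumes "t > 0" "length bs \<le> 1"
  shows "((\<lambda>x. complex_of_real (heatD t bs (x - y))) has_derivative (\<lambda>h. complex_of_real (heatD t (h # bs) (x - y)))) (at x)"
proof -
  consider "bs = []" | b where "bs = [b]"
    using assms by (cases bs) auto
  then show ?thesis
  proof cases
    case 1
    show ?thesis unfolding 1 heatD.simps by (rule has_derivative_of_real[OF heat_has_derivative[OF assms(1)]])
  next
    case 2
    have "((\<lambda>x. - ((x - y) \<bullet> b) / (2 * t) * heat t (x - y)) has_derivative
        (\<lambda>h. (((x - y) \<bullet> h) * ((x - y) \<bullet> b) / (4 * t\<^sup>2) - (h \<bullet> b) / (2 * t)) * heat t (x - y))) (at x)"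
      using assms(1) by (auto intro!: derivative_eq_intros heat_has_derivative simp: fun_eq_iff field_simps power2_eq_square)
    then show ?thesis unfolding 2 heatD.simps by (rule has_derivative_of_real)
  qed
qed

lemma iter_partial_heatD:
  "t > 0 \<Longrightarrow> length bs \<le> 1 \<Longrightarrow> iter_partial [a] (\<lambda>x. complex_of_real (heatD t bs (x - y))) =
    (\<lambda>x. complex_of_real (heatD t (a # bs) (x - y)))"
  by (rule iter_partial_eqI[OF heatD_has_derivative])

lemma smooth_fun_heat: "smooth_fun (\<lambda>x. complex_of_real (heat t (x - y)))"
proof -
  \<comment> \<open>The exponent is written with
    \<open>1 * (x \<bullet> i) + - (y \<bullet> i)\<close> so that it matches the affine
    substitution of \<open>smooth_real_affine\<close>.\<close>
  have "smooth_fun (\<lambda>x. complex_of_real (1 / sqrt (4 * pi * t)) * complex_of_real (exp (- (1 / (4 * t) * (1 * (x \<bullet> i) + - (y \<bullet> i))\<^sup>2))))" for i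
    by (intro smooth_fun_mult smooth_fun_const smooth_fun_real[of "\<lambda>s. exp (- (1 / (4 * t) * (1 * s + - (y \<bullet> i))\<^sup>2))"]
        smooth_real_affine[of "\<lambda>s. exp (- (a * s\<^sup>2))" for a] smooth_real_gauss)
  then have "smooth_fun (\<lambda>x. \<Prod>i\<in>Basis. complex_of_real (1 / sqrt (4 * pi * t)) * complex_of_real (exp (- (1 / (4 * t) * (1 * (x \<bullet> i) + - (y \<bullet> i))\<^sup>2))))"
    by (intro smooth_fun_prod) auto
  then show ?thesis by (simp add: heat_prod inner_diff_left)
qed

lemma smooth_fun_heatD:
  assumes t: "t > 0" and bs: "length bs \<le> 2" "set bs \<subseteq> Basis"
  shows "smooth_fun (\<lambda>x. complex_of_real (heatD t bs (x - y)))"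
proof -
  have 0: "smooth_fun (\<lambda>x. complex_of_real (heatD t [] (x - y)))" by (simp add: smooth_fun_heat)
  have 1: "smooth_fun (\<lambda>x. complex_of_real (heatD t [b] (x - y)))" if "b \<in> Basis" for b
    using smooth_fun_partial[OF 0 that] by (subst (asm) iter_partial_heatD[OF t]) simp_all
  have 2: "smooth_fun (\<lambda>x. complex_of_real (heatD t [a, b] (x - y)))" if "a \<in> Basis" "b \<in> Basis" for a b
    using smooth_fun_partial[OF 1[OF that(2)] that(1)] by (subst (asm) iter_partial_heatD[OF t]) simp_all
  show ?thesis
    using bs(2) 0 1 2 by (cases rule: list_length_le_2_cases[OF bs(1)]) simp_all
qed

text \<open>One half of the exponent, with the normalisation corrected by sqrt 2 per coordinate,
  forms the kernel at time 2t; the other half is left over as spare Gaussian decay. It pays for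
  polynomial factors, for translations, and for decay away from the support of a test
  function.\<close>

lemma heat_double: "t > 0 \<Longrightarrow> heat t (x::'a::euclidean_space) = sqrt 2 ^ DIM('a) * (exp (- ((norm x)\<^sup>2 / (8 * t))) * heat (2 * t) x)"
proof -
  assume t: "t > 0"
  have "1 / sqrt (4 * pi * t) = sqrt 2 * (1 / sqrt (4 * pi * (2 * t)))"
  proof -
    have "sqrt (4 * pi * (2 * t)) = sqrt 2 * sqrt (4 * pi * t)"
      by (subst real_sqrt_mult[symmetric]) (simp add: ac_simps)
    then show ?thesis by simp
  qed
  moreover have "exp (- ((norm x)\<^sup>2 / (4 * t))) = exp (- ((norm x)\<^sup>2 / (8 * t))) * exp (- ((norm x)\<^sup>2 / (4 * (2 * t))))"
    by (simp add: mult_exp_exp)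
  ultimately show ?thesis by (simp only: heat_def power_mult_distrib) simp
qed

lemma exp_neg_bounds:
  fixes s :: real
  assumes "s \<ge> 0"
  shows "s * exp (- s) \<le> 1" "sqrt s * exp (- s) \<le> 1" "exp (- s) \<le> 1"
proof -
  have e: "1 + s \<le> exp s" by (rule exp_ge_add_one_self)
  have "sqrt s \<le> 1 + s"
    using assms by (intro real_le_lsqrt) (auto simp: power2_eq_square algebra_simps)
  then have "s \<le> exp s" "sqrt s \<le> exp s" using e by linarith+
  then show "s * exp (- s) \<le> 1" "sqrt s * exp (- s) \<le> 1" "exp (- s) \<le> 1"
    using assms by (simp_all add: exp_minus divide_inverse[symmetric] divide_le_eq_1 inverse_le_1_iff)
qed

text \<open>Doubling the time absorbs the polynomial factors of the derivatives.\<close>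

lemma heatD_bound:
  fixes x :: "'a::euclidean_space"
  assumes t: "t > 0" and bs: "length bs \<le> 2" "set bs \<subseteq> Basis"
  shows "\<bar>heatD t bs x\<bar> \<le> 3 * sqrt 2 ^ DIM('a) * (1 / sqrt t) ^ length bs * heat (2 * t) x"
proof -
  define s where "s = (norm x)\<^sup>2 / (8 * t)"
  define H where "H = sqrt 2 ^ DIM('a) * heat (2 * t) x"
  have s: "s \<ge> 0" using t by (simp add: s_def)
  have H: "H > 0" using t by (simp add: H_def heat_pos)
  have heat: "heat t x = exp (- s) * H"
    using heat_double[OF t, of x] by (simp add: s_def H_def mult_ac)
  note E = exp_neg_bounds[OF s]
  have nx: "norm x = sqrt s * sqrt 8 * sqrt t"
    using t by (simp add: s_def real_sqrt_divide real_sqrt_mult)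
  \<comment> \<open>The single constant 3 serves all orders: the three cases produce 1, sqrt 2 and 2
    + 1/2.\<close>
  have *: "\<bar>heatD t bs x\<bar> \<le> 3 * (1 / sqrt t) ^ length bs * H"
    using bs(1)
  proof (cases rule: list_length_le_2_cases)
    case 1
    have "exp (- s) * H \<le> 3 * H" using E(3) H by (intro mult_right_mono) linarith+
    then show ?thesis using 1 H by (simp add: heat)
  next
    case (2 b)
    have "\<bar>x \<bullet> b\<bar> \<le> norm x" using bs 2 by (intro Basis_le_norm) auto
    then have "\<bar>heatD t bs x\<bar> \<le> norm x / (2 * t) * (exp (- s) * H)"
      unfolding 2 using t H by (simp add: abs_mult heat mult_right_mono divide_right_mono)
    also have "\<dots> = sqrt 2 * (sqrt s * exp (- s)) * (1 / sqrt t) * H"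
    proof -
      have "sqrt 8 = 2 * sqrt 2" using real_sqrt_mult[of 4 2] by simp
      moreover have "sqrt t / t = 1 / sqrt t" using t by (simp add: real_div_sqrt field_simps)
      moreover have "norm x / (2 * t) = sqrt s * (sqrt 8 / 2) * (sqrt t / t)" unfolding nx by simp
      ultimately show ?thesis by simp
    qed
    also have "\<dots> \<le> 3 * 1 * (1 / sqrt t) * H"
      using H t E(2) s real_sqrt_le_mono[of 2 9] by (intro mult_right_mono mult_mono) auto
    finally show ?thesis unfolding 2 by simp
  next
    case (3 a b)
    have "\<bar>x \<bullet> a\<bar> * \<bar>x \<bullet> b\<bar> \<le> norm x * norm x"
      using bs 3 by (intro mult_mono Basis_le_norm) auto
    moreover have "\<bar>a \<bullet> b\<bar> \<le> 1" using bs 3 by (auto simp: inner_Basis)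
    ultimately have "\<bar>(x \<bullet> a) * (x \<bullet> b) / (4 * t\<^sup>2) - (a \<bullet> b) / (2 * t)\<bar> \<le> (norm x)\<^sup>2 / (4 * t\<^sup>2) + 1 / (2 * t)"
      using t by (intro order_trans[OF abs_triangle_ineq4] add_mono)
        (auto simp: abs_mult power2_eq_square divide_right_mono)
    then have "\<bar>heatD t bs x\<bar> \<le> ((norm x)\<^sup>2 / (4 * t\<^sup>2) + 1 / (2 * t)) * (exp (- s) * H)"
      unfolding 3 using H by (simp add: abs_mult heat mult_right_mono)
    also have "(norm x)\<^sup>2 / (4 * t\<^sup>2) = 2 * s / t" using t by (simp add: s_def field_simps power2_eq_square)
    also have "(2 * s / t + 1 / (2 * t)) * (exp (- s) * H) = (2 * (s * exp (- s)) + (1 / 2) * exp (- s)) * (1 / t) * H"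
      using t by (simp add: field_simps)
    also have "\<dots> \<le> 3 * (1 / t) * H"
      using H t E by (intro mult_right_mono, linarith) auto
    also have "1 / t = (1 / sqrt t) ^ 2" using t by (simp add: power_divide)
    also have "2 = length bs" using 3 by simp
    finally show ?thesis .
  qed
  then show ?thesis by (simp add: H_def mult_ac)
qed

text \<open>This is the heat equation. Writing the time derivative through \<open>heatD\<close> lets
  it be moved onto the other factor of a pairing later.\<close>

lemma heat_time_derivative:
  fixes x :: "'a::euclidean_space"
  assumes "t > 0"
  shows "((\<lambda>t. heat t x) has_real_derivative (\<Sum>b\<in>Basis. heatD t [b, b] x)) (at t)"
proof -
  have sum: "(\<Sum>b\<in>Basis. heatD t [b, b] x) = ((norm x)\<^sup>2 / (4 * t\<^sup>2) - DIM('a) / (2 * t)) * heat t x"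
  proof -
    have "(\<Sum>b\<in>Basis. (x \<bullet> b) * (x \<bullet> b) / (4 * t\<^sup>2) - (b \<bullet> b) / (2 * t)) = (\<Sum>b\<in>Basis. (x \<bullet> b)\<^sup>2) / (4 * t\<^sup>2) - DIM('a) / (2 * t)"
      by (simp add: sum_subtractf sum_divide_distrib power2_eq_square)
    then show ?thesis by (simp only: heatD.simps norm_squared_Basis sum_distrib_right[symmetric])
  qed
  define g where "g t = 1 / sqrt (4 * pi * t)" for t
  have "(g has_real_derivative - g t / (2 * t)) (at t)"
    unfolding g_def using assms
    by (auto intro!: derivative_eq_intros simp: field_simps real_sqrt_mult)
  then have "((\<lambda>t. g t ^ DIM('a)) has_real_derivative real DIM('a) * (- g t / (2 * t) * g t ^ (DIM('a) - Suc 0))) (at t)"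
    by (rule DERIV_power)
  also have "real DIM('a) * (- g t / (2 * t) * g t ^ (DIM('a) - Suc 0)) = - real DIM('a) / (2 * t) * g t ^ DIM('a)"
    using DIM_positive[where 'a='a] by (simp add: power_eq_if)
  finally have 1: "((\<lambda>t. g t ^ DIM('a)) has_real_derivative - real DIM('a) / (2 * t) * g t ^ DIM('a)) (at t)" .
  have 2: "((\<lambda>t. exp (- ((norm x)\<^sup>2 / (4 * t)))) has_real_derivative (norm x)\<^sup>2 / (4 * t\<^sup>2) * exp (- ((norm x)\<^sup>2 / (4 * t)))) (at t)"
    using assms by (auto intro!: derivative_eq_intros simp: field_simps power2_eq_square)
  show ?thesis
    using DERIV_mult[OF 1 2] unfolding sum heat_def g_def by (simp add: algebra_simps)
qed

text \<open>Squaring a Gaussian halves its variance. The L2 norm of the heat kernel is thereby known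
  exactly: its square is (8 pi t)^(-d/2).\<close>

lemma heat_square:
  fixes x :: "'a::euclidean_space"
  assumes "t > 0"
  shows "(heat t x)\<^sup>2 = (1 / sqrt (8 * pi * t)) ^ DIM('a) * heat (t / 2) x"
proof -
  have "(1 / sqrt (4 * pi * t))\<^sup>2 = (1 / sqrt (8 * pi * t)) * (1 / sqrt (4 * pi * (t / 2)))"
  proof -
    have "sqrt (8 * pi * t) * sqrt (4 * pi * (t / 2)) = sqrt ((4 * pi * t)\<^sup>2)"
      by (subst real_sqrt_mult[symmetric]) (simp add: power2_eq_square algebra_simps)
    then show ?thesis using assms by (simp add: power_divide)
  qed
  then have "((1 / sqrt (4 * pi * t)) ^ DIM('a))\<^sup>2 = (1 / sqrt (8 * pi * t)) ^ DIM('a) * (1 / sqrt (4 * pi * (t / 2))) ^ DIM('a)"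
    by (metis power_commutes power_mult power_mult_distrib mult.commute)
  moreover have "(exp (- ((norm x)\<^sup>2 / (4 * t))))\<^sup>2 = exp (- ((norm x)\<^sup>2 / (4 * (t / 2))))"
    by (simp add: power2_eq_square mult_exp_exp)
  ultimately show ?thesis unfolding heat_def by (simp only: power_mult_distrib mult.assoc)
qed

lemma heat_shift_square_integral:
  fixes y :: "'a::euclidean_space"
  assumes "t > 0"
  shows "integrable lborel (\<lambda>x. (heat t (x - y))\<^sup>2)"
    "(LINT x|lborel. (heat t (x - y))\<^sup>2) = (1 / sqrt (8 * pi * t)) ^ DIM('a)"
proof -
  have t: "t / 2 > 0" using assms by simp
  note [measurable] = borel_measurable_integrable[OF heat_integral(1)[OF t]]
  show "integrable lborel (\<lambda>x. (heat t (x - y))\<^sup>2)"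
    unfolding heat_square[OF assms]
    using lborel_integrable_shift[OF heat_integral(1)[OF t], of "- y"] by (intro integrable_mult_right) simp
  have "(LINT x|lborel. heat (t / 2) (x - y)) = 1"
    using lborel_integral_shift[of "heat (t / 2)" "- y"] heat_integral[OF t, where 'a='a] by simp
  then show "(LINT x|lborel. (heat t (x - y))\<^sup>2) = (1 / sqrt (8 * pi * t)) ^ DIM('a)"
    unfolding heat_square[OF assms] by simp
qed

text \<open>The set where the functions differ is open, and a nonempty open set is not
  negligible.\<close>

lemma continuous_AE_eq:
  fixes f g :: "'a::euclidean_space \<Rightarrow> 'b::t2_space"
  assumes "continuous_on UNIV f" "continuous_on UNIV g" "AE x in lborel. f x = g x"
  shows "f = g"
proof (rule ccontr)
  assume "f \<noteq> g"
  let ?S = "{x. f x \<noteq> g x}"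
  have op: "open ?S" using assms(1,2) by (rule open_Collect_neq)
  have "AE x in lebesgue. f x = g x" using assms(3) by (rule AE_completion)
  then have "?S \<in> null_sets lebesgue"
    using op by (subst AE_iff_null_sets) (auto intro: sets_completionI_sets)
  then have "negligible ?S" by (simp add: negligible_iff_null_sets)
  moreover have "?S \<noteq> {}" using \<open>f \<noteq> g\<close> by auto
  ultimately show False using open_not_negligible[OF op] by blast
qed

lemma cont_rep_eqI:
  assumes "continuous_on UNIV h" "AE x in lborel. h x = f x"
  shows "cont_rep f = h"
  unfolding cont_rep_def
proof (rule the_equality)
  fix h' assume "continuous_on UNIV h' \<and> (AE x in lborel. h' x = f x)"
  then have h': "continuous_on UNIV h'" and "AE x in lborel. h' x = f x" by auto
  from this(2) assms(2) have "AE x in lborel. h' x = h x" by eventually_elim simp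
  then show "h' = h" by (rule continuous_AE_eq[OF h' assms(1)])
qed (use assms in blast)

text \<open>Differentiation under the integral sign: on the window of radius \<open>\<delta>\<close>
  the mean value inequality bounds all difference quotients by \<open>B\<close>, and dominated
  convergence applies along sequences.\<close>

lemma has_vector_derivative_lborel_integral:
  fixes F :: "real \<Rightarrow> 'a::euclidean_space \<Rightarrow> complex"
  assumes "\<delta> > 0"
    and deriv: "\<And>s x. \<bar>s - t\<bar> < \<delta> \<Longrightarrow> ((\<lambda>s. F s x) has_vector_derivative F' s x) (at s)"
    and bound: "\<And>s x. \<bar>s - t\<bar> < \<delta> \<Longrightarrow> norm (F' s x) \<le> B x"
    and B: "integrable lborel B"
    and F: "\<And>s. \<bar>s - t\<bar> < \<delta> \<Longrightarrow> integrable lborel (F s)"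
    and meas: "F' t \<in> borel_measurable lborel"
  shows "((\<lambda>s. LINT x|lborel. F s x) has_vector_derivative (LINT x|lborel. F' t x)) (at t)"
  unfolding has_vector_derivative_iff_quotient tendsto_at_iff_sequentially comp_def
proof (intro allI impI)
  fix X :: "nat \<Rightarrow> real" assume X0: "\<forall>i. X i \<in> UNIV - {0}" and X: "X \<longlonglongrightarrow> 0"
  have "eventually (\<lambda>i. \<bar>X i\<bar> < \<delta>) sequentially"
    using X \<open>\<delta> > 0\<close> by (simp add: tendsto_iff)
  then obtain N where N: "\<And>i. i \<ge> N \<Longrightarrow> \<bar>X i\<bar> < \<delta>"
    by (auto simp: eventually_sequentially)
  have int: "integrable lborel (F t)" "integrable lborel (F (t + X (i + N)))" for i
    using N[of "i + N"] \<open>\<delta> > 0\<close> by (auto intro!: F)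
  note [measurable] = borel_measurable_integrable[OF int(1)] borel_measurable_integrable[OF int(2)]
  have "(\<lambda>i. LINT x|lborel. (F (t + X (i + N)) x - F t x) /\<^sub>R X (i + N)) \<longlonglongrightarrow> (LINT x|lborel. F' t x)"
  proof (rule integral_dominated_convergence[where w=B, OF meas _ B])
    show "AE x in lborel. (\<lambda>i. (F (t + X (i + N)) x - F t x) /\<^sub>R X (i + N)) \<longlonglongrightarrow> F' t x"
    proof (intro AE_I2)
      fix x
      have "((\<lambda>h. (F (t + h) x - F t x) /\<^sub>R h) \<longlongrightarrow> F' t x) (at 0)"
        using deriv[of t x] \<open>\<delta> > 0\<close> by (simp add: has_vector_derivative_iff_quotient)
      moreover have "filterlim (\<lambda>i. X (i + N)) (at 0) sequentially"
        using X0 LIMSEQ_ignore_initial_segment[OF X, of N] by (auto simp: filterlim_at)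
      ultimately show "(\<lambda>i. (F (t + X (i + N)) x - F t x) /\<^sub>R X (i + N)) \<longlonglongrightarrow> F' t x"
        by (rule filterlim_compose)
    qed
    show "AE x in lborel. norm ((F (t + X (i + N)) x - F t x) /\<^sub>R X (i + N)) \<le> B x" for i
    proof (intro AE_I2)
      fix x
      let ?S = "{t - \<delta><..<t + \<delta>}"
      have "norm (F (t + X (i + N)) x - F t x) \<le> B x * norm (t + X (i + N) - t)"
      proof (rule differentiable_bound[where S="?S" and f'="\<lambda>s h. h *\<^sub>R F' s x"])
        fix s assume s: "s \<in> ?S"
        then have "((\<lambda>s. F s x) has_derivative (\<lambda>h. h *\<^sub>R F' s x)) (at s)"
          using deriv[of s x] by (auto simp: has_vector_derivative_def abs_less_iff)
        then show "((\<lambda>s. F s x) has_derivative (\<lambda>h. h *\<^sub>R F' s x)) (at s within ?S)"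
          by (rule has_derivative_at_withinI)
        have "norm (F' s x) \<le> B x" using s by (intro bound) (auto simp: abs_less_iff)
        then show "onorm (\<lambda>h. h *\<^sub>R F' s x) \<le> B x"
          by (intro onorm_le) (auto simp: mult.commute[of "B x"] intro!: mult_left_mono)
      qed (use N[of "i + N"] \<open>\<delta> > 0\<close> in \<open>auto simp: abs_less_iff\<close>)
      then show "norm ((F (t + X (i + N)) x - F t x) /\<^sub>R X (i + N)) \<le> B x"
        using X0[rule_format, of "i + N"] by (simp add: divide_inverse_commute[symmetric] pos_divide_le_eq)
    qed
  qed measurable
  then have "(\<lambda>i. ((LINT x|lborel. F (t + X (i + N)) x) - (LINT x|lborel. F t x)) /\<^sub>R X (i + N)) \<longlonglongrightarrow> (LINT x|lborel. F' t x)"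
    by (simp add: Bochner_Integration.integral_diff[OF int(2) int(1)])
  then show "(\<lambda>i. ((LINT x|lborel. F (t + X i) x) - (LINT x|lborel. F t x)) /\<^sub>R X i) \<longlonglongrightarrow> (LINT x|lborel. F' t x)"
    by (rule LIMSEQ_offset)
qed

section \<open>The Sobolev space and L2 estimates for the heat kernel\<close>

lemma H2_L2: "g \<in> H2 \<Longrightarrow> g \<in> L2"
  by (simp add: H2_def)

lemma H2_weak_deriv:
  assumes "g \<in> H2" "set bs \<subseteq> Basis" "length bs \<le> 2"
  shows "weak_deriv bs g \<in> L2" "has_weak_deriv g bs (weak_deriv bs g)"
proof -
  obtain w where "w \<in> L2" "has_weak_deriv g bs w" using assms unfolding H2_def by blast
  then show "weak_deriv bs g \<in> L2" "has_weak_deriv g bs (weak_deriv bs g)"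
    by (rule weak_deriv_props)+
qed

lemma weak_laplacian_L2: "g \<in> H2 \<Longrightarrow> weak_laplacian g \<in> L2"
  unfolding weak_laplacian_def by (intro L2_sum H2_weak_deriv) auto

lemma heat_L2:
  assumes "t > 0"
  shows "(\<lambda>x. complex_of_real (heat t (x - y))) \<in> L2"
proof (rule L2_I[OF _ heat_shift_square_integral(1)[OF assms, of y]])
  show "(\<lambda>x. complex_of_real (heat t (x - y))) \<in> borel_measurable borel"
    by (rule smooth_fun_measurable[OF smooth_fun_heat])
qed simp

lemma heat_L2_norm:
  fixes y :: "'a::euclidean_space"
  assumes "t > 0"
  shows "L2_norm (\<lambda>x. complex_of_real (heat t (x - y))) = sqrt ((1 / sqrt (8 * pi * t)) ^ DIM('a))"
  using heat_shift_square_integral(2)[OF assms, of y] by (simp add: L2_norm_def)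

text \<open>One majorant for all admissible dimensions: if 1 / sqrt t \<le> 1 the power is at most
  1, otherwise the exponent 3 is the worst one.\<close>

lemma heat_power_bound:
  assumes t: "t > 0" and d: "d \<le> 3" and c: "c \<ge> 1"
  shows "(1 / sqrt (c * t)) ^ d \<le> 1 + (1 / sqrt t) ^ 3"
proof -
  have "1 / sqrt (c * t) \<le> 1 / sqrt t"
    using t c by (simp add: frac_le)
  then have "(1 / sqrt (c * t)) ^ d \<le> (1 / sqrt t) ^ d"
    using t c by (intro power_mono) auto
  also have "\<dots> \<le> 1 + (1 / sqrt t) ^ 3"
  proof (cases "1 / sqrt t \<le> 1")
    case True
    then have "(1 / sqrt t) ^ d \<le> 1" using t by (intro power_le_one) auto
    then show ?thesis using t by (simp add: add_increasing2)
  next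
    case False
    then have "(1 / sqrt t) ^ d \<le> (1 / sqrt t) ^ 3" using d by (intro power_increasing) auto
    then show ?thesis by simp
  qed
  finally show ?thesis .
qed

lemma inverse_sqrt_powr: "t > 0 \<Longrightarrow> (1 / sqrt t) ^ n = t powr (- (real n / 2))"
proof -
  assume t: "t > 0"
  then have "1 / sqrt t = t powr (- (1 / 2))"
    by (simp only: powr_minus_divide powr_half_sqrt[OF less_imp_le])
  then have "(1 / sqrt t) ^ n = t powr (real n * - (1 / 2))"
    using t powr_power[where z=t and n=n and u="- (1 / 2)"] by simp
  then show ?thesis by simp
qed

text \<open>The exponent \<open>- 3 / 4\<close> is integrable at 0; this is where the dimension is restricted.\<close>

lemma heat_L2_norm_bound:
  fixes y :: "'a::euclidean_space"
  assumes "t > 0" "DIM('a) \<le> 3"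
  shows "L2_norm (\<lambda>x. complex_of_real (heat t (x - y))) \<le> 1 + t powr (- 3 / 4)"
proof -
  have "8 * pi \<ge> 1" using pi_gt3 by linarith
  then have "(1 / sqrt (8 * pi * t)) ^ DIM('a) \<le> 1 + t powr (- (3 / 2))"
    using heat_power_bound[OF assms(1,2), of "8 * pi"] inverse_sqrt_powr[OF assms(1), of 3] by simp
  also have "\<dots> \<le> (1 + t powr (- 3 / 4))\<^sup>2"
    using assms(1) by (simp add: power2_sum powr_power)
  finally show ?thesis
    unfolding heat_L2_norm[OF assms(1)] by (intro real_le_lsqrt) auto
qed

lemma heatD_shift_measurable1: "(\<lambda>x. complex_of_real (heatD t bs (x - y))) \<in> borel_measurable borel"
proof -
  have "(\<lambda>x. (t, x)) \<in> borel \<rightarrow>\<^sub>M borel \<Otimes>\<^sub>M borel" by measurable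
  from measurable_compose[OF this heatD_shift_measurable[of bs y]] show ?thesis by simp
qed

lemma heatD_L2:
  fixes y :: "'a::euclidean_space"
  assumes "t > 0" "length bs \<le> 2" "set bs \<subseteq> Basis"
  shows "(\<lambda>x. complex_of_real (heatD t bs (x - y))) \<in> L2"
proof (rule L2_bound[OF heatD_shift_measurable1 L2_cmult[OF heat_L2]])
  show "cmod (complex_of_real (heatD t bs (x - y))) \<le>
      cmod (complex_of_real (3 * sqrt 2 ^ DIM('a) * (1 / sqrt t) ^ length bs) * complex_of_real (heat (2 * t) (x - y)))" for x
    using heatD_bound[OF assms, of "x - y"] assms(1) heat_pos[of "2 * t" "x - y"] by (simp add: norm_mult norm_power norm_divide)
qed (use assms in simp)

text \<open>Provides a majorant independent of s on the time window [t/2, 2t], as differentiation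
  under the integral requires. The factor 2 per coordinate compares the normalisations, using s
  \<ge> t/2.\<close>

lemma heat_time_mono:
  fixes z :: "'a::euclidean_space"
  assumes "t / 2 \<le> s" "s \<le> 2 * t" "t > 0"
  shows "heat (2 * s) z \<le> 2 ^ DIM('a) * heat (4 * t) z"
proof -
  have "1 / sqrt (4 * pi * (2 * s)) \<le> 1 / sqrt (4 * pi * t)"
    using assms by (intro divide_left_mono) auto
  also have "\<dots> = 2 * (1 / sqrt (4 * pi * (4 * t)))"
  proof -
    have "sqrt (4 * pi * (4 * t)) = 2 * sqrt (4 * pi * t)"
      using real_sqrt_mult[of 4 "4 * pi * t"] by (simp add: mult_ac)
    then show ?thesis by simp
  qed
  finally have "(1 / sqrt (4 * pi * (2 * s))) ^ DIM('a) \<le> 2 ^ DIM('a) * (1 / sqrt (4 * pi * (4 * t))) ^ DIM('a)"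
    unfolding power_mult_distrib[symmetric] using assms by (intro power_mono) auto
  moreover have "exp (- ((norm z)\<^sup>2 / (4 * (2 * s)))) \<le> exp (- ((norm z)\<^sup>2 / (4 * (4 * t))))"
    using assms by (simp add: divide_left_mono)
  ultimately show ?thesis
    unfolding heat_def mult.assoc[symmetric] by (intro mult_mono) (use assms in auto)
qed

section \<open>Convolution with the heat kernel\<close>

definition heat_conv :: "real \<Rightarrow> ('a::euclidean_space \<Rightarrow> complex) \<Rightarrow> 'a \<Rightarrow> complex" where
  "heat_conv t u y = (LINT x|lborel. complex_of_real (heat t (x - y)) * u x)"

text \<open>The Laplacian stays on the kernel, so the expression makes sense for any L2 function; it
  is later applied to \<open>weak_laplacian g\<close>.\<close>

definition heat_lap_conv :: "real \<Rightarrow> ('a::euclidean_space \<Rightarrow> complex) \<Rightarrow> 'a \<Rightarrow> complex" where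
  "heat_lap_conv t u y = (LINT x|lborel. complex_of_real (\<Sum>b\<in>Basis. heatD t [b, b] (x - y)) * u x)"

lemma heat_conv_deriv:
  fixes u :: "'a::euclidean_space \<Rightarrow> complex"
  assumes t: "t > 0" and u: "u \<in> L2"
  shows "((\<lambda>t. heat_conv t u y) has_vector_derivative heat_lap_conv t u y) (at t)"
  unfolding heat_conv_def heat_lap_conv_def
proof (rule has_vector_derivative_lborel_integral[where \<delta>="t / 2"])
  \<comment> \<open>For |s - t| < t/2 one has 1/s \<le> 2/t, and the kernel at time 2s is at most
    2^d times the kernel at time 4t. Together with the second-derivative bound, summed over the
    basis, this gives the constant.\<close>
  let ?C = "real DIM('a) * (3 * sqrt 2 ^ DIM('a) * (2 / t) * 2 ^ DIM('a))"
  have pos: "s > 0" if "\<bar>s - t\<bar> < t / 2" for s using that by arith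
  show "((\<lambda>s. complex_of_real (heat s (x - y)) * u x) has_vector_derivative
      complex_of_real (\<Sum>b\<in>Basis. heatD s [b, b] (x - y)) * u x) (at s)" if "\<bar>s - t\<bar> < t / 2" for s x
    by (intro has_vector_derivative_mult_left has_vector_derivative_of_real
        heat_time_derivative pos that)
  show "integrable lborel (\<lambda>x. ?C * cmod (complex_of_real (heat (4 * t) (x - y)) * u x))"
    using t by (intro integrable_mult_right integrable_norm L2_mult_integrable heat_L2 u) auto
  show "integrable lborel (\<lambda>x. complex_of_real (heat s (x - y)) * u x)" if "\<bar>s - t\<bar> < t / 2" for s
    by (intro L2_mult_integrable heat_L2 u pos that)
  show "(\<lambda>x. complex_of_real (\<Sum>b\<in>Basis. heatD t [b, b] (x - y)) * u x) \<in> borel_measurable lborel"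
    using L2_measurable[OF u] heatD_shift_measurable1[of t "[b, b]" y for b] unfolding of_real_sum
    by (intro borel_measurable_times borel_measurable_sum) simp_all
  show "norm (complex_of_real (\<Sum>b\<in>Basis. heatD s [b, b] (x - y)) * u x)
      \<le> ?C * cmod (complex_of_real (heat (4 * t) (x - y)) * u x)" if s: "\<bar>s - t\<bar> < t / 2" for s x
  proof -
    have s': "t / 2 \<le> s" "s \<le> 2 * t" "s > 0" using s t by arith+
    have "\<bar>heatD s [b, b] (x - y)\<bar> \<le> 3 * sqrt 2 ^ DIM('a) * (2 / t) * 2 ^ DIM('a) * heat (4 * t) (x - y)" if "b \<in> Basis" for b
    proof -
      have "\<bar>heatD s [b, b] (x - y)\<bar> \<le> 3 * sqrt 2 ^ DIM('a) * (1 / sqrt s) ^ length [b, b] * heat (2 * s) (x - y)"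
        using that by (intro heatD_bound s') auto
      also have "(1 / sqrt s) ^ length [b, b] = 1 / s" using s' by (simp add: power2_eq_square[symmetric] power_divide)
      also have "3 * sqrt 2 ^ DIM('a) * (1 / s) * heat (2 * s) (x - y) \<le> 3 * sqrt 2 ^ DIM('a) * (2 / t) * (2 ^ DIM('a) * heat (4 * t) (x - y))"
        using s' t heat_pos[of "2 * s" "x - y"] by (intro mult_mono heat_time_mono) (auto simp: field_simps)
      finally show ?thesis by (simp add: mult.assoc)
    qed
    then have "\<bar>\<Sum>b\<in>Basis. heatD s [b, b] (x - y)\<bar> \<le> (\<Sum>b\<in>(Basis::'a set). 3 * sqrt 2 ^ DIM('a) * (2 / t) * 2 ^ DIM('a) * heat (4 * t) (x - y))"
      by (intro order_trans[OF sum_abs] sum_mono)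
    then have "\<bar>\<Sum>b\<in>Basis. heatD s [b, b] (x - y)\<bar> \<le> ?C * heat (4 * t) (x - y)" by (simp only: sum_constant mult.assoc)
    then have "\<bar>\<Sum>b\<in>Basis. heatD s [b, b] (x - y)\<bar> * cmod (u x) \<le> ?C * heat (4 * t) (x - y) * cmod (u x)"
      by (rule mult_right_mono) simp
    then show ?thesis
      using heat_pos[of "4 * t" "x - y"] t unfolding norm_mult norm_of_real by (simp only: abs_of_pos mult.assoc zero_less_mult_iff) simp
  qed
qed (use t in simp)

text \<open>Derivatives move from the kernel to \<open>g\<close> one at a time: the kernel and its
  first derivative are smooth and in L2, so \<open>weak_deriv_by_parts\<close> applies to each
  although neither has compact support.\<close>

lemma heat_conv_partial:
  assumes t: "t > 0" and g: "g \<in> H2" and b: "b \<in> Basis"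
  shows "(LINT x|lborel. complex_of_real (heatD t [b] (x - y)) * weak_deriv [b] g x) = - heat_conv t (weak_deriv [b, b] g) y"
    and "(LINT x|lborel. complex_of_real (heatD t [b, b] (x - y)) * g x) = heat_conv t (weak_deriv [b, b] g) y"
proof -
  have W1: "weak_deriv [b] g \<in> L2" "has_weak_deriv g [b] (weak_deriv [b] g)"
    using b by (auto intro!: H2_weak_deriv g)
  have W2: "weak_deriv [b, b] g \<in> L2" "has_weak_deriv g [b, b] (weak_deriv [b, b] g)"
    using b by (auto intro!: H2_weak_deriv g)
  have S: "smooth_fun (\<lambda>x. complex_of_real (heatD t [] (x - y)))" "smooth_fun (\<lambda>x. complex_of_real (heatD t [b] (x - y)))"
    using b by (auto intro!: smooth_fun_heatD[OF t] simp del: heatD.simps)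
  have L: "(\<lambda>x. complex_of_real (heatD t [] (x - y))) \<in> L2" "(\<lambda>x. complex_of_real (heatD t [b] (x - y))) \<in> L2"
    "(\<lambda>x. complex_of_real (heatD t [b, b] (x - y))) \<in> L2"
    using b by (auto intro!: heatD_L2[OF t] simp del: heatD.simps)
  have D: "iter_partial [b] (\<lambda>x. complex_of_real (heatD t [] (x - y))) = (\<lambda>x. complex_of_real (heatD t [b] (x - y)))"
    "iter_partial [b] (\<lambda>x. complex_of_real (heatD t [b] (x - y))) = (\<lambda>x. complex_of_real (heatD t [b, b] (x - y)))"
    by (rule iter_partial_heatD[OF t]; simp)+
  show 1: "(LINT x|lborel. complex_of_real (heatD t [b] (x - y)) * weak_deriv [b] g x) = - heat_conv t (weak_deriv [b, b] g) y"
    using weak_deriv_by_parts[OF W1(1) W2(1) has_weak_deriv_partial[OF W1(2) W2(2) b] b S(1) L(1)] L(2)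
    unfolding D by (simp add: heat_conv_def mult.commute)
  have "(LINT x|lborel. g x * complex_of_real (heatD t [b, b] (x - y))) = - (LINT x|lborel. weak_deriv [b] g x * complex_of_real (heatD t [b] (x - y)))"
    using weak_deriv_by_parts[OF H2_L2[OF g] W1 b S(2) L(2)] L(3) unfolding D by blast
  then show "(LINT x|lborel. complex_of_real (heatD t [b, b] (x - y)) * g x) = heat_conv t (weak_deriv [b, b] g) y"
    using 1 by (simp add: mult.commute)
qed

lemma heat_conv_laplacian:
  assumes t: "t > 0" and g: "g \<in> H2"
  shows "(\<Sum>b\<in>Basis. heat_conv t (weak_deriv [b, b] g) y) = heat_conv t (weak_laplacian g) y"
  unfolding heat_conv_def weak_laplacian_def sum_distrib_left
  by (rule Bochner_Integration.integral_sum[symmetric])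
    (auto intro!: L2_mult_integrable heat_L2 t H2_weak_deriv g)

text \<open>Moving both derivatives to \<open>g\<close> improves the time behaviour: only the L2
  norm of the kernel itself remains, of order t^(-d/4) at 0, instead of that of its second
  derivatives with an additional 1/t that would not be integrable.\<close>

lemma heat_lap_conv_H2:
  assumes t: "t > 0" and g: "g \<in> H2"
  shows "heat_lap_conv t g y = heat_conv t (weak_laplacian g) y"
proof -
  have "heat_lap_conv t g y = (\<Sum>b\<in>Basis. LINT x|lborel. complex_of_real (heatD t [b, b] (x - y)) * g x)"
    unfolding heat_lap_conv_def of_real_sum sum_distrib_right
    by (intro Bochner_Integration.integral_sum L2_mult_integrable heatD_L2 t H2_L2 g) auto
  also have "\<dots> = (\<Sum>b\<in>Basis. heat_conv t (weak_deriv [b, b] g) y)"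
    by (intro sum.cong refl heat_conv_partial t g)
  finally show ?thesis by (simp add: heat_conv_laplacian[OF assms])
qed

text \<open>From |z|^2 \<le> 2 |z + w|^2 + 2 |w|^2: the spare Gaussian of \<open>heat_double\<close>
  absorbs the shift. With |w| \<le> 1 this gives the majorant for continuity of the convolution in
  its base point.\<close>

lemma heat_translate_bound:
  fixes z w :: "'a::euclidean_space"
  assumes "t > 0"
  shows "heat t (z + w) \<le> sqrt 2 ^ DIM('a) * exp ((norm w)\<^sup>2 / (4 * t)) * heat (2 * t) z"
proof -
  have "(norm z)\<^sup>2 \<le> (norm (z + w) + norm w)\<^sup>2"
    by (intro power_mono) (metis add_diff_cancel_right' norm_triangle_ineq4, simp)
  also have "\<dots> \<le> 2 * (norm (z + w))\<^sup>2 + 2 * (norm w)\<^sup>2"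
    using zero_le_power2[of "norm (z + w) - norm w"] by (simp add: power2_sum power2_diff)
  finally have "- ((norm (z + w))\<^sup>2 / (8 * t)) + - ((norm (z + w))\<^sup>2 / (4 * (2 * t))) \<le> (norm w)\<^sup>2 / (4 * t) + - ((norm z)\<^sup>2 / (4 * (2 * t)))"
    using assms by (simp add: field_simps)
  then have "exp (- ((norm (z + w))\<^sup>2 / (8 * t))) * exp (- ((norm (z + w))\<^sup>2 / (4 * (2 * t)))) \<le> exp ((norm w)\<^sup>2 / (4 * t)) * exp (- ((norm z)\<^sup>2 / (4 * (2 * t))))"
    unfolding exp_add[symmetric] by simp
  then have "exp (- ((norm (z + w))\<^sup>2 / (8 * t))) * heat (2 * t) (z + w) \<le> exp ((norm w)\<^sup>2 / (4 * t)) * heat (2 * t) z"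
    using mult_left_mono[of _ _ "(1 / sqrt (4 * pi * (2 * t))) ^ DIM('a)"] assms
    unfolding heat_def by (simp add: mult.left_commute)
  then show ?thesis
    unfolding heat_double[OF assms, of "z + w"] mult.assoc by (intro mult_left_mono) auto
qed

lemma continuous_on_heat_conv:
  fixes u :: "'a::euclidean_space \<Rightarrow> complex"
  assumes t: "t > 0" and u: "u \<in> L2"
  shows "continuous_on UNIV (heat_conv t u)"
proof -
  have "(\<lambda>n. heat_conv t u (X n)) \<longlonglongrightarrow> heat_conv t u y" if X: "X \<longlonglongrightarrow> y" for X :: "nat \<Rightarrow> 'a" and y
  proof -
    let ?C = "sqrt 2 ^ DIM('a) * exp (1 / (4 * t))"
    have "eventually (\<lambda>n. norm (X n - y) < 1) sequentially"
      using X tendstoD[of X y sequentially 1] by (simp add: dist_norm)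
    then obtain N where N: "\<And>n. n \<ge> N \<Longrightarrow> norm (X n - y) < 1" by (auto simp: eventually_sequentially)
    note L = L2_mult_integrable[OF heat_L2 u]
    have "(\<lambda>n. heat_conv t u (X (n + N))) \<longlonglongrightarrow> heat_conv t u y"
      unfolding heat_conv_def
    proof (rule integral_dominated_convergence[where w="\<lambda>x. ?C * cmod (complex_of_real (heat (2 * t) (x - y)) * u x)"])
      show "integrable lborel (\<lambda>x. ?C * cmod (complex_of_real (heat (2 * t) (x - y)) * u x))"
        using t by (intro integrable_mult_right integrable_norm L) simp
      show "AE x in lborel. (\<lambda>n. complex_of_real (heat t (x - X (n + N))) * u x) \<longlonglongrightarrow> complex_of_real (heat t (x - y)) * u x"
        unfolding heat_def by (intro AE_I2 tendsto_intros LIMSEQ_ignore_initial_segment[OF X]) (use t in auto)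
      show "AE x in lborel. norm (complex_of_real (heat t (x - X (n + N))) * u x) \<le> ?C * cmod (complex_of_real (heat (2 * t) (x - y)) * u x)" for n
      proof (intro AE_I2)
        fix x
        have n: "norm (y - X (n + N)) \<le> 1" using N[of "n + N"] by (simp add: norm_minus_commute)
        have "heat t (x - X (n + N)) = heat t ((x - y) + (y - X (n + N)))" by simp
        also have "\<dots> \<le> sqrt 2 ^ DIM('a) * exp ((norm (y - X (n + N)))\<^sup>2 / (4 * t)) * heat (2 * t) (x - y)"
          by (rule heat_translate_bound[OF t])
        also have "\<dots> \<le> ?C * heat (2 * t) (x - y)"
          using t n heat_pos[of "2 * t" "x - y"]
          by (intro mult_right_mono mult_left_mono) (auto simp: divide_right_mono power_le_one)
        finally have "heat t (x - X (n + N)) * cmod (u x) \<le> ?C * heat (2 * t) (x - y) * cmod (u x)"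
          by (rule mult_right_mono) simp
        then show "norm (complex_of_real (heat t (x - X (n + N))) * u x) \<le> ?C * cmod (complex_of_real (heat (2 * t) (x - y)) * u x)"
          using heat_pos[of t "x - X (n + N)"] heat_pos[of "2 * t" "x - y"] t
          by (simp add: norm_mult mult.assoc)
      qed
    qed (use borel_measurable_integrable[OF L] t in simp_all)
    then show ?thesis by (rule LIMSEQ_offset)
  qed
  then show ?thesis by (auto simp: continuous_on_sequentially comp_def)
qed

section \<open>Short-time behaviour of heat convolutions\<close>

lemma heat_uminus: "heat t (- x) = heat t x"
  by (simp add: heat_def)

lemma heat_minus_commute: "heat t (x - y) = heat t (y - x)"
  using heat_uminus[of t "y - x"] by simp

lemma heat_shift_integral:
  fixes y :: "'a::euclidean_space"
  assumes "t > 0"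
  shows "integrable lborel (\<lambda>x. heat t (x - y))" "(LINT x|lborel. heat t (x - y)) = 1"
proof -
  note [measurable] = borel_measurable_integrable[OF heat_integral(1)[OF assms]]
  show "integrable lborel (\<lambda>x. heat t (x - y))"
    using lborel_integrable_shift[OF heat_integral(1)[OF assms], of "- y"] by simp
  show "(LINT x|lborel. heat t (x - y)) = 1"
    using lborel_integral_shift[of "heat t" "- y"] heat_integral[OF assms, where 'a='a] by simp
qed

text \<open>A pointwise form of the fact that the first absolute moment of the kernel is O(sqrt
  t).\<close>

lemma norm_times_heat_bound:
  fixes z :: "'a::euclidean_space"
  assumes t: "t > 0"
  shows "norm z * heat t z \<le> sqrt 8 * sqrt 2 ^ DIM('a) * sqrt t * heat (2 * t) z"
proof -
  define s where "s = (norm z)\<^sup>2 / (8 * t)"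
  have s: "s \<ge> 0" using t by (simp add: s_def)
  have nz: "norm z = sqrt s * sqrt 8 * sqrt t"
    using t by (simp add: s_def real_sqrt_divide real_sqrt_mult)
  have "norm z * heat t z = (sqrt s * exp (- s)) * (sqrt 8 * sqrt 2 ^ DIM('a) * sqrt t * heat (2 * t) z)"
    unfolding heat_double[OF t, of z, folded s_def] nz by simp
  also have "\<dots> \<le> 1 * (sqrt 8 * sqrt 2 ^ DIM('a) * sqrt t * heat (2 * t) z)"
    using t heat_pos[of "2 * t" z] by (intro mult_right_mono exp_neg_bounds s) auto
  finally show ?thesis by simp
qed

text \<open>The kernel has mass 1, so the value at y may be subtracted inside the integral; the
  Lipschitz bound then leaves the first moment of the kernel.\<close>

lemma heat_conv_lipschitz_bound:
  fixes \<phi> :: "'a::euclidean_space \<Rightarrow> complex"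
  assumes t: "t > 0" and meas: "\<phi> \<in> borel_measurable borel"
    and B: "\<And>x. cmod (\<phi> x) \<le> B" and L: "\<And>x y. cmod (\<phi> x - \<phi> y) \<le> L * norm (x - y)" and L0: "L \<ge> 0"
  shows "cmod (heat_conv t \<phi> y - \<phi> y) \<le> L * (sqrt 8 * sqrt 2 ^ DIM('a)) * sqrt t"
proof -
  let ?C = "sqrt 8 * sqrt 2 ^ DIM('a)"
  note [measurable] = meas borel_measurable_integrable[OF heat_shift_integral(1)[OF t, of y], simplified]
  have t2: "2 * t > 0" using t by simp
  have I: "integrable lborel (\<lambda>x. complex_of_real (heat t (x - y)) * \<phi> x)"
  proof (rule Bochner_Integration.integrable_bound)
    show "integrable lborel (\<lambda>x. heat t (x - y) * B)"
      by (intro integrable_mult_left heat_shift_integral t)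
    show "AE x in lborel. norm (complex_of_real (heat t (x - y)) * \<phi> x) \<le> norm (heat t (x - y) * B)"
      using B heat_pos[OF t] order_trans[OF B abs_ge_self] by (auto simp: norm_mult abs_mult intro!: mult_left_mono)
  qed simp
  have "heat_conv t \<phi> y - \<phi> y = (LINT x|lborel. complex_of_real (heat t (x - y)) * \<phi> x) - (LINT x|lborel. complex_of_real (heat t (x - y)) * \<phi> y)"
    by (simp add: heat_conv_def heat_shift_integral[OF t])
  also have "\<dots> = (LINT x|lborel. complex_of_real (heat t (x - y)) * (\<phi> x - \<phi> y))"
    using I by (simp add: right_diff_distrib integrable_of_real heat_shift_integral[OF t])
  also have "cmod \<dots> \<le> (LINT x|lborel. L * ?C * sqrt t * heat (2 * t) (x - y))"
  proof (rule order_trans[OF integral_norm_bound])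
    show "(LINT x|lborel. cmod (complex_of_real (heat t (x - y)) * (\<phi> x - \<phi> y))) \<le> (LINT x|lborel. L * ?C * sqrt t * heat (2 * t) (x - y))"
    proof (rule integral_mono)
      show "integrable lborel (\<lambda>x. cmod (complex_of_real (heat t (x - y)) * (\<phi> x - \<phi> y)))"
        using I by (intro integrable_norm) (simp add: right_diff_distrib integrable_of_real heat_shift_integral[OF t])
      show "integrable lborel (\<lambda>x. L * ?C * sqrt t * heat (2 * t) (x - y))"
        by (intro integrable_mult_right heat_shift_integral t2)
      fix x
      have "cmod (complex_of_real (heat t (x - y)) * (\<phi> x - \<phi> y)) \<le> heat t (x - y) * (L * norm (x - y))"
        using heat_pos[OF t, of "x - y"] L[of x y] by (simp add: norm_mult mult_left_mono)
      also have "\<dots> = L * (norm (x - y) * heat t (x - y))" by simp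
      also have "\<dots> \<le> L * (?C * sqrt t * heat (2 * t) (x - y))"
        by (intro mult_left_mono norm_times_heat_bound t L0)
      finally show "cmod (complex_of_real (heat t (x - y)) * (\<phi> x - \<phi> y)) \<le> L * ?C * sqrt t * heat (2 * t) (x - y)"
        by (simp add: mult.assoc)
    qed
  qed
  also have "\<dots> = L * ?C * sqrt t" by (simp add: heat_shift_integral[OF t2])
  finally show ?thesis .
qed

lemma heat_conv_test_tendsto:
  assumes "test_function \<phi>"
  shows "((\<lambda>t. heat_conv t \<phi> y) \<longlongrightarrow> \<phi> y) (at_right 0)"
proof -
  obtain B where B: "B \<ge> 0" "\<And>x. cmod (\<phi> x) \<le> B" using test_function_bounded[OF assms] by blast
  obtain L where L: "L \<ge> 0" "\<And>x y. cmod (\<phi> x - \<phi> y) \<le> L * norm (x - y)"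
    using test_function_lipschitz[OF assms] by blast
  let ?C = "L * (sqrt 8 * sqrt 2 ^ DIM('a))"
  have "((\<lambda>t. heat_conv t \<phi> y - \<phi> y) \<longlongrightarrow> 0) (at_right 0)"
  proof (rule Lim_null_comparison)
    show "eventually (\<lambda>t. norm (heat_conv t \<phi> y - \<phi> y) \<le> ?C * sqrt t) (at_right 0)"
      using eventually_at_right_less[of 0]
      by eventually_elim (rule heat_conv_lipschitz_bound[OF _ smooth_fun_measurable[OF test_function_smooth[OF assms]] B(2) L(2) L(1)])
    have "((\<lambda>t. ?C * sqrt t) \<longlongrightarrow> ?C * sqrt 0) (at_right 0)"
      by (intro tendsto_intros)
    then show "((\<lambda>t. ?C * sqrt t) \<longlongrightarrow> 0) (at_right 0)" by simp
  qed
  then show ?thesis by (simp add: LIM_zero_iff)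
qed

text \<open>A Gaussian majorant in y, uniform in t \<le> 1. On the support of \<open>\<phi>\<close>
  the distance |x - y| is large when |y| is, since |y|^2 \<le> 2 |x - y|^2 + 2 R^2, and the spare
  factor of \<open>heat_double\<close> converts this into decay.\<close>

lemma heat_conv_test_bound:
  fixes \<phi> :: "'a::euclidean_space \<Rightarrow> complex"
  assumes t: "0 < t" "t \<le> 1" and B: "\<And>x. cmod (\<phi> x) \<le> B" and R: "\<And>x. norm x > R \<Longrightarrow> \<phi> x = 0" "R \<ge> 0"
  shows "cmod (heat_conv t \<phi> y) \<le> B * (sqrt 2 ^ DIM('a) * exp (R\<^sup>2 / 8)) * exp (- ((norm y)\<^sup>2 / 16))"
proof -
  let ?C = "B * (sqrt 2 ^ DIM('a) * exp (R\<^sup>2 / 8)) * exp (- ((norm y)\<^sup>2 / 16))"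
  have t2: "2 * t > 0" using t by simp
  have B0: "B \<ge> 0" using order_trans[OF norm_ge_zero B] .
  have le: "cmod (complex_of_real (heat t (x - y)) * \<phi> x) \<le> ?C * heat (2 * t) (x - y)" for x
  proof (cases "norm x > R")
    case True
    then show ?thesis using R B0 heat_pos[OF t2, of "x - y"] by simp
  next
    case False
    have "(norm y)\<^sup>2 \<le> (norm (x - y) + norm x)\<^sup>2"
      by (intro power_mono) (metis norm_minus_commute norm_triangle_sub add.commute, simp)
    also have "\<dots> \<le> 2 * (norm (x - y))\<^sup>2 + 2 * (norm x)\<^sup>2"
      using zero_le_power2[of "norm (x - y) - norm x"] by (simp add: power2_sum power2_diff)
    also have "(norm x)\<^sup>2 \<le> R\<^sup>2" using False by (intro power_mono) auto
    finally have "(norm y)\<^sup>2 / 16 - R\<^sup>2 / 8 \<le> (norm (x - y))\<^sup>2 / 8" by simp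
    also have "\<dots> \<le> (norm (x - y))\<^sup>2 / (8 * t)" using t by (intro divide_left_mono) auto
    finally have "exp (- ((norm (x - y))\<^sup>2 / (8 * t))) \<le> exp (R\<^sup>2 / 8) * exp (- ((norm y)\<^sup>2 / 16))"
      unfolding exp_add[symmetric] by simp
    then have "heat t (x - y) \<le> sqrt 2 ^ DIM('a) * (exp (R\<^sup>2 / 8) * exp (- ((norm y)\<^sup>2 / 16)) * heat (2 * t) (x - y))"
      unfolding heat_double[OF t(1), of "x - y"]
      using heat_pos[OF t2, of "x - y"] by (intro mult_left_mono mult_right_mono) auto
    then have "heat t (x - y) * cmod (\<phi> x) \<le> (sqrt 2 ^ DIM('a) * (exp (R\<^sup>2 / 8) * exp (- ((norm y)\<^sup>2 / 16)) * heat (2 * t) (x - y))) * B"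
      using heat_pos[OF t2, of "x - y"] by (intro mult_mono B) auto
    then show ?thesis using heat_pos[OF t(1), of "x - y"] by (simp add: norm_mult mult_ac)
  qed
  have int: "integrable lborel (\<lambda>x. ?C * heat (2 * t) (x - y))"
    by (intro integrable_mult_right heat_shift_integral t2)
  have "cmod (heat_conv t \<phi> y) \<le> (LINT x|lborel. ?C * heat (2 * t) (x - y))"
    unfolding heat_conv_def 
  proof (rule order_trans[OF integral_norm_bound integral_mono'[OF int le]])
    show "0 \<le> ?C * heat (2 * t) (x - y)" for x
      using B0 heat_pos[OF t2, of "x - y"] by simp
  qed
  also have "\<dots> = ?C" by (simp add: heat_shift_integral[OF t2])
  finally show ?thesis .
qed

text \<open>The heat kernel is symmetric in its two points. Fubini is justified because
  Cauchy-Schwarz bounds the x-integral by \<open>?N\<close> uniformly in y, and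
  \<open>\<phi>\<close> is integrable.\<close>

lemma heat_conv_swap:
  fixes u :: "'a::euclidean_space \<Rightarrow> complex"
  assumes t: "t > 0" and u: "u \<in> L2" and \<phi>: "test_function \<phi>"
  shows "(LINT y|lborel. heat_conv t u y * \<phi> y) = (LINT x|lborel. u x * heat_conv t \<phi> x)"
proof -
  note [measurable] = L2_measurable[OF u] smooth_fun_measurable[OF test_function_smooth[OF \<phi>]]
  have m[measurable]: "(\<lambda>(y, x). heat t (x - y)) \<in> borel_measurable (borel \<Otimes>\<^sub>M borel)"
    unfolding heat_def by measurable
  let ?f = "\<lambda>(y, x). complex_of_real (heat t (x - y)) * u x * \<phi> y"
  have int: "integrable (lborel \<Otimes>\<^sub>M lborel) ?f"
  proof (rule lborel_pair.Fubini_integrable)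
    show "?f \<in> borel_measurable (lborel \<Otimes>\<^sub>M lborel)" by simp
    have I: "integrable lborel (\<lambda>x. complex_of_real (heat t (x - y)) * u x)" for y
      by (intro L2_mult_integrable heat_L2 t u)
    then show "AE y in lborel. integrable lborel (\<lambda>x. ?f (y, x))" by simp
    let ?N = "sqrt ((1 / sqrt (8 * pi * t)) ^ DIM('a)) * L2_norm u"
    have le: "(LINT x|lborel. cmod (?f (y, x))) \<le> ?N * cmod (\<phi> y)" for y
    proof -
      have "(LINT x|lborel. cmod (?f (y, x))) = (LINT x|lborel. heat t (x - y) * cmod (u x)) * cmod (\<phi> y)"
        by (simp add: norm_mult abs_of_pos[OF heat_pos[OF t]])
      also have "(LINT x|lborel. heat t (x - y) * cmod (u x)) \<le> ?N"
      proof -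
        have "(LINT x|lborel. heat t (x - y) * cmod (u x)) = Re (LINT x|lborel. complex_of_real (heat t (x - y)) * complex_of_real (cmod (u x)))"
          by (simp flip: of_real_mult)
        also have "\<dots> \<le> cmod (LINT x|lborel. complex_of_real (heat t (x - y)) * complex_of_real (cmod (u x)))"
          by (rule complex_Re_le_cmod)
        also have "\<dots> \<le> L2_norm (\<lambda>x. complex_of_real (heat t (x - y))) * L2_norm (\<lambda>x. complex_of_real (cmod (u x)))"
          by (intro Cauchy_Schwarz_L2 heat_L2 t L2_cmod u)
        finally show ?thesis by (simp add: heat_L2_norm[OF t] L2_norm_def)
      qed
      finally show ?thesis by (simp add: mult_right_mono)
    qed
    show "integrable lborel (\<lambda>y. LINT x|lborel. cmod (?f (y, x)))"
    proof (rule Bochner_Integration.integrable_bound)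
      show "integrable lborel (\<lambda>y. ?N * cmod (\<phi> y))"
        by (intro integrable_mult_right integrable_norm test_function_integrable \<phi>)
      show "(\<lambda>y. LINT x|lborel. cmod (?f (y, x))) \<in> borel_measurable lborel"
        by (intro lborel.borel_measurable_lebesgue_integral) (simp add: split_beta')
      have "(LINT x|lborel. cmod (?f (y, x))) \<ge> 0" for y by simp
      then show "AE y in lborel. norm (LINT x|lborel. cmod (?f (y, x))) \<le> norm (?N * cmod (\<phi> y))"
        using le order_trans[OF le abs_ge_self] by (intro AE_I2) simp
    qed
  qed
  have "(LINT y|lborel. heat_conv t u y * \<phi> y) = (LINT y|lborel. (LINT x|lborel. complex_of_real (heat t (x - y)) * u x * \<phi> y))"
    by (simp add: heat_conv_def)
  also have "\<dots> = (LINT x|lborel. (LINT y|lborel. complex_of_real (heat t (x - y)) * u x * \<phi> y))"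
    using lborel_pair.Fubini_integral[of "\<lambda>y x. complex_of_real (heat t (x - y)) * u x * \<phi> y"] int by simp
  also have "\<dots> = (LINT x|lborel. u x * heat_conv t \<phi> x)"
  proof (intro Bochner_Integration.integral_cong refl)
    fix x
    have "(LINT y|lborel. complex_of_real (heat t (x - y)) * u x * \<phi> y) = (LINT y|lborel. u x * (complex_of_real (heat t (y - x)) * \<phi> y))"
      by (simp add: heat_minus_commute[of t x] mult_ac)
    then show "(LINT y|lborel. complex_of_real (heat t (x - y)) * u x * \<phi> y) = u x * heat_conv t \<phi> x"
      by (simp add: heat_conv_def)
  qed
  finally show ?thesis .
qed

lemma filterlim_inverse_Suc_at_right: "filterlim (\<lambda>n. inverse (real (Suc n))) (at_right 0) sequentially"
  unfolding filterlim_at using LIMSEQ_inverse_real_of_nat by (auto simp del: of_nat_Suc)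

text \<open>Convergence against test functions suffices to identify the limit almost everywhere. The
  convolution is moved onto \<open>\<phi>\<close>, where it converges pointwise under a Gaussian
  majorant.\<close>

lemma heat_conv_weak_limit:
  fixes u :: "'a::euclidean_space \<Rightarrow> complex"
  assumes u: "u \<in> L2" and \<phi>: "test_function \<phi>"
  shows "(\<lambda>n. LINT y|lborel. heat_conv (inverse (real (Suc n))) u y * \<phi> y) \<longlonglongrightarrow> (LINT y|lborel. u y * \<phi> y)"
proof -
  obtain B where B: "B \<ge> 0" "\<And>x. cmod (\<phi> x) \<le> B" using test_function_bounded[OF \<phi>] by blast
  obtain R where R: "R > 0" "\<And>x. norm x > R \<Longrightarrow> \<phi> x = 0" using test_function_support[OF \<phi>] by blast
  define h :: "nat \<Rightarrow> real" where "h n = inverse (real (Suc n))" for n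
  have h: "0 < h n" "h n \<le> 1" for n by (auto simp: h_def field_simps)
  let ?C = "B * (sqrt 2 ^ DIM('a) * exp (R\<^sup>2 / 8))"
  let ?e = "\<lambda>y::'a. complex_of_real (exp (- ((norm y)\<^sup>2 / 16)))"
  \<comment> \<open>The majorant exp(-|y|^2/16) is a multiple of the heat kernel at time 4, hence in
    L2, and its product with \<open>u\<close> is integrable.\<close>
  have "?e = (\<lambda>y. complex_of_real (inverse ((1 / sqrt (4 * pi * 4)) ^ DIM('a))) * complex_of_real (heat 4 (y - 0)))"
    by (auto simp: heat_def fun_eq_iff)
  then have e: "?e \<in> L2" using L2_cmult[OF heat_L2[of 4 0]] by simp
  note [measurable] = L2_measurable[OF u] smooth_fun_measurable[OF test_function_smooth[OF \<phi>]]
  have "(\<lambda>n. LINT y|lborel. u y * heat_conv (h n) \<phi> y) \<longlonglongrightarrow> (LINT y|lborel. u y * \<phi> y)"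
  proof (rule integral_dominated_convergence[where w="\<lambda>y. ?C * cmod (u y * ?e y)"])
    show "integrable lborel (\<lambda>y. ?C * cmod (u y * ?e y))"
      by (intro integrable_mult_right integrable_norm L2_mult_integrable u e)
    show "AE y in lborel. (\<lambda>n. u y * heat_conv (h n) \<phi> y) \<longlonglongrightarrow> u y * \<phi> y"
      using filterlim_compose[OF heat_conv_test_tendsto[OF \<phi>] filterlim_inverse_Suc_at_right]
      by (intro AE_I2 tendsto_mult tendsto_const) (simp only: h_def)
    show "AE y in lborel. norm (u y * heat_conv (h n) \<phi> y) \<le> ?C * cmod (u y * ?e y)" for n
    proof (intro AE_I2)
      fix y
      have "cmod (u y) * cmod (heat_conv (h n) \<phi> y) \<le> cmod (u y) * (?C * exp (- ((norm y)\<^sup>2 / 16)))"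
        using R by (intro mult_left_mono heat_conv_test_bound h B) auto
      then show "norm (u y * heat_conv (h n) \<phi> y) \<le> ?C * cmod (u y * ?e y)"
        by (simp add: norm_mult mult_ac)
    qed
    show "(\<lambda>y. u y * heat_conv (h n) \<phi> y) \<in> borel_measurable lborel" for n
      using continuous_on_heat_conv[OF h(1) test_function_L2[OF \<phi>], of n, THEN borel_measurable_continuous_onI] by simp
  qed simp
  then show ?thesis unfolding h_def[symmetric] using heat_conv_swap[OF h(1) u \<phi>] by simp
qed

section \<open>The continuous representative\<close>

text \<open>The function \<open>\<Phi>\<close> is a modulus of convergence that does not depend on
  the point, so the continuous convolutions converge uniformly and the limit is continuous. Weak
  convergence then identifies it with \<open>g\<close> almost everywhere.\<close>

lemma sobolev_continuous_limit:
  fixes g :: "'a::euclidean_space \<Rightarrow> complex"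
  assumes g: "g \<in> H2" and d: "DIM('a) \<le> 3"
  obtains G where "continuous_on UNIV G" "AE x in lborel. G x = g x"
    "\<And>y. ((\<lambda>t. heat_conv t g y) \<longlongrightarrow> G y) (at_right 0)"
proof -
  define K where "K = L2_norm (weak_laplacian g)"
  \<comment> \<open>The primitive, vanishing at 0, of the bound K (1 + t^(-3/4)) on the time
    derivative.\<close>
  define \<Phi> where "\<Phi> t = K * (t + 4 * t powr (1 / 4))" for t :: real
  have K: "K \<ge> 0" by (simp add: K_def L2_norm_nonneg)
  note Lg = weak_laplacian_L2[OF g]
  have deriv: "((\<lambda>t. heat_conv t g y) has_vector_derivative heat_conv t (weak_laplacian g) y) (at t)" if "t > 0" for t y
    using heat_conv_deriv[OF that H2_L2[OF g], of y] by (simp add: heat_lap_conv_H2[OF that g])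
  have deriv_bound: "cmod (heat_conv t (weak_laplacian g) y) \<le> K * (1 + t powr (- 3 / 4))" if "t > 0" for t y
  proof -
    have "cmod (heat_conv t (weak_laplacian g) y) \<le> L2_norm (\<lambda>x. complex_of_real (heat t (x - y))) * K"
      unfolding heat_conv_def K_def by (intro Cauchy_Schwarz_L2 heat_L2 that Lg)
    also have "\<dots> \<le> (1 + t powr (- 3 / 4)) * K"
      by (intro mult_right_mono heat_L2_norm_bound that d K)
    finally show ?thesis by (simp add: mult.commute)
  qed
  have \<Phi>_deriv: "(\<Phi> has_real_derivative K * (1 + t powr (- 3 / 4))) (at t)" if "t > 0" for t
    unfolding \<Phi>_def using that by (auto intro!: derivative_eq_intros)
  have \<Phi>_lim: "(\<Phi> \<longlongrightarrow> 0) (at_right 0)"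
  proof -
    have "eventually (\<lambda>t::real. 0 \<le> t) (at_right 0)"
      using eventually_at_right_less[of "0::real"] by eventually_elim simp
    then have "((\<lambda>t. t powr (1 / 4)) \<longlongrightarrow> 0 powr (1 / 4)) (at_right (0::real))"
      by (intro tendsto_powr' tendsto_intros) auto
    then have "((\<lambda>t. K * (t + 4 * t powr (1 / 4))) \<longlongrightarrow> K * (0 + 4 * 0 powr (1 / 4))) (at_right 0)"
      by (rule tendsto_mult_left[OF tendsto_add[OF tendsto_ident_at tendsto_mult_left]])
    then show ?thesis by (simp add: \<Phi>_def[abs_def])
  qed
  have \<Phi>_nonneg: "\<Phi> t \<ge> 0" if "t > 0" for t using K that by (simp add: \<Phi>_def)
  have diff: "cmod (heat_conv t g y - heat_conv s g y) \<le> \<Phi> t" if st: "0 < s" "s \<le> t" for s t y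
  proof (cases "s = t")
    case False
    have "cmod (heat_conv t g y - heat_conv s g y) \<le> \<Phi> t - \<Phi> s"
    proof (rule differentiable_bound_general[where f'="\<lambda>t. heat_conv t (weak_laplacian g) y" and \<phi>'="\<lambda>t. K * (1 + t powr (- 3 / 4))"])
      show "continuous_on {s..t} (\<lambda>t. heat_conv t g y)"
        using st by (intro continuous_at_imp_continuous_on ballI has_vector_derivative_continuous[OF deriv]) auto
      show "continuous_on {s..t} \<Phi>"
        using st by (intro continuous_at_imp_continuous_on ballI DERIV_isCont[OF \<Phi>_deriv]) auto
      show "(\<Phi> has_vector_derivative K * (1 + r powr (- 3 / 4))) (at r)" if "s < r" for r
        using \<Phi>_deriv[of r] that st by (simp only: has_real_derivative_iff_has_vector_derivative)
      show "cmod (heat_conv r (weak_laplacian g) y) \<le> K * (1 + r powr (- 3 / 4))" if "s < r" for r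
        using that st by (intro deriv_bound) simp
    qed (use st False in \<open>auto intro!: deriv\<close>)
    then show ?thesis using \<Phi>_nonneg[OF st(1)] by linarith
  qed (use \<Phi>_nonneg st in simp)
  define h :: "nat \<Rightarrow> real" where "h n = inverse (real (Suc n))" for n
  have h: "0 < h n" for n by (simp add: h_def)
  have h_anti: "h n \<le> h m" if "m \<le> n" for m n using that by (simp add: h_def)
  have \<Phi>h: "(\<lambda>n. \<Phi> (h n)) \<longlonglongrightarrow> 0"
    unfolding h_def by (rule filterlim_compose[OF \<Phi>_lim filterlim_inverse_Suc_at_right])
  have "convergent (\<lambda>n. heat_conv (h n) g y)" for y
  proof (rule Cauchy_convergent, rule CauchyI)
    fix e :: real assume e: "0 < e"
    then have "eventually (\<lambda>n. \<Phi> (h n) < e) sequentially" by (rule order_tendstoD(2)[OF \<Phi>h])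
    then obtain N where N: "\<And>n. n \<ge> N \<Longrightarrow> \<Phi> (h n) < e" by (auto simp: eventually_sequentially)
    show "\<exists>M. \<forall>m\<ge>M. \<forall>n\<ge>M. norm (heat_conv (h m) g y - heat_conv (h n) g y) < e"
    proof (intro exI[of _ N] allI impI)
      fix m n assume mn: "N \<le> m" "N \<le> n"
      show "norm (heat_conv (h m) g y - heat_conv (h n) g y) < e"
      proof (cases "m \<le> n")
        case True
        then show ?thesis using diff[OF h h_anti[OF True], of y] N[OF mn(1)] by linarith
      next
        case False
        then have "n \<le> m" by simp
        then show ?thesis using diff[OF h h_anti[OF \<open>n \<le> m\<close>], of y] N[OF mn(2)] by (simp add: norm_minus_commute)
      qed
    qed
  qed
  then obtain G where G: "\<And>y. (\<lambda>n. heat_conv (h n) g y) \<longlonglongrightarrow> G y"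
    unfolding convergent_def by metis
  have close: "cmod (heat_conv t g y - G y) \<le> \<Phi> t" if t: "t > 0" for t y
  proof (rule tendsto_upperbound[where F=sequentially])
    show "(\<lambda>n. cmod (heat_conv t g y - heat_conv (h n) g y)) \<longlonglongrightarrow> cmod (heat_conv t g y - G y)"
      by (intro tendsto_intros G)
    have "h \<longlonglongrightarrow> 0" unfolding h_def by (rule LIMSEQ_inverse_real_of_nat)
    then have "eventually (\<lambda>n. h n < t) sequentially" by (rule order_tendstoD(2)[OF _ t])
    then show "eventually (\<lambda>n. cmod (heat_conv t g y - heat_conv (h n) g y) \<le> \<Phi> t) sequentially"
      by eventually_elim (intro diff h less_imp_le)
  qed simp
  have G_lim: "((\<lambda>t. heat_conv t g y) \<longlongrightarrow> G y) (at_right 0)" for y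
  proof -
    have "((\<lambda>t. heat_conv t g y - G y) \<longlongrightarrow> 0) (at_right 0)"
      by (rule Lim_null_comparison[OF eventually_mono[OF eventually_at_right_less[of "0::real"]] \<Phi>_lim]) (rule close)
    then show ?thesis by (simp add: LIM_zero_iff)
  qed
  have unif: "uniform_limit UNIV (\<lambda>n y. heat_conv (h n) g y) G sequentially"
    unfolding uniform_limit_iff
  proof (intro allI impI)
    fix e :: real assume "0 < e"
    then have "eventually (\<lambda>n. \<Phi> (h n) < e) sequentially" by (rule order_tendstoD(2)[OF \<Phi>h])
    then show "\<forall>\<^sub>F n in sequentially. \<forall>y\<in>UNIV. dist (heat_conv (h n) g y) (G y) < e"
      by eventually_elim (use close[OF h] in \<open>auto simp: dist_norm intro: le_less_trans\<close>)
  qed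
  have cont: "continuous_on UNIV G"
    by (rule uniform_limit_theorem[OF _ unif]) (auto intro!: always_eventually continuous_on_heat_conv h H2_L2 g)
  have G_loc: "integrable lborel (\<lambda>x. indicator (cball 0 R) x *\<^sub>R G x)" for R
    by (intro borel_integrable_compact compact_cball continuous_on_subset[OF cont]) auto
  note [measurable] = borel_measurable_continuous_onI[OF cont] L2_measurable[OF H2_L2[OF g]]
  have "AE x in lborel. G x - g x = 0"
  proof (rule fundamental_lemma)
    show "integrable lborel (\<lambda>x. indicator (cball 0 R) x *\<^sub>R (G x - g x))" for R
      unfolding scaleR_diff_right by (intro Bochner_Integration.integrable_diff G_loc L2_locally_integrable H2_L2 g)
    fix \<phi> :: "'a \<Rightarrow> complex" assume \<phi>: "test_function \<phi>"
    note int\<phi> = test_function_integrable[OF \<phi>]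
    note [measurable] = smooth_fun_measurable[OF test_function_smooth[OF \<phi>]]
    have [measurable]: "heat_conv (h n) g \<in> borel_measurable borel" for n
      by (intro borel_measurable_continuous_onI continuous_on_heat_conv h H2_L2 g)
    obtain R where R: "R > 0" "\<And>x. norm x > R \<Longrightarrow> \<phi> x = 0" using test_function_support[OF \<phi>] by blast
    obtain B where B: "B \<ge> 0" "\<And>x. cmod (\<phi> x) \<le> B" using test_function_bounded[OF \<phi>] by blast
    have intG: "integrable lborel (\<lambda>y. G y * \<phi> y)"
    proof (rule Bochner_Integration.integrable_bound)
      show "integrable lborel (\<lambda>x. B *\<^sub>R (indicator (cball 0 R) x *\<^sub>R G x))" by (intro integrable_scaleR_right G_loc)
      have "norm (G x * \<phi> x) \<le> norm (B *\<^sub>R (indicator (cball 0 R) x *\<^sub>R G x))" for x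
      proof (cases "norm x > R")
        case False
        then show ?thesis using mult_left_mono[OF B(2)[of x] norm_ge_zero[of "G x"]] B(1) by (simp add: norm_mult mult.commute)
      qed (use R in simp)
      then show "AE x in lborel. norm (G x * \<phi> x) \<le> norm (B *\<^sub>R (indicator (cball 0 R) x *\<^sub>R G x))" by simp
    qed simp
    have "(\<lambda>n. LINT y|lborel. heat_conv (h n) g y * \<phi> y) \<longlonglongrightarrow> (LINT y|lborel. G y * \<phi> y)"
    \<comment> \<open>\<open>\<Phi>\<close> increases in t and \<open>h\<close> decreases in n, so
      \<open>\<Phi> (h 0)\<close> bounds the distance to \<open>G\<close> for every n.\<close>
    proof (rule integral_dominated_convergence[where w="\<lambda>y. cmod (G y * \<phi> y) + \<Phi> (h 0) * cmod (\<phi> y)"])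
      show "integrable lborel (\<lambda>y. cmod (G y * \<phi> y) + \<Phi> (h 0) * cmod (\<phi> y))"
        by (intro Bochner_Integration.integrable_add integrable_mult_right integrable_norm intG int\<phi>)
      show "AE y in lborel. (\<lambda>n. heat_conv (h n) g y * \<phi> y) \<longlonglongrightarrow> G y * \<phi> y"
        by (intro AE_I2 tendsto_mult G tendsto_const)
      show "AE y in lborel. norm (heat_conv (h n) g y * \<phi> y) \<le> cmod (G y * \<phi> y) + \<Phi> (h 0) * cmod (\<phi> y)" for n
      proof (intro AE_I2)
        fix y
        have "cmod (heat_conv (h n) g y - G y) \<le> \<Phi> (h n)" by (rule close[OF h])
        also have "\<Phi> (h n) \<le> \<Phi> (h 0)"
          using h[of n] h_anti[of 0 n] K unfolding \<Phi>_def by (intro mult_left_mono add_mono powr_mono2) auto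
        finally have "cmod (heat_conv (h n) g y) \<le> cmod (G y) + \<Phi> (h 0)"
          using norm_triangle_sub[of "heat_conv (h n) g y" "G y"] by linarith
        then show "norm (heat_conv (h n) g y * \<phi> y) \<le> cmod (G y * \<phi> y) + \<Phi> (h 0) * cmod (\<phi> y)"
          unfolding norm_mult distrib_right[symmetric] by (rule mult_right_mono) simp
      qed
    qed simp_all
    moreover have "(\<lambda>n. LINT y|lborel. heat_conv (h n) g y * \<phi> y) \<longlonglongrightarrow> (LINT y|lborel. g y * \<phi> y)"
      unfolding h_def by (rule heat_conv_weak_limit[OF H2_L2[OF g] \<phi>])
    ultimately have "(LINT y|lborel. G y * \<phi> y) = (LINT y|lborel. g y * \<phi> y)" by (rule LIMSEQ_unique)
    then show "(LINT x|lborel. (G x - g x) * \<phi> x) = 0"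
      using intG L2_mult_integrable[OF H2_L2[OF g] test_function_L2[OF \<phi>]] by (simp add: left_diff_distrib)
  qed simp
  then have "AE x in lborel. G x = g x" by simp
  then show ?thesis using that cont G_lim by blast
qed

text \<open>The third statement turns point evaluation into a boundary value at t = 0, the form in
  which it appears in the reproducing identity.\<close>

lemma H2_cont_rep:
  fixes g :: "'a::euclidean_space \<Rightarrow> complex"
  assumes "g \<in> H2" "DIM('a) \<le> 3"
  shows "continuous_on UNIV (cont_rep g)" "AE x in lborel. cont_rep g x = g x"
    "((\<lambda>t. heat_conv t g y) \<longlongrightarrow> cont_rep g y) (at_right 0)"
proof -
  obtain G where G: "continuous_on UNIV G" "AE x in lborel. G x = g x"
    "\<And>y. ((\<lambda>t. heat_conv t g y) \<longlongrightarrow> G y) (at_right 0)"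
    using sobolev_continuous_limit[OF assms] by blast
  moreover have "cont_rep g = G" by (rule cont_rep_eqI[OF G(1,2)])
  ultimately show "continuous_on UNIV (cont_rep g)" "AE x in lborel. cont_rep g x = g x"
    "((\<lambda>t. heat_conv t g y) \<longlongrightarrow> cont_rep g y) (at_right 0)" by auto
qed

section \<open>The Green function as a time integral of heat kernels\<close>

text \<open>Explicit solutions of k'' + 2 m k' + q k = 0 with \<open>k 0 = 0\<close> and
  \<open>k' 0 = 1\<close> in the overdamped, critical and underdamped cases; positive
  \<open>m\<close> and \<open>q\<close> give exponential decay in each.\<close>

lemma damped_oscillator:
  fixes m q :: real
  assumes m: "m > 0" and q: "q > 0"
  obtains k k' c C where "c > 0" "k 0 = 0" "k' 0 = 1"
    "\<And>t. (k has_real_derivative k' t) (at t)"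
    "\<And>t. (k' has_real_derivative - (2 * m * k' t + q * k t)) (at t)"
    "\<And>t. t \<ge> 0 \<Longrightarrow> \<bar>k t\<bar> \<le> C * exp (- (c * t))"
    "\<And>t. t \<ge> 0 \<Longrightarrow> \<bar>k' t\<bar> \<le> C * exp (- (c * t))"
proof -
  consider "m\<^sup>2 > q" | "m\<^sup>2 = q" | "m\<^sup>2 < q" by linarith
  then show ?thesis
  proof cases
    case 1
    define w where "w = sqrt (m\<^sup>2 - q)"
    have w: "w > 0" "w\<^sup>2 = m\<^sup>2 - q" using 1 by (auto simp: w_def)
    then have "w\<^sup>2 < m\<^sup>2" using q by simp
    then have wm: "w < m" using m by (intro power2_less_imp_less[of w m]) auto
    define k where "k t = (exp (- ((m - w) * t)) - exp (- ((m + w) * t))) / (2 * w)" for t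
    define k' where "k' t = ((m + w) * exp (- ((m + w) * t)) - (m - w) * exp (- ((m - w) * t))) / (2 * w)" for t
    have q_eq: "q = m * m - w * w" using w(2) by (simp add: power2_eq_square)
    have le: "exp (- ((m + w) * t)) \<le> exp (- ((m - w) * t))" if "t \<ge> 0" for t
      using mult_right_mono[of "m - w" "m + w" t] that w wm by simp
    show ?thesis
    \<comment> \<open>The slower rate m - w is positive because w^2 = m^2 - q < m^2. In the
      numerator 1 serves \<open>k\<close> and 2m = (m + w) + (m - w) serves
      \<open>k'\<close>.\<close>
    proof (rule that[of "m - w" k k' "(1 + 2 * m) / (2 * w)"])
      show "(k has_real_derivative k' t) (at t)" for t
        unfolding k_def k'_def using w by (auto intro!: derivative_eq_intros simp: field_simps)
      show "(k' has_real_derivative - (2 * m * k' t + q * k t)) (at t)" for t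
        unfolding k_def k'_def q_eq using w by (auto intro!: derivative_eq_intros simp: field_simps)
      fix t :: real assume t: "t \<ge> 0"
      let ?e = "exp (- ((m - w) * t))" and ?f = "exp (- ((m + w) * t))"
      have e: "0 < ?e" "0 < ?f" "?f \<le> ?e" using le[OF t] by auto
      have "\<bar>?e - ?f\<bar> \<le> (1 + 2 * m) * ?e"
        using e m mult_pos_pos[of m ?e] by (simp add: algebra_simps abs_if)
      then show "\<bar>k t\<bar> \<le> (1 + 2 * m) / (2 * w) * ?e"
        using w by (simp add: k_def abs_divide divide_right_mono)
      have "\<bar>(m + w) * ?f - (m - w) * ?e\<bar> \<le> (m + w) * ?f + (m - w) * ?e"
        using e m w wm by (intro order_trans[OF abs_triangle_ineq4]) (simp add: abs_mult)
      also have "\<dots> \<le> (m + w) * ?e + (m - w) * ?e"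
        using e m w wm by (intro add_mono mult_left_mono) auto
      also have "\<dots> \<le> (1 + 2 * m) * ?e" using e by (simp add: algebra_simps)
      finally show "\<bar>k' t\<bar> \<le> (1 + 2 * m) / (2 * w) * ?e"
        using w by (simp add: k'_def abs_divide divide_right_mono)
    qed (use wm w in \<open>auto simp: k_def k'_def field_simps\<close>)
  next
    case 2
    define k where "k t = t * exp (- (m * t))" for t
    define k' where "k' t = (1 - m * t) * exp (- (m * t))" for t
    have te: "t * exp (- (m * t)) \<le> 2 / m * exp (- (m / 2 * t))" if "t \<ge> 0" for t
    proof -
      have "(m / 2 * t) * exp (- (m / 2 * t)) \<le> 1" using m that by (intro exp_neg_bounds) auto
      then have "t * exp (- (m / 2 * t)) \<le> 2 / m" using m by (simp add: field_simps)
      then have "t * exp (- (m / 2 * t)) * exp (- (m / 2 * t)) \<le> 2 / m * exp (- (m / 2 * t))"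
        by (rule mult_right_mono) simp
      then show ?thesis by (simp add: mult_exp_exp mult.assoc)
    qed
    show ?thesis
    \<comment> \<open>Half of the decay rate is spent on the factor t of the double root. The term
      2/m bounds \<open>k\<close>, and 3 = 1 + 2 bounds \<open>k'\<close>.\<close>
    proof (rule that[of "m / 2" k k' "2 / m + 3"])
      show "(k has_real_derivative k' t) (at t)" for t
        unfolding k_def k'_def by (auto intro!: derivative_eq_intros simp: algebra_simps)
      show "(k' has_real_derivative - (2 * m * k' t + q * k t)) (at t)" for t
        unfolding k_def k'_def 2[symmetric] by (auto intro!: derivative_eq_intros simp: algebra_simps power2_eq_square)
      fix t :: real assume t: "t \<ge> 0"
      let ?e = "exp (- (m / 2 * t))"
      show "\<bar>k t\<bar> \<le> (2 / m + 3) * ?e"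
        using te[OF t] t by (simp add: k_def abs_mult distrib_right add_increasing2)
      have "0 \<le> m * t" using m t by simp
      then have "\<bar>1 - m * t\<bar> \<le> 1 + m * t" by linarith
      then have "\<bar>k' t\<bar> \<le> (1 + m * t) * exp (- (m * t))"
        by (simp add: k'_def abs_mult mult_right_mono)
      also have "\<dots> = exp (- (m * t)) + m * (t * exp (- (m * t)))" by (simp add: algebra_simps)
      also have "\<dots> \<le> ?e + m * (2 / m * ?e)"
        using m t te[OF t] by (intro add_mono mult_left_mono) auto
      also have "\<dots> \<le> (2 / m + 3) * ?e" using m by (simp add: distrib_right)
      finally show "\<bar>k' t\<bar> \<le> (2 / m + 3) * ?e" .
    qed (use m in \<open>auto simp: k_def k'_def\<close>)
  next
    case 3
    define w where "w = sqrt (q - m\<^sup>2)"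
    have w: "w > 0" "w\<^sup>2 = q - m\<^sup>2" using 3 by (auto simp: w_def)
    define k where "k t = exp (- (m * t)) * sin (w * t) / w" for t
    define k' where "k' t = exp (- (m * t)) * (cos (w * t) - m * sin (w * t) / w)" for t
    have q_eq: "q = m * m + w * w" using w(2) by (simp add: power2_eq_square)
    show ?thesis
    \<comment> \<open>Here 1/w bounds the amplitude of \<open>k\<close> and 1 + m/w that of
      \<open>k'\<close>.\<close>
    proof (rule that[of m k k' "1 / w + 1 + m / w"])
      show "(k has_real_derivative k' t) (at t)" for t
        unfolding k_def k'_def using w by (auto intro!: derivative_eq_intros simp: field_simps)
      show "(k' has_real_derivative - (2 * m * k' t + q * k t)) (at t)" for t
        unfolding k_def k'_def q_eq using w by (auto intro!: derivative_eq_intros simp: field_simps)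
      fix t :: real assume t: "t \<ge> 0"
      let ?e = "exp (- (m * t))"
      have "\<bar>sin (w * t) / w\<bar> \<le> 1 / w + 1 + m / w"
        using w m abs_sin_le_one[of "w * t"] by (simp add: abs_divide field_simps add_increasing2)
      then have "\<bar>sin (w * t) / w\<bar> * ?e \<le> (1 / w + 1 + m / w) * ?e" by (rule mult_right_mono) simp
      then show "\<bar>k t\<bar> \<le> (1 / w + 1 + m / w) * ?e"
        by (simp add: k_def abs_mult abs_divide mult.commute)
      have "\<bar>m * sin (w * t) / w\<bar> \<le> m / w"
        using w m abs_sin_le_one[of "w * t"] mult_left_mono[of "\<bar>sin (w * t)\<bar>" 1 m] by (simp add: abs_divide abs_mult divide_right_mono)
      then have "\<bar>cos (w * t) - m * sin (w * t) / w\<bar> \<le> 1 + m / w"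
        using abs_cos_le_one[of "w * t"] by linarith
      then have "\<bar>cos (w * t) - m * sin (w * t) / w\<bar> \<le> 1 / w + 1 + m / w"
        using zero_le_divide_1_iff[of w] w(1) by linarith
      then have "\<bar>cos (w * t) - m * sin (w * t) / w\<bar> * ?e \<le> (1 / w + 1 + m / w) * ?e" by (rule mult_right_mono) simp
      then show "\<bar>k' t\<bar> \<le> (1 / w + 1 + m / w) * ?e"
        by (simp add: k'_def abs_mult mult.commute)
    qed (use m in \<open>auto simp: k_def k'_def\<close>)
  qed
qed

text \<open>The primitive enters only through its limits at 0 and infinity, because the reproducing
  identity applies this to heat convolutions, which are meaningful for t > 0 only. The half-line is
  exhausted by the intervals [1/(n+1), n+1].\<close>

lemma integral_FTC_Ioi:
  fixes f F :: "real \<Rightarrow> 'b::euclidean_space"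
  assumes deriv: "\<And>t. t > 0 \<Longrightarrow> (F has_vector_derivative f t) (at t)"
    and int: "integrable lborel (\<lambda>t. indicator {0<..} t *\<^sub>R f t)"
    and A: "(F \<longlongrightarrow> A) (at_right 0)" and B: "(F \<longlongrightarrow> B) at_top"
  shows "(LINT t|lborel. indicator {0<..} t *\<^sub>R f t) = B - A"
proof -
  define a where "a n = inverse (real (Suc n))" for n
  define b where "b n = real (Suc n)" for n
  have ab: "0 < a n" "a n \<le> b n" for n by (auto simp: a_def b_def field_simps)
  let ?f = "\<lambda>t. indicator {0<..} t *\<^sub>R f t"
  have restrict: "indicator {a n..b n} t *\<^sub>R ?f t = indicator {a n..b n} t *\<^sub>R f t" for n t
    using ab(1)[of n] by (auto simp: indicator_def)
  have val: "(LINT t|lborel. indicator {a n..b n} t *\<^sub>R ?f t) = F (b n) - F (a n)" for n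
  proof -
    have "(f has_integral F (b n) - F (a n)) {a n..b n}"
      using ab[of n] by (intro fundamental_theorem_of_calculus has_vector_derivative_at_within[OF deriv]) auto
    moreover have "set_integrable lborel {a n..b n} f"
      unfolding set_integrable_def restrict[symmetric] by (intro integrable_mult_indicator int) simp
    ultimately show ?thesis
      unfolding restrict using set_borel_integral_eq_integral(2)[of "{a n..b n}" f]
      by (simp add: set_lebesgue_integral_def integral_unique)
  qed
  have "(\<lambda>n. LINT t|lborel. indicator {a n..b n} t *\<^sub>R ?f t) \<longlonglongrightarrow> (LINT t|lborel. ?f t)"
  proof (rule integral_dominated_convergence[where w="\<lambda>t. norm (?f t)"])
    show "AE t in lborel. (\<lambda>n. indicator {a n..b n} t *\<^sub>R ?f t) \<longlonglongrightarrow> ?f t"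
    proof (intro AE_I2)
      fix t
      show "(\<lambda>n. indicator {a n..b n} t *\<^sub>R ?f t) \<longlonglongrightarrow> ?f t"
      proof (cases "t > 0")
        case True
        have "a \<longlonglongrightarrow> 0" unfolding a_def by (rule LIMSEQ_inverse_real_of_nat)
        then have "eventually (\<lambda>n. a n < t) sequentially" by (rule order_tendstoD(2)[OF _ True])
        moreover have "filterlim b at_top sequentially"
          unfolding b_def by (intro filterlim_compose[OF filterlim_real_sequentially] filterlim_Suc)
        then have "eventually (\<lambda>n. t \<le> b n) sequentially" by (simp add: filterlim_at_top)
        ultimately have "eventually (\<lambda>n. indicator {a n..b n} t *\<^sub>R ?f t = ?f t) sequentially"
          by eventually_elim simp
        then show ?thesis by (rule tendsto_eventually)
      qed simp
    qed
    show "AE t in lborel. norm (indicator {a n..b n} t *\<^sub>R ?f t) \<le> norm (?f t)" for n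
      by (intro AE_I2) (simp add: indicator_def)
    show "(\<lambda>t. indicator {a n..b n} t *\<^sub>R ?f t) \<in> borel_measurable lborel" for n
      by (intro borel_measurable_integrable integrable_mult_indicator int) simp
  qed (intro borel_measurable_integrable integrable_norm int)+
  moreover have "(\<lambda>n. F (b n) - F (a n)) \<longlonglongrightarrow> B - A"
    unfolding a_def b_def
    by (intro tendsto_diff filterlim_compose[OF A filterlim_inverse_Suc_at_right]
        filterlim_compose[OF B] filterlim_compose[OF filterlim_real_sequentially] filterlim_Suc)
  ultimately show ?thesis unfolding val by (rule LIMSEQ_unique)
qed

text \<open>Retains of the time kernel only its differential equation, initial values and bounds, so
  that the distinction of the three damping cases ends here. The factor t in \<open>k_bound\<close>
  records the simple zero at 0 that compensates two space derivatives.\<close>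

locale resolvent_kernel =
  fixes \<epsilon> \<alpha> :: real and k k' :: "real \<Rightarrow> real" and c C :: real
  assumes eps: "\<epsilon> > 0" and alpha: "\<alpha> > 0" and c: "c > 0"
    and k_0: "k 0 = 0" and k'_0: "k' 0 = 1 / \<epsilon>\<^sup>2"
    and k_deriv: "\<And>t. (k has_real_derivative k' t) (at t)"
    and k'_deriv: "\<And>t. (k' has_real_derivative - ((k' t + \<alpha> * k t) / \<epsilon>\<^sup>2)) (at t)"
    and k_bound: "\<And>t. t \<ge> 0 \<Longrightarrow> \<bar>k t\<bar> \<le> C * t * exp (- (c * t))"
    and k'_bound: "\<And>t. t \<ge> 0 \<Longrightarrow> \<bar>k' t\<bar> \<le> C * exp (- (c * t))"

lemma resolvent_kernel_exists:
  assumes eps: "\<epsilon> > 0" and alpha: "\<alpha> > 0"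
  obtains k k' c C where "resolvent_kernel \<epsilon> \<alpha> k k' c C"
proof -
  \<comment> \<open>Dividing the equation by \<epsilon>^2 gives 2 m = 1 / \<epsilon>^2 and q =
    \<alpha> / \<epsilon>^2.\<close>
  have mq: "1 / (2 * \<epsilon>\<^sup>2) > 0" "\<alpha> / \<epsilon>\<^sup>2 > 0" using assms by auto
  obtain f f' c B where f: "c > 0" "f 0 = 0" "f' 0 = 1"
    "\<And>t. (f has_real_derivative f' t) (at t)"
    "\<And>t. (f' has_real_derivative - (2 * (1 / (2 * \<epsilon>\<^sup>2)) * f' t + \<alpha> / \<epsilon>\<^sup>2 * f t)) (at t)"
    "\<And>t. t \<ge> 0 \<Longrightarrow> \<bar>f t\<bar> \<le> B * exp (- (c * t))"
    "\<And>t. t \<ge> 0 \<Longrightarrow> \<bar>f' t\<bar> \<le> B * exp (- (c * t))"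
    by (rule damped_oscillator[OF mq]; rule that; assumption)
  have B: "B \<ge> 0" using order_trans[OF abs_ge_zero f(6)[of 0]] by simp
  \<comment> \<open>Mean value inequality for exp(c t) f(t), which vanishes at 0 and has derivative
    exp(c t) (c f + f'), bounded by (c + 1) B. The decay rate is kept while a factor t is
    gained.\<close>
  have f_lin: "\<bar>f t\<bar> \<le> (c + 1) * B * t * exp (- (c * t))" if t: "t \<ge> 0" for t
  proof -
    have "norm (exp (c * t) * f t - exp (c * 0) * f 0) \<le> (c + 1) * B * norm (t - 0)"
    proof (rule differentiable_bound[where S="{0..t}" and f'="\<lambda>s h. h * ((c * f s + f' s) * exp (c * s))"])
      fix s assume s: "s \<in> {0..t}"
      have "((\<lambda>s. exp (c * s) * f s) has_real_derivative (c * f s + f' s) * exp (c * s)) (at s)"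
        by (auto intro!: derivative_eq_intros f(4) simp: algebra_simps)
      then show "((\<lambda>s. exp (c * s) * f s) has_derivative (\<lambda>h. h * ((c * f s + f' s) * exp (c * s)))) (at s within {0..t})"
        unfolding has_field_derivative_def mult.commute[of "(c * f s + f' s) * exp (c * s)"] by (rule has_derivative_at_withinI)
      have "\<bar>c * f s + f' s\<bar> \<le> c * (B * exp (- (c * s))) + B * exp (- (c * s))"
        using f(1) f(6,7)[of s] s by (intro order_trans[OF abs_triangle_ineq] add_mono) (auto simp: abs_mult)
      then have "\<bar>c * f s + f' s\<bar> * exp (c * s) \<le> (c * (B * exp (- (c * s))) + B * exp (- (c * s))) * exp (c * s)"
        by (rule mult_right_mono) simp
      also have "\<dots> = (c + 1) * B * (exp (- (c * s)) * exp (c * s))" by (simp add: algebra_simps)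
      finally have "\<bar>c * f s + f' s\<bar> * exp (c * s) \<le> (c + 1) * B" by (simp add: mult_exp_exp)
      then show "onorm (\<lambda>h. h * ((c * f s + f' s) * exp (c * s))) \<le> (c + 1) * B"
        by (intro onorm_le) (simp add: abs_mult mult.commute[of "(c + 1) * B"] mult_left_mono)
    qed (use t in auto)
    then have "\<bar>f t\<bar> * exp (c * t) * exp (- (c * t)) \<le> (c + 1) * B * t * exp (- (c * t))"
      using t f(2) by (intro mult_right_mono) (auto simp: abs_mult mult.commute)
    moreover have "\<bar>f t\<bar> * exp (c * t) * exp (- (c * t)) = \<bar>f t\<bar>"
      by (simp add: mult.assoc mult_exp_exp)
    ultimately show ?thesis by simp
  qed
  have "resolvent_kernel \<epsilon> \<alpha> (\<lambda>t. f t / \<epsilon>\<^sup>2) (\<lambda>t. f' t / \<epsilon>\<^sup>2) c ((c + 1) * B / \<epsilon>\<^sup>2)"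
  proof
    show "((\<lambda>t. f t / \<epsilon>\<^sup>2) has_real_derivative f' t / \<epsilon>\<^sup>2) (at t)" for t
      by (intro DERIV_cdivide f)
    show "((\<lambda>t. f' t / \<epsilon>\<^sup>2) has_real_derivative - ((f' t / \<epsilon>\<^sup>2 + \<alpha> * (f t / \<epsilon>\<^sup>2)) / \<epsilon>\<^sup>2)) (at t)" for t
      using DERIV_cdivide[OF f(5)[of t], of "\<epsilon>\<^sup>2"] eps by (simp add: field_simps)
    show "\<bar>f t / \<epsilon>\<^sup>2\<bar> \<le> (c + 1) * B / \<epsilon>\<^sup>2 * t * exp (- (c * t))" if "t \<ge> 0" for t
      using divide_right_mono[OF f_lin[OF that], of "\<epsilon>\<^sup>2"] by (simp add: abs_divide)
    show "\<bar>f' t / \<epsilon>\<^sup>2\<bar> \<le> (c + 1) * B / \<epsilon>\<^sup>2 * exp (- (c * t))" if "t \<ge> 0" for t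
    proof -
      have "\<bar>f' t\<bar> \<le> (c + 1) * B * exp (- (c * t))"
        using f(7)[OF that] f(1) B by (simp add: distrib_right add_increasing)
      from divide_right_mono[OF this, of "\<epsilon>\<^sup>2"] show ?thesis by (simp add: abs_divide)
    qed
  qed (use assms f in auto)
  then show ?thesis by (rule that)
qed

text \<open>The function is the modulus of the integrand of Euler's Gamma integral for a real
  argument.\<close>

lemma integrable_powr_exp:
  fixes r a :: real
  assumes "r > 0" "a > 0"
  shows "integrable lborel (\<lambda>t. indicator {0<..} t * (t powr (r - 1) * exp (- (a * t))))"
proof -
  have "(\<lambda>t. complex_of_real t powr (complex_of_real r - 1) / of_real (exp (a * t))) absolutely_integrable_on {0<..}"
    using assms by (intro absolutely_integrable_Gamma_integral) auto
  then have "integrable lebesgue (\<lambda>t. norm (indicator {0<..} t *\<^sub>R (complex_of_real t powr (complex_of_real r - 1) / of_real (exp (a * t)))))"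
    unfolding set_integrable_def by (rule integrable_norm)
  moreover have "norm (indicator {0<..} t *\<^sub>R (complex_of_real t powr (complex_of_real r - 1) / of_real (exp (a * t)))) =
      indicator {0<..} t * (t powr (r - 1) * exp (- (a * t)))" for t
    using norm_powr_real_powr[of "complex_of_real t" "complex_of_real r - 1"]
    by (cases "t > 0") (simp_all add: norm_divide exp_minus divide_inverse[symmetric])
  ultimately have "integrable lebesgue (\<lambda>t. indicator {0<..} t * (t powr (r - 1) * exp (- (a * t))))" by (simp only:)
  then show ?thesis
    by (subst (asm) integrable_completion) auto
qed

section \<open>Bounds and Laplace transform of the time kernel\<close>

context resolvent_kernel
begin

text \<open>The cutoff lets time integrals run over the whole line while suppressing the times at
  which \<open>heat\<close> has no meaning.\<close>

definition k_pos :: "real \<Rightarrow> real" where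
  "k_pos t = indicator {0<..} t * k t"

text \<open>Half of the exponential rate is kept; the other half absorbs the polynomial growth in
  \<open>k_pos_bound\<close>.\<close>

definition decay :: "real \<Rightarrow> real" where
  "decay t = indicator {0<..} t * exp (- (c / 2 * t))"

lemma k_measurable[measurable]: "k \<in> borel_measurable borel"
  by (intro borel_measurable_continuous_onI continuous_at_imp_continuous_on ballI DERIV_isCont[OF k_deriv])

lemma k_pos_measurable[measurable]: "k_pos \<in> borel_measurable borel"
  unfolding k_pos_def by measurable

lemma decay_measurable[measurable]: "decay \<in> borel_measurable borel"
  unfolding decay_def by measurable

lemma C_nonneg: "C \<ge> 0"
  using order_trans[OF abs_ge_zero k'_bound[of 0]] by simp

text \<open>The simple zero of \<open>k\<close> at 0 outweighs up to two factors t^(-1/2), since t *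
  t^(-n/2) \<le> 1 + t for n \<le> 2. The growing factor is then absorbed by (1 + t) exp(-c t/2)
  \<le> 1 + 2/c.\<close>

lemma k_pos_bound:
  assumes n: "n \<le> 2"
  shows "\<bar>k_pos t\<bar> * (1 / sqrt t) ^ n \<le> C * (1 + 2 / c) * decay t"
proof (cases "t > 0")
  case True
  have "t * (1 / sqrt t) ^ n \<le> 1 + t"
  proof -
    consider "n = 0" | "n = 1" | "n = 2" using n by linarith
    then show ?thesis
    proof cases
      case 2
      have "t * (1 / sqrt t) = sqrt t" using True by (simp add: real_div_sqrt)
      also have "\<dots> \<le> 1 + t"
        using True by (intro real_le_lsqrt) (auto simp: power2_eq_square algebra_simps)
      finally show ?thesis using 2 by simp
    qed (use True in \<open>auto simp: power_divide\<close>)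
  qed
  moreover have "(1 + t) * exp (- (c / 2 * t)) \<le> 1 + 2 / c"
  proof -
    have "(c / 2 * t) * exp (- (c / 2 * t)) \<le> 1" "exp (- (c / 2 * t)) \<le> 1"
      using c True by (intro exp_neg_bounds; simp)+
    moreover from this(1) have "t * exp (- (c / 2 * t)) \<le> 2 / c" using c by (simp add: field_simps)
    ultimately show ?thesis unfolding distrib_right by linarith
  qed
  moreover have "\<bar>k t\<bar> * (1 / sqrt t) ^ n \<le> C * t * exp (- (c * t)) * (1 / sqrt t) ^ n"
    using True by (intro mult_right_mono k_bound) auto
  ultimately have "\<bar>k t\<bar> * (1 / sqrt t) ^ n \<le> C * ((1 + t) * exp (- (c * t)))"
    using C_nonneg mult_left_mono[of "t * (1 / sqrt t) ^ n" "1 + t" "C * exp (- (c * t))"] by (simp add: mult_ac)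
  also have "(1 + t) * exp (- (c * t)) = ((1 + t) * exp (- (c / 2 * t))) * exp (- (c / 2 * t))"
    by (simp add: mult.assoc mult_exp_exp)
  also have "C * \<dots> \<le> C * ((1 + 2 / c) * exp (- (c / 2 * t)))"
    using \<open>(1 + t) * exp (- (c / 2 * t)) \<le> 1 + 2 / c\<close> C_nonneg by (intro mult_left_mono mult_right_mono) auto
  finally show ?thesis using True by (simp add: k_pos_def decay_def mult.assoc)
qed (simp add: k_pos_def decay_def)

lemma decay_integrable: "integrable lborel (\<lambda>t. decay t * (1 + t powr (- 3 / 4)))"
proof -
  have "integrable lborel (\<lambda>t. indicator {0<..} t * (t powr (1 - 1) * exp (- (c / 2 * t))) +
      indicator {0<..} t * (t powr (1 / 4 - 1) * exp (- (c / 2 * t))))"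
    using c by (intro Bochner_Integration.integrable_add integrable_powr_exp) auto
  moreover have "indicator {0<..} t * (t powr (1 - 1) * exp (- (c / 2 * t))) +
      indicator {0<..} t * (t powr (1 / 4 - 1) * exp (- (c / 2 * t))) = decay t * (1 + t powr (- 3 / 4))" for t
    by (auto simp: decay_def indicator_def algebra_simps)
  ultimately show ?thesis by simp
qed

text \<open>At 0 the integrand is at worst t * t^(-3/2) = t^(-1/2). The power is the supremum over
  space of the heat kernel, so this controls the underived Green function pointwise and also the
  Fubini argument for the Fourier integral.\<close>

lemma k_pos_power_integrable:
  assumes d: "d \<le> 3"
  shows "integrable lborel (\<lambda>t. \<bar>k_pos t\<bar> * \<bar>(1 / sqrt (4 * pi * t)) ^ d\<bar>)"
proof (rule Bochner_Integration.integrable_bound)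
  show "integrable lborel (\<lambda>t. C * (indicator {0<..} t * (t powr (2 - 1) * exp (- (c * t))) +
      indicator {0<..} t * (t powr (1 / 2 - 1) * exp (- (c * t)))))"
    using c by (intro integrable_mult_right Bochner_Integration.integrable_add integrable_powr_exp) auto
  have "\<bar>k_pos t\<bar> * \<bar>(1 / sqrt (4 * pi * t)) ^ d\<bar> \<le> C * (indicator {0<..} t * (t powr (2 - 1) * exp (- (c * t))) +
      indicator {0<..} t * (t powr (1 / 2 - 1) * exp (- (c * t))))" for t
  proof (cases "t > 0")
    case True
    have "4 * pi \<ge> 1" using pi_gt3 by linarith
    then have "(1 / sqrt (4 * pi * t)) ^ d \<le> 1 + t powr (- (3 / 2))"
      using heat_power_bound[OF True d, of "4 * pi"] inverse_sqrt_powr[OF True, of 3] by simp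
    then have "\<bar>k_pos t\<bar> * \<bar>(1 / sqrt (4 * pi * t)) ^ d\<bar> \<le> (C * t * exp (- (c * t))) * (1 + t powr (- (3 / 2)))"
      using True k_bound[of t] C_nonneg by (intro mult_mono) (auto simp: k_pos_def)
    also have "\<dots> = C * (t powr 1 * exp (- (c * t)) + (t powr 1 * t powr (- (3 / 2))) * exp (- (c * t)))"
      using True by (simp add: algebra_simps del: powr_one)
    also have "t powr 1 * t powr (- (3 / 2)) = t powr (1 / 2 - 1)"
      unfolding powr_add[symmetric] by simp
    finally show ?thesis using True by simp
  qed (simp add: k_pos_def)
  from order_trans[OF this abs_ge_self]
  show "AE t in lborel. norm (\<bar>k_pos t\<bar> * \<bar>(1 / sqrt (4 * pi * t)) ^ d\<bar>) \<le>
      norm (C * (indicator {0<..} t * (t powr (2 - 1) * exp (- (c * t))) +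
      indicator {0<..} t * (t powr (1 / 2 - 1) * exp (- (c * t)))))"
    by (intro AE_I2) (simp only: real_norm_def abs_mult abs_abs order_trans[OF _ abs_ge_self])
qed measurable

lemma k_pos_laplace:
  assumes s: "s \<ge> 0"
  shows "integrable lborel (\<lambda>t. k_pos t * exp (- (t * s)))"
    "(LINT t|lborel. k_pos t * exp (- (t * s))) = 1 / (\<epsilon>\<^sup>2 * s\<^sup>2 + s + \<alpha>)"
proof -
  let ?m = "\<epsilon>\<^sup>2 * s\<^sup>2 + s + \<alpha>"
  have m: "?m > 0" using s alpha by (intro add_nonneg_pos add_nonneg_nonneg) auto
  \<comment> \<open>A primitive of k(t) exp(-t s): by the differential equation the bracket times
    the exponential has derivative -\<open>?m\<close> k(t) exp(-t s). At 0 the bracket equals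
    \<epsilon>^2 k'(0) = 1, which produces the value 1 / \<open>?m\<close>.\<close>
  define F where "F t = - ((\<epsilon>\<^sup>2 * k' t + (1 + \<epsilon>\<^sup>2 * s) * k t) * exp (- (t * s))) / ?m" for t
  have int: "integrable lborel (\<lambda>t. k_pos t * exp (- (t * s)))"
  proof (rule Bochner_Integration.integrable_bound[OF k_pos_power_integrable[of 0]])
    have "\<bar>k_pos t * exp (- (t * s))\<bar> \<le> \<bar>k_pos t\<bar>" for t
    proof (cases "t > 0")
      case True
      then have "exp (- (t * s)) \<le> 1" using s by simp
      then show ?thesis using mult_left_mono[of "exp (- (t * s))" 1 "\<bar>k_pos t\<bar>"] by (simp add: abs_mult)
    qed (simp add: k_pos_def)
    then show "AE t in lborel. norm (k_pos t * exp (- (t * s))) \<le> norm (\<bar>k_pos t\<bar> * \<bar>(1 / sqrt (4 * pi * t)) ^ 0\<bar>)"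
      by simp
  qed (simp, measurable)
  then show "integrable lborel (\<lambda>t. k_pos t * exp (- (t * s)))" .
  have cont: "isCont k t" for t by (rule DERIV_isCont[OF k_deriv])
  have exp0: "((\<lambda>t. exp (- (c * t))) \<longlongrightarrow> 0) at_top"
    using c by real_asymp
  have texp0: "((\<lambda>t. t * exp (- (c * t))) \<longlongrightarrow> 0) at_top"
    using c by real_asymp
  have k_lim: "(k \<longlongrightarrow> 0) at_top"
  proof (rule Lim_null_comparison)
    show "eventually (\<lambda>t. norm (k t) \<le> C * (t * exp (- (c * t)))) at_top"
      using eventually_ge_at_top[of 0] by eventually_elim (use k_bound in \<open>simp add: mult.assoc\<close>)
    show "((\<lambda>t. C * (t * exp (- (c * t)))) \<longlongrightarrow> 0) at_top"
      using tendsto_mult_left[OF texp0, of C] by simp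
  qed
  have k'_lim: "(k' \<longlongrightarrow> 0) at_top"
  proof (rule Lim_null_comparison)
    show "eventually (\<lambda>t. norm (k' t) \<le> C * exp (- (c * t))) at_top"
      using eventually_ge_at_top[of 0] by eventually_elim (use k'_bound in simp)
    show "((\<lambda>t. C * exp (- (c * t))) \<longlongrightarrow> 0) at_top"
      using tendsto_mult_left[OF exp0, of C] by simp
  qed
  have F_lim: "(F \<longlongrightarrow> 0) at_top"
  proof (rule Lim_null_comparison)
    show "eventually (\<lambda>t. norm (F t) \<le> \<bar>\<epsilon>\<^sup>2 * k' t + (1 + \<epsilon>\<^sup>2 * s) * k t\<bar> / ?m) at_top"
      using eventually_ge_at_top[of 0]
    proof eventually_elim
      case (elim t)
      then have "exp (- (t * s)) \<le> 1" using s by simp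
      then show ?case
        using m mult_left_mono[of "exp (- (t * s))" 1 "\<bar>\<epsilon>\<^sup>2 * k' t + (1 + \<epsilon>\<^sup>2 * s) * k t\<bar>"]
        by (simp add: F_def abs_mult divide_right_mono)
    qed
    have "((\<lambda>t. \<bar>\<epsilon>\<^sup>2 * k' t + (1 + \<epsilon>\<^sup>2 * s) * k t\<bar> / ?m) \<longlongrightarrow> \<bar>\<epsilon>\<^sup>2 * 0 + (1 + \<epsilon>\<^sup>2 * s) * 0\<bar> / ?m) at_top"
      using m by (intro tendsto_intros k_lim k'_lim) auto
    then show "((\<lambda>t. \<bar>\<epsilon>\<^sup>2 * k' t + (1 + \<epsilon>\<^sup>2 * s) * k t\<bar> / ?m) \<longlongrightarrow> 0) at_top" by simp
  qed
  have F_deriv: "(F has_real_derivative k t * exp (- (t * s))) (at t)" for t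
  proof -
    let ?P = "\<epsilon>\<^sup>2 * k' t + (1 + \<epsilon>\<^sup>2 * s) * k t"
    let ?P' = "\<epsilon>\<^sup>2 * - ((k' t + \<alpha> * k t) / \<epsilon>\<^sup>2) + (1 + \<epsilon>\<^sup>2 * s) * k' t"
    have "((\<lambda>t. \<epsilon>\<^sup>2 * k' t + (1 + \<epsilon>\<^sup>2 * s) * k t) has_real_derivative ?P') (at t)"
      by (intro DERIV_add DERIV_cmult k_deriv k'_deriv)
    moreover have "((\<lambda>t. exp (- (t * s))) has_real_derivative exp (- (t * s)) * - s) (at t)"
      by (auto intro!: derivative_eq_intros)
    ultimately have "(F has_real_derivative - (?P' * exp (- (t * s)) + exp (- (t * s)) * - s * ?P) / ?m) (at t)"
      unfolding F_def by (intro DERIV_cdivide DERIV_minus DERIV_mult)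
    moreover have "- (?P' * exp (- (t * s)) + exp (- (t * s)) * - s * ?P) = ?m * (k t * exp (- (t * s)))"
    proof -
      have h: "\<epsilon>\<^sup>2 * - ((k' t + \<alpha> * k t) / \<epsilon>\<^sup>2) = - (k' t + \<alpha> * k t)" using eps by simp
      show ?thesis unfolding h by (simp add: algebra_simps power2_eq_square)
    qed
    ultimately show ?thesis using m by simp
  qed
  have "(LINT t|lborel. indicator {0<..} t *\<^sub>R (k t * exp (- (t * s)))) = 0 - F 0"
  proof (rule integral_FTC_Ioi)
    show "(F has_vector_derivative k t * exp (- (t * s))) (at t)" for t
      using F_deriv by (simp add: has_real_derivative_iff_has_vector_derivative)
    show "integrable lborel (\<lambda>t. indicator {0<..} t *\<^sub>R (k t * exp (- (t * s))))"
      using int by (simp add: k_pos_def mult.assoc)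
    show "(F \<longlongrightarrow> F 0) (at_right 0)"
      using DERIV_isCont[OF F_deriv, of 0] by (simp add: isCont_def filterlim_at_split)
  qed (rule F_lim)
  then have "(LINT t|lborel. k_pos t * exp (- (t * s))) = 0 - F 0"
    by (simp add: k_pos_def mult.assoc)
  moreover have "F 0 = - 1 / ?m" using eps by (simp add: F_def k_0 k'_0)
  ultimately show "(LINT t|lborel. k_pos t * exp (- (t * s))) = 1 / ?m" by simp
qed

end

lemma heat_test_by_parts:
  fixes y :: "'a::euclidean_space"
  assumes t: "t > 0" and bs: "set bs \<subseteq> Basis" "length bs \<le> 2" and \<phi>: "test_function \<phi>"
  shows "(LINT x|lborel. complex_of_real (heat t (x - y)) * iter_partial bs \<phi> x) =
    (- 1) ^ length bs * (LINT x|lborel. complex_of_real (heatD t bs (x - y)) * \<phi> x)"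
proof -
  have S0: "smooth_fun (\<lambda>x. complex_of_real (heatD t [] (x - y)))" by (simp add: smooth_fun_heat)
  have S1: "smooth_fun (\<lambda>x. complex_of_real (heatD t [b] (x - y)))" if "b \<in> Basis" for b
    using that by (intro smooth_fun_heatD t) auto
  have D1: "iter_partial [b] (\<lambda>x. complex_of_real (heatD t [] (x - y))) = (\<lambda>x. complex_of_real (heatD t [b] (x - y)))" for b
    by (rule iter_partial_heatD[OF t]) simp
  have D2: "iter_partial [b] (\<lambda>x. complex_of_real (heatD t [a] (x - y))) = (\<lambda>x. complex_of_real (heatD t [b, a] (x - y)))" for a b
    by (rule iter_partial_heatD[OF t]) simp
  have 1: "(LINT x|lborel. complex_of_real (heat t (x - y)) * iter_partial [b] \<psi> x) =
      - (LINT x|lborel. complex_of_real (heatD t [b] (x - y)) * \<psi> x)" if "b \<in> Basis" "test_function \<psi>" for b \<psi>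
    using integral_by_parts_test[OF S0 that(2,1)] unfolding D1 unfolding heatD.simps(1) .
  have 2: "(LINT x|lborel. complex_of_real (heatD t [a] (x - y)) * iter_partial [b] \<psi> x) =
      - (LINT x|lborel. complex_of_real (heatD t [b, a] (x - y)) * \<psi> x)" if "a \<in> Basis" "b \<in> Basis" "test_function \<psi>" for a b \<psi>
    using integral_by_parts_test[OF S1[OF that(1)] that(3,2)] unfolding D2 .
  show ?thesis
    using bs(2)
  proof (cases rule: list_length_le_2_cases)
    case (2 b)
    then show ?thesis using 1[of b \<phi>] bs \<phi> by (simp del: heatD.simps iter_partial.simps)
  next
    case (3 a b)
    have ab: "a \<in> Basis" "b \<in> Basis" using bs 3 by auto
    have "(LINT x|lborel. complex_of_real (heat t (x - y)) * iter_partial [a] (iter_partial [b] \<phi>) x) =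
        - (LINT x|lborel. complex_of_real (heatD t [a] (x - y)) * iter_partial [b] \<phi> x)"
      by (rule 1[OF ab(1) test_function_partial[OF \<phi> ab(2)]])
    also have "\<dots> = (LINT x|lborel. complex_of_real (heatD t [b, a] (x - y)) * \<phi> x)"
      unfolding 2[OF ab \<phi>] by simp
    also have "iter_partial [a] (iter_partial [b] \<phi>) = iter_partial bs \<phi>" using 3 by simp
    \<comment> \<open>Transferring the derivatives reverses their order; the explicit second
      derivative of the Gaussian is symmetric in its two directions.\<close>
    also have "heatD t [b, a] = heatD t bs" by (auto simp: fun_eq_iff 3 inner_commute mult.commute)
    finally show ?thesis using 3 by simp
  qed simp
qed

lemma heat_conv_bound:
  fixes u :: "'a::euclidean_space \<Rightarrow> complex"
  assumes "t > 0" "DIM('a) \<le> 3" "u \<in> L2"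
  shows "cmod (heat_conv t u y) \<le> (1 + t powr (- 3 / 4)) * L2_norm u"
proof -
  have "cmod (heat_conv t u y) \<le> L2_norm (\<lambda>x. complex_of_real (heat t (x - y))) * L2_norm u"
    unfolding heat_conv_def by (intro Cauchy_Schwarz_L2 heat_L2 assms)
  also have "\<dots> \<le> (1 + t powr (- 3 / 4)) * L2_norm u"
    by (intro mult_right_mono heat_L2_norm_bound assms L2_norm_nonneg)
  finally show ?thesis .
qed

section \<open>The Green function and its weak derivatives\<close>

context resolvent_kernel
begin

text \<open>For nonempty \<open>bs\<close> the integral may diverge at \<open>z = 0\<close>, where it has the junk value 0.\<close>

definition green_deriv :: "'a::euclidean_space list \<Rightarrow> 'a \<Rightarrow> real" where
  "green_deriv bs z = (LINT t|lborel. k_pos t * heatD t bs z)"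

text \<open>One function dominating, up to a constant, the time integral of every derivative of
  order at most two. It takes extended values because it is infinite at x = y in dimensions 2 and
  3.\<close>

definition majorant :: "'a::euclidean_space \<Rightarrow> 'a \<Rightarrow> ennreal" where
  "majorant y x = (\<integral>\<^sup>+t. ennreal (decay t * heat (2 * t) (x - y)) \<partial>lborel)"

text \<open>The product of the constants of \<open>heatD_bound\<close> and
  \<open>k_pos_bound\<close>; the type argument carries the dimension.\<close>

definition majorant_const :: "'a::euclidean_space itself \<Rightarrow> real" where
  "majorant_const _ = 3 * sqrt 2 ^ DIM('a) * (C * (1 + 2 / c))"

lemma majorant_const_nonneg: "majorant_const TYPE('a::euclidean_space) \<ge> 0"
  using C_nonneg c by (simp add: majorant_const_def)

lemma k_pos_heatD_bound:
  fixes z :: "'a::euclidean_space"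
  assumes "length bs \<le> 2" "set bs \<subseteq> Basis"
  shows "\<bar>k_pos t * heatD t bs z\<bar> \<le> majorant_const TYPE('a) * (decay t * heat (2 * t) z)"
proof (cases "t > 0")
  case True
  have "\<bar>k_pos t * heatD t bs z\<bar> \<le> \<bar>k_pos t\<bar> * (3 * sqrt 2 ^ DIM('a) * (1 / sqrt t) ^ length bs * heat (2 * t) z)"
    unfolding abs_mult by (intro mult_left_mono heatD_bound True assms) simp
  also have "\<dots> = (\<bar>k_pos t\<bar> * (1 / sqrt t) ^ length bs) * (3 * sqrt 2 ^ DIM('a) * heat (2 * t) z)"
    by simp
  also have "\<dots> \<le> (C * (1 + 2 / c) * decay t) * (3 * sqrt 2 ^ DIM('a) * heat (2 * t) z)"
    using heat_pos[of "2 * t" z] True by (intro mult_right_mono k_pos_bound assms) auto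
  finally show ?thesis by (simp add: majorant_const_def mult_ac)
qed (simp add: k_pos_def decay_def)

lemma decay_heat_measurable[measurable]:
  "(\<lambda>(t, x). decay t * heat (2 * t) (x - y)) \<in> borel_measurable (borel \<Otimes>\<^sub>M borel)"
  "(\<lambda>(x, t). decay t * heat (2 * t) (x - y)) \<in> borel_measurable (borel \<Otimes>\<^sub>M borel)"
  unfolding heat_def by measurable

lemma majorant_measurable[measurable]: "majorant y \<in> borel_measurable borel"
  unfolding majorant_def by (intro lborel.borel_measurable_nn_integral) measurable

text \<open>Cauchy-Schwarz in \<open>t\<close> with the weight \<open>rho\<close>, which dominates the \<open>L\<^sup>2\<close> norm of the heat kernel.\<close>

lemma majorant_square:
  fixes y :: "'a::euclidean_space"
  assumes d: "DIM('a) \<le> 3"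
  shows "(\<integral>\<^sup>+x. (majorant y x)\<^sup>2 \<partial>lborel) < \<infinity>"
proof -
  define rho where "rho t = 1 + t powr (- 3 / 4)" for t :: real
  have rho: "rho t > 0" for t by (simp add: rho_def add_pos_nonneg)
  define f where "f t = sqrt (decay t * rho t)" for t
  define g where "g t x = sqrt (decay t / rho t) * heat (2 * t) (x - y)" for t x
  have decay: "decay t \<ge> 0" for t by (simp add: decay_def)
  have [measurable]: "rho \<in> borel_measurable borel" unfolding rho_def by measurable
  have [measurable]: "f \<in> borel_measurable borel" unfolding f_def by measurable
  have gm[measurable]: "(\<lambda>(t, x). g t x) \<in> borel_measurable (borel \<Otimes>\<^sub>M borel)" "(\<lambda>(x, t). g t x) \<in> borel_measurable (borel \<Otimes>\<^sub>M borel)"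
    unfolding g_def heat_def by measurable
  define A where "A = (\<integral>\<^sup>+t. ennreal (decay t * rho t) \<partial>lborel)"
  have A: "A < \<infinity>"
    using decay_integrable decay rho less_imp_le[OF rho]
    unfolding A_def rho_def by (subst nn_integral_eq_integral) auto
  have fg: "ennreal (decay t * heat (2 * t) (x - y)) = ennreal (f t) * ennreal (g t x)" for t x
  proof -
    have "f t * g t x = decay t * heat (2 * t) (x - y)"
      using decay[of t] rho[of t] by (simp add: f_def g_def real_sqrt_mult real_sqrt_divide)
    then show ?thesis using decay[of t] rho[of t] by (simp add: f_def flip: ennreal_mult')
  qed
  have "(majorant y x)\<^sup>2 \<le> A * (\<integral>\<^sup>+t. ennreal ((g t x)\<^sup>2) \<partial>lborel)" for x
  proof -
    have "(majorant y x)\<^sup>2 \<le> (\<integral>\<^sup>+t. (ennreal (f t))\<^sup>2 \<partial>lborel) * (\<integral>\<^sup>+t. (ennreal (g t x))\<^sup>2 \<partial>lborel)"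
      unfolding majorant_def fg by (rule Cauchy_Schwarz_nn_integral) auto
    also have "(\<integral>\<^sup>+t. (ennreal (f t))\<^sup>2 \<partial>lborel) = A"
      unfolding A_def using decay less_imp_le[OF rho] by (intro nn_integral_cong) (simp add: f_def ennreal_power)
    also have "A * (\<integral>\<^sup>+t. (ennreal (g t x))\<^sup>2 \<partial>lborel) \<le> A * (\<integral>\<^sup>+t. ennreal ((g t x)\<^sup>2) \<partial>lborel)"
    proof (intro mult_left_mono nn_integral_mono)
      show "(ennreal (g t x))\<^sup>2 \<le> ennreal ((g t x)\<^sup>2)" for t
        by (cases "g t x \<ge> 0") (auto simp: ennreal_power ennreal_neg)
    qed simp
    finally show ?thesis .
  qed
  then have "(\<integral>\<^sup>+x. (majorant y x)\<^sup>2 \<partial>lborel) \<le> (\<integral>\<^sup>+x. A * (\<integral>\<^sup>+t. ennreal ((g t x)\<^sup>2) \<partial>lborel) \<partial>lborel)"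
    by (rule nn_integral_mono)
  also have "\<dots> = A * (\<integral>\<^sup>+x. (\<integral>\<^sup>+t. ennreal ((g t x)\<^sup>2) \<partial>lborel) \<partial>lborel)"
    by (intro nn_integral_cmult lborel.borel_measurable_nn_integral) measurable
  also have "(\<integral>\<^sup>+x. (\<integral>\<^sup>+t. ennreal ((g t x)\<^sup>2) \<partial>lborel) \<partial>lborel) = (\<integral>\<^sup>+t. (\<integral>\<^sup>+x. ennreal ((g t x)\<^sup>2) \<partial>lborel) \<partial>lborel)"
    by (intro lborel_pair.Fubini') measurable
  \<comment> \<open>The squared L2 norm of the kernel at time 2t is at most \<open>rho t\<close>
    squared, so dividing by the weight leaves \<open>decay t * rho t\<close>, and the second
    Cauchy-Schwarz factor is bounded by \<open>A\<close> as well.\<close>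
  also have "\<dots> \<le> A"
    unfolding A_def
  proof (intro nn_integral_mono)
    fix t
    show "(\<integral>\<^sup>+x. ennreal ((g t x)\<^sup>2) \<partial>lborel) \<le> ennreal (decay t * rho t)"
    proof (cases "t > 0")
      case True
      then have t2: "2 * t > 0" by simp
      have "(g t x)\<^sup>2 = decay t / rho t * (heat (2 * t) (x - y))\<^sup>2" for x
        using decay[of t] rho[of t] by (simp add: g_def power_mult_distrib)
      moreover have "integrable lborel (\<lambda>x. decay t / rho t * (heat (2 * t) (x - y))\<^sup>2)"
        by (intro integrable_mult_right heat_shift_square_integral t2)
      ultimately have "(\<integral>\<^sup>+x. ennreal ((g t x)\<^sup>2) \<partial>lborel) = ennreal (LINT x|lborel. decay t / rho t * (heat (2 * t) (x - y))\<^sup>2)"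
        using decay[of t] rho[of t] by (simp only:) (intro nn_integral_eq_integral, auto)
      also have "(LINT x|lborel. decay t / rho t * (heat (2 * t) (x - y))\<^sup>2) = decay t / rho t * (1 / sqrt (8 * pi * (2 * t))) ^ DIM('a)"
        by (simp add: heat_shift_square_integral[OF t2])
      also have "\<dots> \<le> decay t / rho t * (rho t)\<^sup>2"
      proof (intro mult_left_mono)
        have "sqrt ((1 / sqrt (8 * pi * (2 * t))) ^ DIM('a)) \<le> 1 + (2 * t) powr (- 3 / 4)"
          using heat_L2_norm_bound[OF t2 d, of y] heat_L2_norm[OF t2, of y] by simp
        also have "\<dots> \<le> rho t" unfolding rho_def using True by (intro add_left_mono powr_mono2') auto
        finally have "(sqrt ((1 / sqrt (8 * pi * (2 * t))) ^ DIM('a)))\<^sup>2 \<le> (rho t)\<^sup>2"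
          by (rule power_mono) (use True in simp)
        then show "(1 / sqrt (8 * pi * (2 * t))) ^ DIM('a) \<le> (rho t)\<^sup>2" using True by simp
      qed (use decay[of t] rho[of t] in simp)
      also have "\<dots> = decay t * rho t" using rho[of t] by (simp add: power2_eq_square)
      finally show ?thesis by (simp add: ennreal_leI)
    qed (simp add: g_def decay_def)
  qed
  also have "A * A < \<infinity>" using A by (simp add: ennreal_mult_less_top)
  finally show ?thesis by (simp add: mult_left_mono)
qed

text \<open>Where the time integral diverges, the Bochner integral has the value 0 and the bound is
  trivial, so the estimate holds at every point, including the pole.\<close>

lemma green_deriv_bound:
  fixes x y :: "'a::euclidean_space"
  assumes "length bs \<le> 2" "set bs \<subseteq> Basis"
  shows "ennreal \<bar>green_deriv bs (x - y)\<bar> \<le> ennreal (majorant_const TYPE('a)) * majorant y x"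
proof (cases "integrable lborel (\<lambda>t. k_pos t * heatD t bs (x - y))")
  case True
  have "ennreal \<bar>green_deriv bs (x - y)\<bar> \<le> (\<integral>\<^sup>+t. ennreal (norm (k_pos t * heatD t bs (x - y))) \<partial>lborel)"
    unfolding green_deriv_def real_norm_def[symmetric] by (rule integral_norm_bound_ennreal[OF True])
  also have "\<dots> \<le> (\<integral>\<^sup>+t. ennreal (majorant_const TYPE('a)) * ennreal (decay t * heat (2 * t) (x - y)) \<partial>lborel)"
    unfolding real_norm_def ennreal_mult'[OF majorant_const_nonneg, symmetric]
    by (intro nn_integral_mono ennreal_leI k_pos_heatD_bound assms)
  also have "\<dots> = ennreal (majorant_const TYPE('a)) * majorant y x"
    unfolding majorant_def by (intro nn_integral_cmult) measurable
  finally show ?thesis .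
qed (simp add: green_deriv_def not_integrable_integral_eq)

lemma k_pos_heatD_measurable[measurable]:
  "(\<lambda>(t, x). k_pos t * heatD t bs (x - y)) \<in> borel_measurable (borel \<Otimes>\<^sub>M borel)"
  "(\<lambda>(x, t). k_pos t * heatD t bs (x - y)) \<in> borel_measurable (borel \<Otimes>\<^sub>M borel)"
proof -
  show "(\<lambda>(t, x). k_pos t * heatD t bs (x - y)) \<in> borel_measurable (borel \<Otimes>\<^sub>M borel)"
    using heatD_shift_measurable[of bs y] by (simp add: split_beta')
  from measurable_pair_swap[OF this]
  show "(\<lambda>(x, t). k_pos t * heatD t bs (x - y)) \<in> borel_measurable (borel \<Otimes>\<^sub>M borel)"
    by (simp add: split_beta')
qed

lemma green_deriv_L2:
  fixes y :: "'a::euclidean_space"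
  assumes d: "DIM('a) \<le> 3" and bs: "length bs \<le> 2" "set bs \<subseteq> Basis"
  shows "(\<lambda>x. complex_of_real (green_deriv bs (x - y))) \<in> L2"
proof -
  have m[measurable]: "(\<lambda>x. green_deriv bs (x - y)) \<in> borel_measurable borel"
    unfolding green_deriv_def by (intro lborel.borel_measurable_lebesgue_integral) measurable
  have "(\<integral>\<^sup>+x. ennreal (norm ((cmod (complex_of_real (green_deriv bs (x - y))))\<^sup>2)) \<partial>lborel) \<le>
      (\<integral>\<^sup>+x. (ennreal (majorant_const TYPE('a)))\<^sup>2 * (majorant y x)\<^sup>2 \<partial>lborel)"
  proof (intro nn_integral_mono)
    fix x
    have "(ennreal \<bar>green_deriv bs (x - y)\<bar>)\<^sup>2 \<le> (ennreal (majorant_const TYPE('a)) * majorant y x)\<^sup>2"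
      by (intro power_mono green_deriv_bound bs) simp
    then show "ennreal (norm ((cmod (complex_of_real (green_deriv bs (x - y))))\<^sup>2)) \<le> (ennreal (majorant_const TYPE('a)))\<^sup>2 * (majorant y x)\<^sup>2"
      by (simp add: ennreal_power power_mult_distrib)
  qed
  also have "\<dots> = (ennreal (majorant_const TYPE('a)))\<^sup>2 * (\<integral>\<^sup>+x. (majorant y x)\<^sup>2 \<partial>lborel)"
    by (intro nn_integral_cmult) measurable
  also have "\<dots> < \<infinity>"
    using majorant_square[OF d, of y] by (simp add: ennreal_mult_less_top ennreal_power[OF majorant_const_nonneg])
  finally have "integrable lborel (\<lambda>x. (cmod (complex_of_real (green_deriv bs (x - y))))\<^sup>2)"
    by (intro integrableI_bounded) measurable
  then show ?thesis by (simp add: L2_def)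
qed

text \<open>Fubini, with absolute convergence from the Cauchy-Schwarz inequality for the majorant
  and |u|. Statements about \<open>green_deriv\<close> as a distribution reduce through this to
  statements about the heat kernel at a fixed time.\<close>

lemma green_deriv_pairing:
  fixes y :: "'a::euclidean_space" and u :: "'a \<Rightarrow> complex"
  assumes d: "DIM('a) \<le> 3" and bs: "length bs \<le> 2" "set bs \<subseteq> Basis" and u: "u \<in> L2"
  shows "integrable lborel (\<lambda>t. complex_of_real (k_pos t) * (LINT x|lborel. complex_of_real (heatD t bs (x - y)) * u x))"
    and "(LINT x|lborel. complex_of_real (green_deriv bs (x - y)) * u x) =
      (LINT t|lborel. complex_of_real (k_pos t) * (LINT x|lborel. complex_of_real (heatD t bs (x - y)) * u x))"
proof -
  note [measurable] = L2_measurable[OF u]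
  let ?f = "\<lambda>(t, x). complex_of_real (k_pos t * heatD t bs (x - y)) * u x"
  have m[measurable]: "?f \<in> borel_measurable (lborel \<Otimes>\<^sub>M lborel)"
    using k_pos_heatD_measurable(1)[of bs y] by (simp add: split_beta')
  have "(\<integral>\<^sup>+x. majorant y x * ennreal (cmod (u x)) \<partial>lborel)\<^sup>2 \<le> (\<integral>\<^sup>+x. (majorant y x)\<^sup>2 \<partial>lborel) * (\<integral>\<^sup>+x. (ennreal (cmod (u x)))\<^sup>2 \<partial>lborel)"
    by (rule Cauchy_Schwarz_nn_integral) auto
  also have "(\<integral>\<^sup>+x. (ennreal (cmod (u x)))\<^sup>2 \<partial>lborel) < \<infinity>"
    using L2_square_integrable[OF u] by (simp add: ennreal_power nn_integral_eq_integral)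
  then have "(\<integral>\<^sup>+x. (majorant y x)\<^sup>2 \<partial>lborel) * (\<integral>\<^sup>+x. (ennreal (cmod (u x)))\<^sup>2 \<partial>lborel) < \<infinity>"
    using majorant_square[OF d, of y] by (simp add: ennreal_mult_less_top)
  finally have SSu: "(\<integral>\<^sup>+x. majorant y x * ennreal (cmod (u x)) \<partial>lborel) < \<infinity>"
    by (auto simp: power2_eq_square ennreal_mult_less_top)
  have int: "integrable (lborel \<Otimes>\<^sub>M lborel) ?f"
  proof (rule integrableI_bounded[OF m])
    have "(\<integral>\<^sup>+p. ennreal (norm (?f p)) \<partial>(lborel \<Otimes>\<^sub>M lborel)) = (\<integral>\<^sup>+x. (\<integral>\<^sup>+t. ennreal (norm (?f (t, x))) \<partial>lborel) \<partial>lborel)"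
      by (intro lborel_pair.nn_integral_snd[symmetric]) measurable
    also have "\<dots> \<le> (\<integral>\<^sup>+x. ennreal (majorant_const TYPE('a)) * (majorant y x * ennreal (cmod (u x))) \<partial>lborel)"
    proof (intro nn_integral_mono)
      fix x
      have "(\<integral>\<^sup>+t. ennreal (norm (?f (t, x))) \<partial>lborel) \<le>
          (\<integral>\<^sup>+t. (ennreal (majorant_const TYPE('a)) * ennreal (cmod (u x))) * ennreal (decay t * heat (2 * t) (x - y)) \<partial>lborel)"
      proof (intro nn_integral_mono)
        fix t
        have "norm (?f (t, x)) \<le> majorant_const TYPE('a) * (decay t * heat (2 * t) (x - y)) * cmod (u x)"
          unfolding prod.case norm_mult norm_of_real by (intro mult_right_mono k_pos_heatD_bound bs) simp
        then have "ennreal (norm (?f (t, x))) \<le> ennreal ((majorant_const TYPE('a) * cmod (u x)) * (decay t * heat (2 * t) (x - y)))"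
          by (intro ennreal_leI) (simp add: mult_ac)
        then show "ennreal (norm (?f (t, x))) \<le> (ennreal (majorant_const TYPE('a)) * ennreal (cmod (u x))) * ennreal (decay t * heat (2 * t) (x - y))"
          using majorant_const_nonneg[where 'a='a] by (simp add: ennreal_mult')
      qed
      also have "\<dots> = ennreal (majorant_const TYPE('a)) * ennreal (cmod (u x)) * majorant y x"
        unfolding majorant_def by (intro nn_integral_cmult) measurable
      finally show "(\<integral>\<^sup>+t. ennreal (norm (?f (t, x))) \<partial>lborel) \<le> ennreal (majorant_const TYPE('a)) * (majorant y x * ennreal (cmod (u x)))"
        by (simp only: mult_ac)
    qed
    also have "\<dots> = ennreal (majorant_const TYPE('a)) * (\<integral>\<^sup>+x. majorant y x * ennreal (cmod (u x)) \<partial>lborel)"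
      by (intro nn_integral_cmult) measurable
    also have "\<dots> < \<infinity>" using SSu by (simp add: ennreal_mult_less_top)
    finally show "(\<integral>\<^sup>+p. ennreal (norm (?f p)) \<partial>(lborel \<Otimes>\<^sub>M lborel)) < \<infinity>" .
  qed
  have inner: "(LINT x|lborel. ?f (t, x)) = complex_of_real (k_pos t) * (LINT x|lborel. complex_of_real (heatD t bs (x - y)) * u x)" for t
    by (simp add: mult.assoc)
  show "integrable lborel (\<lambda>t. complex_of_real (k_pos t) * (LINT x|lborel. complex_of_real (heatD t bs (x - y)) * u x))"
    using lborel_pair.integrable_fst'[OF int] unfolding inner .
  have "(LINT x|lborel. complex_of_real (green_deriv bs (x - y)) * u x) = (LINT x|lborel. LINT t|lborel. ?f (t, x))"
    unfolding green_deriv_def prod.case integral_complex_of_real[symmetric] by simp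
  also have "\<dots> = (LINT t|lborel. LINT x|lborel. ?f (t, x))"
    using lborel_pair.Fubini_integral[of "\<lambda>t x. ?f (t, x)"] int by simp
  finally show "(LINT x|lborel. complex_of_real (green_deriv bs (x - y)) * u x) =
      (LINT t|lborel. complex_of_real (k_pos t) * (LINT x|lborel. complex_of_real (heatD t bs (x - y)) * u x))"
    unfolding inner .
qed

text \<open>For each t > 0 the identity is integration by parts for the smooth heat kernel;
  weighting with \<open>k_pos\<close> and integrating over t gives the claim without differentiating
  anything at the pole.\<close>

lemma green_deriv_weak_deriv:
  fixes y :: "'a::euclidean_space"
  assumes d: "DIM('a) \<le> 3" and bs: "length bs \<le> 2" "set bs \<subseteq> Basis"
  shows "has_weak_deriv (\<lambda>x. complex_of_real (green_deriv [] (x - y))) bs (\<lambda>x. complex_of_real (green_deriv bs (x - y)))"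
  unfolding has_weak_deriv_def
proof (intro allI impI)
  fix \<phi> :: "'a \<Rightarrow> complex" assume \<phi>: "test_function \<phi>"
  have "(LINT x|lborel. complex_of_real (green_deriv [] (x - y)) * iter_partial bs \<phi> x) =
      (LINT t|lborel. complex_of_real (k_pos t) * (LINT x|lborel. complex_of_real (heatD t [] (x - y)) * iter_partial bs \<phi> x))"
    by (intro green_deriv_pairing d test_function_L2 test_function_iter_partial \<phi> bs) auto
  also have "\<dots> = (LINT t|lborel. (- 1) ^ length bs * (complex_of_real (k_pos t) * (LINT x|lborel. complex_of_real (heatD t bs (x - y)) * \<phi> x)))"
  proof (intro Bochner_Integration.integral_cong refl)
    fix t
    show "complex_of_real (k_pos t) * (LINT x|lborel. complex_of_real (heatD t [] (x - y)) * iter_partial bs \<phi> x) =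
        (- 1) ^ length bs * (complex_of_real (k_pos t) * (LINT x|lborel. complex_of_real (heatD t bs (x - y)) * \<phi> x))"
    proof (cases "t > 0")
      case True
      show ?thesis by (simp add: heat_test_by_parts[OF True bs(2,1) \<phi>])
    qed (simp add: k_pos_def)
  qed
  also have "\<dots> = (- 1) ^ length bs * (LINT x|lborel. complex_of_real (green_deriv bs (x - y)) * \<phi> x)"
    unfolding green_deriv_pairing(2)[OF d bs test_function_L2[OF \<phi>]] by (rule integral_mult_right_zero)
  finally show "(LINT x|lborel. complex_of_real (green_deriv [] (x - y)) * iter_partial bs \<phi> x) =
      (- 1) ^ length bs * (LINT x|lborel. complex_of_real (green_deriv bs (x - y)) * \<phi> x)" .
qed

lemma green_deriv_H2:
  fixes y :: "'a::euclidean_space"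
  assumes d: "DIM('a) \<le> 3"
  shows "(\<lambda>x. complex_of_real (green_deriv [] (x - y))) \<in> H2"
  unfolding H2_def using green_deriv_L2[OF d] green_deriv_weak_deriv[OF d] by fastforce

text \<open>The heat kernel at time t is largest at the origin, and that maximum times
  \<open>k_pos\<close> is integrable; dominated convergence holds even at the pole.\<close>

lemma green_deriv_continuous:
  assumes d: "DIM('a::euclidean_space) \<le> 3"
  shows "continuous_on UNIV (green_deriv [] :: 'a \<Rightarrow> real)"
proof -
  have "(\<lambda>n. green_deriv [] (X n)) \<longlonglongrightarrow> green_deriv [] z" if X: "X \<longlonglongrightarrow> z" for X :: "nat \<Rightarrow> 'a" and z
    unfolding green_deriv_def heatD.simps
  proof (rule integral_dominated_convergence[OF _ _ k_pos_power_integrable[OF d]])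
    show "AE t in lborel. (\<lambda>n. k_pos t * heat t (X n)) \<longlonglongrightarrow> k_pos t * heat t z"
    proof (intro AE_I2)
      fix t
      show "(\<lambda>n. k_pos t * heat t (X n)) \<longlonglongrightarrow> k_pos t * heat t z"
      proof (cases "t > 0")
        case True
        then show ?thesis unfolding heat_def by (intro tendsto_intros X) auto
      qed (simp add: k_pos_def)
    qed
    show "AE t in lborel. norm (k_pos t * heat t (X n)) \<le> \<bar>k_pos t\<bar> * \<bar>(1 / sqrt (4 * pi * t)) ^ DIM('a)\<bar>" for n
    proof (intro AE_I2)
      fix t
      show "norm (k_pos t * heat t (X n)) \<le> \<bar>k_pos t\<bar> * \<bar>(1 / sqrt (4 * pi * t)) ^ DIM('a)\<bar>"
      proof (cases "t > 0")
        case True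
        have "\<bar>heat t (X n)\<bar> \<le> \<bar>(1 / sqrt (4 * pi * t)) ^ DIM('a)\<bar>"
          unfolding heat_def abs_mult using True by (intro mult_left_le) auto
        then show ?thesis by (simp add: abs_mult mult_left_mono)
      qed (simp add: k_pos_def)
    qed
  qed (unfold heat_def, measurable)
  then show ?thesis by (auto simp: continuous_on_sequentially comp_def)
qed

text \<open>The reciprocal of the symbol is the Laplace transform of \<open>k\<close> at |p|^2.
  Exchanging the p- and t-integrals leaves the Fourier transform of a Gaussian, that is, a multiple
  of the heat kernel.\<close>

lemma green_eq_green_deriv:
  fixes z :: "'a::euclidean_space"
  assumes d: "DIM('a) \<le> 3"
  shows "green \<epsilon> \<alpha> z = complex_of_real (green_deriv [] z)"
proof -
  let ?f = "\<lambda>(t, p::'a). exp (\<i> * complex_of_real (p \<bullet> z)) * complex_of_real (k_pos t * exp (- (t * (norm p)\<^sup>2)))"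
  have m[measurable]: "?f \<in> borel_measurable (lborel \<Otimes>\<^sub>M lborel)"
    by measurable
  have inner_p: "(LINT p|lborel. ?f (t, p)) = complex_of_real ((2 * pi) ^ DIM('a)) * complex_of_real (k_pos t * heat t z)" for t
  proof (cases "t > 0")
    case True
    have "(LINT p|lborel. ?f (t, p)) = (LINT p|lborel. complex_of_real (k_pos t) * (exp (\<i> * complex_of_real (p \<bullet> z)) * complex_of_real (exp (- (t * (norm p)\<^sup>2)))))"
      by (simp add: mult_ac)
    also have "\<dots> = complex_of_real (k_pos t) * complex_of_real ((2 * pi) ^ DIM('a) * heat t z)"
      by (simp only: integral_mult_right_zero gauss_fourier(1)[OF True])
    finally show ?thesis by simp
  qed (simp add: k_pos_def)
  have norm_f: "norm (?f (t, p)) = \<bar>k_pos t\<bar> * exp (- (t * (norm p)\<^sup>2))" for t p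
    by (simp add: norm_mult)
  have int: "integrable (lborel \<Otimes>\<^sub>M lborel) ?f"
  proof (rule lborel_pair.Fubini_integrable[OF m])
    have "(LINT p|lborel. norm (?f (t, p))) = (2 * pi) ^ DIM('a) * (\<bar>k_pos t\<bar> * \<bar>(1 / sqrt (4 * pi * t)) ^ DIM('a)\<bar>)" for t
    proof (cases "t > 0")
      case True
      \<comment> \<open>The total Gaussian mass is the Fourier formula at x = 0, so the p-integral
        of the modulus has the size (4 pi t)^(-d/2) handled by
        \<open>k_pos_power_integrable\<close>.\<close>
      have "complex_of_real (LINT p::'a|lborel. exp (- (t * (norm p)\<^sup>2))) = complex_of_real ((2 * pi) ^ DIM('a) * heat t (0::'a))"
        using gauss_fourier(1)[OF True, of "0::'a"] by simp
      then have "(LINT p::'a|lborel. exp (- (t * (norm p)\<^sup>2))) = (2 * pi) ^ DIM('a) * (1 / sqrt (4 * pi * t)) ^ DIM('a)"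
        unfolding of_real_eq_iff by (simp add: heat_def)
      then show ?thesis using True unfolding norm_f by simp
    qed (simp add: k_pos_def)
    then show "integrable lborel (\<lambda>t. LINT p|lborel. norm (?f (t, p)))"
      using k_pos_power_integrable[OF d] by simp
    show "AE t in lborel. integrable lborel (\<lambda>p. ?f (t, p))"
    proof (intro AE_I2)
      fix t
      show "integrable lborel (\<lambda>p. ?f (t, p))"
      proof (cases "t > 0")
        case True
        have "integrable lborel (\<lambda>p::'a. \<bar>k_pos t\<bar> * exp (- (t * (norm p)\<^sup>2)))"
          by (intro integrable_mult_right gauss_fourier True)
        then show ?thesis
          by (rule Bochner_Integration.integrable_bound) (simp, simp add: norm_mult)
      qed (simp add: k_pos_def)
    qed
  qed
  have "(LINT p|lborel. exp (\<i> * complex_of_real (p \<bullet> z)) / complex_of_real (\<epsilon>\<^sup>2 * norm p ^ 4 + (norm p)\<^sup>2 + \<alpha>)) =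
      (LINT p|lborel. LINT t|lborel. ?f (t, p))"
  proof (intro Bochner_Integration.integral_cong refl)
    fix p :: 'a
    have "(LINT t|lborel. ?f (t, p)) = exp (\<i> * complex_of_real (p \<bullet> z)) * complex_of_real (LINT t|lborel. k_pos t * exp (- (t * (norm p)\<^sup>2)))"
      unfolding prod.case integral_mult_right_zero integral_complex_of_real ..
    also have "(LINT t|lborel. k_pos t * exp (- (t * (norm p)\<^sup>2))) = 1 / (\<epsilon>\<^sup>2 * norm p ^ 4 + (norm p)\<^sup>2 + \<alpha>)"
      using k_pos_laplace(2)[of "(norm p)\<^sup>2"] by (simp add: power2_eq_square power4_eq_xxxx mult.assoc)
    finally show "exp (\<i> * complex_of_real (p \<bullet> z)) / complex_of_real (\<epsilon>\<^sup>2 * norm p ^ 4 + (norm p)\<^sup>2 + \<alpha>) = (LINT t|lborel. ?f (t, p))"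
      by simp
  qed
  also have "\<dots> = (LINT t|lborel. LINT p|lborel. ?f (t, p))"
    using lborel_pair.Fubini_integral[of "\<lambda>t p. ?f (t, p)"] int by simp
  also have "\<dots> = complex_of_real ((2 * pi) ^ DIM('a)) * complex_of_real (green_deriv [] z)"
    unfolding inner_p integral_mult_right_zero integral_complex_of_real by (simp add: green_deriv_def)
  finally show ?thesis by (simp add: green_def)
qed

text \<open>The reproducing property in bilinear form; the conjugate enters only when it is
  translated to \<open>energy\<close>. With v(t) the heat convolution of \<open>g\<close> at y, the
  functions w = v' and w' turn the three terms into time integrals of k times \<epsilon>^2 w', -w
  and \<alpha> v.\<close>

lemma reproducing_identity:
  fixes g :: "'a::euclidean_space \<Rightarrow> complex"
  assumes d: "DIM('a) \<le> 3" and g: "g \<in> H2"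
  shows "complex_of_real (\<epsilon>\<^sup>2) * (\<Sum>b\<in>Basis. LINT x|lborel. complex_of_real (green_deriv [b, b] (x - y)) * weak_laplacian g x) +
      (\<Sum>b\<in>Basis. LINT x|lborel. complex_of_real (green_deriv [b] (x - y)) * weak_deriv [b] g x) +
      complex_of_real \<alpha> * (LINT x|lborel. complex_of_real (green_deriv [] (x - y)) * g x) = cont_rep g y"
proof -
  define v where "v t = heat_conv t g y" for t
  define w where "w t = heat_conv t (weak_laplacian g) y" for t
  define w' where "w' t = heat_lap_conv t (weak_laplacian g) y" for t
  note g2 = H2_L2[OF g] and lg = weak_laplacian_L2[OF g]
  note P = green_deriv_pairing[OF d]
  have gb: "weak_deriv [b] g \<in> L2" if "b \<in> Basis" for b using that by (intro H2_weak_deriv g) auto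
  have v_deriv: "(v has_vector_derivative w t) (at t)" if "t > 0" for t
    using heat_conv_deriv[OF that g2, of y] unfolding heat_lap_conv_H2[OF that g] v_def w_def .
  have w_deriv: "(w has_vector_derivative w' t) (at t)" if "t > 0" for t
    using heat_conv_deriv[OF that lg, of y] unfolding w_def w'_def .
  have 1: "(\<Sum>b\<in>Basis. LINT x|lborel. complex_of_real (green_deriv [b, b] (x - y)) * weak_laplacian g x) = (LINT t|lborel. complex_of_real (k_pos t) * w' t)"
      "integrable lborel (\<lambda>t. complex_of_real (k_pos t) * w' t)"
  proof -
    let ?h = "\<lambda>b t. complex_of_real (k_pos t) * (LINT x|lborel. complex_of_real (heatD t [b, b] (x - y)) * weak_laplacian g x)"
    have eq: "complex_of_real (k_pos t) * w' t = (\<Sum>b\<in>Basis. ?h b t)" for t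
    proof (cases "t > 0")
      case True
      have "w' t = (\<Sum>b\<in>Basis. LINT x|lborel. complex_of_real (heatD t [b, b] (x - y)) * weak_laplacian g x)"
        unfolding w'_def heat_lap_conv_def of_real_sum sum_distrib_right
        by (intro Bochner_Integration.integral_sum L2_mult_integrable heatD_L2 True lg) auto
      then show ?thesis by (simp add: sum_distrib_left)
    qed (simp add: k_pos_def)
    have int: "integrable lborel (?h b)" if "b \<in> Basis" for b using that by (intro P lg) auto
    then show "integrable lborel (\<lambda>t. complex_of_real (k_pos t) * w' t)" unfolding eq by (intro Bochner_Integration.integrable_sum)
    have "(\<Sum>b\<in>Basis. LINT x|lborel. complex_of_real (green_deriv [b, b] (x - y)) * weak_laplacian g x) = (\<Sum>b\<in>Basis. LINT t|lborel. ?h b t)"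
      by (intro sum.cong refl P lg) auto
    also have "\<dots> = (LINT t|lborel. (\<Sum>b\<in>Basis. ?h b t))"
      by (rule Bochner_Integration.integral_sum[symmetric]) (rule int)
    finally show "(\<Sum>b\<in>Basis. LINT x|lborel. complex_of_real (green_deriv [b, b] (x - y)) * weak_laplacian g x) = (LINT t|lborel. complex_of_real (k_pos t) * w' t)"
      unfolding eq .
  qed
  have 2: "(\<Sum>b\<in>Basis. LINT x|lborel. complex_of_real (green_deriv [b] (x - y)) * weak_deriv [b] g x) = (LINT t|lborel. - (complex_of_real (k_pos t) * w t))"
      "integrable lborel (\<lambda>t. - (complex_of_real (k_pos t) * w t))"
  proof -
    let ?h = "\<lambda>b t. complex_of_real (k_pos t) * (LINT x|lborel. complex_of_real (heatD t [b] (x - y)) * weak_deriv [b] g x)"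
    have eq: "- (complex_of_real (k_pos t) * w t) = (\<Sum>b\<in>Basis. ?h b t)" for t
    proof (cases "t > 0")
      case True
      have "(\<Sum>b\<in>Basis. ?h b t) = (\<Sum>b\<in>Basis. complex_of_real (k_pos t) * - heat_conv t (weak_deriv [b, b] g) y)"
        by (intro sum.cong refl arg_cong2[of _ _ _ _ "(*)"] heat_conv_partial True g)
      also have "\<dots> = - (complex_of_real (k_pos t) * (\<Sum>b\<in>Basis. heat_conv t (weak_deriv [b, b] g) y))"
        by (simp add: sum_distrib_left sum_negf)
      finally show ?thesis by (simp add: heat_conv_laplacian[OF True g] w_def)
    qed (simp add: k_pos_def)
    have int: "integrable lborel (?h b)" if "b \<in> Basis" for b using that by (intro P gb) auto
    then show "integrable lborel (\<lambda>t. - (complex_of_real (k_pos t) * w t))" unfolding eq by (intro Bochner_Integration.integrable_sum)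
    have "(\<Sum>b\<in>Basis. LINT x|lborel. complex_of_real (green_deriv [b] (x - y)) * weak_deriv [b] g x) = (\<Sum>b\<in>Basis. LINT t|lborel. ?h b t)"
      by (intro sum.cong refl P gb) auto
    also have "\<dots> = (LINT t|lborel. (\<Sum>b\<in>Basis. ?h b t))"
      by (rule Bochner_Integration.integral_sum[symmetric]) (rule int)
    finally show "(\<Sum>b\<in>Basis. LINT x|lborel. complex_of_real (green_deriv [b] (x - y)) * weak_deriv [b] g x) = (LINT t|lborel. - (complex_of_real (k_pos t) * w t))"
      unfolding eq .
  qed
  have 3: "(LINT x|lborel. complex_of_real (green_deriv [] (x - y)) * g x) = (LINT t|lborel. complex_of_real (k_pos t) * v t)"
      "integrable lborel (\<lambda>t. complex_of_real (k_pos t) * v t)"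
    using P[of "[]" g y] g2 by (simp_all add: v_def heat_conv_def)
  define f where "f t = complex_of_real (k t) * (complex_of_real (\<epsilon>\<^sup>2) * w' t - w t + complex_of_real \<alpha> * v t)" for t
  have f_eq: "indicator {0<..} t *\<^sub>R f t = complex_of_real (\<epsilon>\<^sup>2) * (complex_of_real (k_pos t) * w' t) + - (complex_of_real (k_pos t) * w t) + complex_of_real \<alpha> * (complex_of_real (k_pos t) * v t)" for t
    by (cases "t > 0") (simp_all add: f_def k_pos_def algebra_simps)
  have f_int: "integrable lborel (\<lambda>t. indicator {0<..} t *\<^sub>R f t)"
    unfolding f_eq by (intro Bochner_Integration.integrable_add integrable_mult_right 1 2 3)
  have "complex_of_real (\<epsilon>\<^sup>2) * (\<Sum>b\<in>Basis. LINT x|lborel. complex_of_real (green_deriv [b, b] (x - y)) * weak_laplacian g x) +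
      (\<Sum>b\<in>Basis. LINT x|lborel. complex_of_real (green_deriv [b] (x - y)) * weak_deriv [b] g x) +
      complex_of_real \<alpha> * (LINT x|lborel. complex_of_real (green_deriv [] (x - y)) * g x) = (LINT t|lborel. indicator {0<..} t *\<^sub>R f t)"
    unfolding f_eq 1(1) 2(1) 3(1) using 1(2) 2(2) 3(2)
    by (simp only: Bochner_Integration.integral_add integrable_mult_right Bochner_Integration.integrable_add integral_mult_right_zero simp_thms)
  also have "\<dots> = 0 - (- cont_rep g y)"
  proof (rule integral_FTC_Ioi[OF _ f_int])
    \<comment> \<open>In F = \<epsilon>^2 (k w - k' v) - k v the products k' w cancel on
      differentiation, and the equation \<epsilon>^2 k'' + k' = -\<alpha> k leaves the integrand. At
      0 only -\<epsilon>^2 k' v survives, giving -\<open>cont_rep g y\<close> since \<epsilon>^2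
      k'(0) = 1.\<close>
    let ?F = "\<lambda>t. complex_of_real (\<epsilon>\<^sup>2) * (complex_of_real (k t) * w t - complex_of_real (k' t) * v t) - complex_of_real (k t) * v t"
    have dk: "((\<lambda>t. complex_of_real (k t)) has_vector_derivative complex_of_real (k' t)) (at t)" for t
      by (intro has_vector_derivative_of_real k_deriv)
    have dk': "((\<lambda>t. complex_of_real (k' t)) has_vector_derivative complex_of_real (- ((k' t + \<alpha> * k t) / \<epsilon>\<^sup>2))) (at t)" for t
      by (intro has_vector_derivative_of_real k'_deriv)
    show "(?F has_vector_derivative f t) (at t)" if "t > 0" for t
    proof -
      let ?D = "complex_of_real (\<epsilon>\<^sup>2) * ((complex_of_real (k t) * w' t + complex_of_real (k' t) * w t) -
          (complex_of_real (k' t) * w t + complex_of_real (- ((k' t + \<alpha> * k t) / \<epsilon>\<^sup>2)) * v t)) - (complex_of_real (k t) * w t + complex_of_real (k' t) * v t)"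
      have "(?F has_vector_derivative ?D) (at t)"
        by (intro has_vector_derivative_diff has_vector_derivative_mult_right has_vector_derivative_mult dk dk' v_deriv w_deriv that)
      moreover have "?D = f t"
      proof -
        have "complex_of_real (\<epsilon>\<^sup>2) * (complex_of_real (- ((k' t + \<alpha> * k t) / \<epsilon>\<^sup>2)) * v t) = - (complex_of_real (k' t + \<alpha> * k t) * v t)"
          using eps by simp
        then show ?thesis unfolding f_def right_diff_distrib distrib_left by (simp only:) (simp add: algebra_simps)
      qed
      ultimately show ?thesis by simp
    qed
    have k0: "(k \<longlongrightarrow> 0) (at_right 0)" and k'0: "(k' \<longlongrightarrow> 1 / \<epsilon>\<^sup>2) (at_right 0)"
      using DERIV_isCont[OF k_deriv, of 0] DERIV_isCont[OF k'_deriv, of 0] k_0 k'_0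
      by (simp_all add: isCont_def filterlim_at_split)
    have v0: "(v \<longlongrightarrow> cont_rep g y) (at_right 0)"
      unfolding v_def by (rule H2_cont_rep(3)[OF g d])
    \<comment> \<open>One estimate for both ends: the factor t of \<open>k_bound\<close> turns
      t^(-3/4) into t^(1/4), which vanishes at 0, and the exponential wins at infinity.\<close>
    have kw: "cmod (complex_of_real (k t) * heat_conv t u y) \<le> C * L2_norm u * ((t + t powr (1 / 4)) * exp (- (c * t)))"
      if "t > 0" "u \<in> L2" for t u
    proof -
      have "cmod (complex_of_real (k t) * heat_conv t u y) \<le> (C * t * exp (- (c * t))) * ((1 + t powr (- 3 / 4)) * L2_norm u)"
        unfolding norm_mult using that k_bound[of t] C_nonneg
        by (intro mult_mono heat_conv_bound d) auto
      also have "\<dots> = C * L2_norm u * ((t + t powr 1 * t powr (- 3 / 4)) * exp (- (c * t)))"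
        using that by (simp add: algebra_simps)
      also have "t powr 1 * t powr (- 3 / 4) = t powr (1 / 4)"
        unfolding powr_add[symmetric] by simp
      finally show ?thesis .
    qed
    have kw0: "((\<lambda>t. complex_of_real (k t) * w t) \<longlongrightarrow> 0) (at_right 0)"
    proof (rule Lim_null_comparison)
      show "eventually (\<lambda>t. norm (complex_of_real (k t) * w t) \<le> C * L2_norm (weak_laplacian g) * ((t + t powr (1 / 4)) * exp (- (c * t)))) (at_right 0)"
        using eventually_at_right_less[of "0::real"] by eventually_elim (unfold w_def, rule kw[OF _ lg])
      have "((\<lambda>t. (t + t powr (1 / 4)) * exp (- (c * t))) \<longlongrightarrow> 0) (at_right 0)"
        by real_asymp
      from tendsto_mult_left[OF this] show "((\<lambda>t. C * L2_norm (weak_laplacian g) * ((t + t powr (1 / 4)) * exp (- (c * t)))) \<longlongrightarrow> 0) (at_right 0)"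
        by simp
    qed
    have "(?F \<longlongrightarrow> complex_of_real (\<epsilon>\<^sup>2) * (0 - complex_of_real (1 / \<epsilon>\<^sup>2) * cont_rep g y) - complex_of_real 0 * cont_rep g y) (at_right 0)"
      by (intro tendsto_intros kw0 k0 k'0 v0)
    then show "(?F \<longlongrightarrow> - cont_rep g y) (at_right 0)" using eps by simp
    have kinf: "((\<lambda>t. complex_of_real (k t) * heat_conv t u y) \<longlongrightarrow> 0) at_top" if "u \<in> L2" for u
    proof (rule Lim_null_comparison)
      show "eventually (\<lambda>t. norm (complex_of_real (k t) * heat_conv t u y) \<le> C * L2_norm u * ((t + t powr (1 / 4)) * exp (- (c * t)))) at_top"
        using eventually_gt_at_top[of "0::real"] by eventually_elim (rule kw[OF _ that])
      have "((\<lambda>t. (t + t powr (1 / 4)) * exp (- (c * t))) \<longlongrightarrow> 0) at_top"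
        using c by real_asymp
      from tendsto_mult_left[OF this] show "((\<lambda>t. C * L2_norm u * ((t + t powr (1 / 4)) * exp (- (c * t)))) \<longlongrightarrow> 0) at_top"
        by simp
    qed
    have k'inf: "((\<lambda>t. complex_of_real (k' t) * v t) \<longlongrightarrow> 0) at_top"
    proof (rule Lim_null_comparison)
      show "eventually (\<lambda>t. norm (complex_of_real (k' t) * v t) \<le> C * L2_norm g * (exp (- (c * t)) * (1 + t powr (- 3 / 4)))) at_top"
        using eventually_gt_at_top[of "0::real"]
      proof eventually_elim
        case (elim t)
        have "norm (complex_of_real (k' t) * v t) \<le> (C * exp (- (c * t))) * ((1 + t powr (- 3 / 4)) * L2_norm g)"
          unfolding norm_mult v_def using elim k'_bound[of t] C_nonneg
          by (intro mult_mono heat_conv_bound d g2) auto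
        then show ?case by (simp add: mult_ac)
      qed
      have "((\<lambda>t. exp (- (c * t)) * (1 + t powr (- 3 / 4))) \<longlongrightarrow> 0) at_top"
        using c by real_asymp
      from tendsto_mult_left[OF this] show "((\<lambda>t. C * L2_norm g * (exp (- (c * t)) * (1 + t powr (- 3 / 4)))) \<longlongrightarrow> 0) at_top"
        by simp
    qed
    have "(?F \<longlongrightarrow> complex_of_real (\<epsilon>\<^sup>2) * (0 - 0) - 0) at_top"
      using kinf[OF lg] kinf[OF g2] by (intro tendsto_diff tendsto_mult_left k'inf) (simp_all add: v_def w_def)
    then show "(?F \<longlongrightarrow> 0) at_top" by simp
  qed
  finally show ?thesis by simp
qed

end

section \<open>Linearity of the inner product and of weak derivatives\<close>

lemma L2_inner_add:
  "f \<in> L2 \<Longrightarrow> f' \<in> L2 \<Longrightarrow> g \<in> L2 \<Longrightarrow> L2_inner (\<lambda>x. f x + f' x) g = L2_inner f g + L2_inner f' g"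
  by (simp add: L2_inner_def distrib_right L2_mult_integrable L2_cnj)

lemma L2_inner_cmult: "L2_inner (\<lambda>x. a * f x) g = a * L2_inner f g"
  by (simp add: L2_inner_def mult.assoc)

lemma L2_inner_sum:
  assumes "\<And>i. i \<in> I \<Longrightarrow> f i \<in> L2" "g \<in> L2"
  shows "L2_inner (\<lambda>x. \<Sum>i\<in>I. f i x) g = (\<Sum>i\<in>I. L2_inner (f i) g)"
  unfolding L2_inner_def sum_distrib_right
  by (rule Bochner_Integration.integral_sum) (intro L2_mult_integrable L2_cnj assms)

lemma L2_inner_cong_AE:
  assumes "f \<in> L2" "f' \<in> L2" "g \<in> L2" "AE x in lborel. f x = f' x"
  shows "L2_inner f g = L2_inner f' g"
  unfolding L2_inner_def
proof (rule integral_cong_AE)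
  show "(\<lambda>x. f x * cnj (g x)) \<in> borel_measurable lborel" "(\<lambda>x. f' x * cnj (g x)) \<in> borel_measurable lborel"
    by (intro borel_measurable_integrable L2_mult_integrable L2_cnj assms)+
  show "AE x in lborel. f x * cnj (g x) = f' x * cnj (g x)"
    using assms(4) by eventually_elim simp
qed

lemma L2_inner_self: "L2_inner f f = complex_of_real (LINT x|lborel. (cmod (f x))\<^sup>2)"
  unfolding L2_inner_def complex_norm_square[symmetric] by (rule integral_complex_of_real)

text \<open>The bridge between the sesquilinear form and the bilinear pairings: for a real first
  factor the conjugate can be taken outside the integral.\<close>

lemma L2_inner_of_real: "L2_inner (\<lambda>x. complex_of_real (r x)) g = cnj (LINT x|lborel. complex_of_real (r x) * g x)"
  unfolding L2_inner_def
  by (simp only: Bochner_Integration.integral_cnj[symmetric] complex_cnj_mult complex_cnj_complex_of_real)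

lemma H2_add:
  assumes "f \<in> H2" "g \<in> H2"
  shows "(\<lambda>x. f x + g x) \<in> H2"
proof -
  have "\<exists>h\<in>L2. has_weak_deriv (\<lambda>x. f x + g x) bs h" if "set bs \<subseteq> Basis" "length bs \<le> 2" for bs
    by (intro bexI[of _ "\<lambda>x. weak_deriv bs f x + weak_deriv bs g x"] has_weak_deriv_add L2_add H2_weak_deriv H2_L2 assms that)
  then show ?thesis using assms by (auto simp: H2_def intro: L2_add)
qed

lemma H2_cmult:
  assumes "f \<in> H2"
  shows "(\<lambda>x. a * f x) \<in> H2"
proof -
  have "\<exists>h\<in>L2. has_weak_deriv (\<lambda>x. a * f x) bs h" if "set bs \<subseteq> Basis" "length bs \<le> 2" for bs
    by (intro bexI[of _ "\<lambda>x. a * weak_deriv bs f x"] has_weak_deriv_cmult L2_cmult H2_weak_deriv assms that)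
  then show ?thesis using assms by (auto simp: H2_def intro: L2_cmult)
qed

lemma H2_zero: "(\<lambda>x. 0) \<in> H2"
  unfolding H2_def has_weak_deriv_def using L2_zero by (auto intro!: bexI[of _ "\<lambda>x. 0"])

lemma H2_sum: "(\<And>i. i \<in> I \<Longrightarrow> f i \<in> H2) \<Longrightarrow> (\<lambda>x. \<Sum>i\<in>I. f i x) \<in> H2"
  by (induction I rule: infinite_finite_induct) (auto intro: H2_zero H2_add)

text \<open>Representatives are chosen separately for each function, so linearity can be expected
  almost everywhere only; \<open>L2_inner_cong_AE\<close> later absorbs this.\<close>

lemma weak_deriv_add:
  assumes "f \<in> H2" "g \<in> H2" "set bs \<subseteq> Basis" "length bs \<le> 2"
  shows "AE x in lborel. weak_deriv bs (\<lambda>x. f x + g x) x = weak_deriv bs f x + weak_deriv bs g x"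
  by (intro weak_deriv_props(3) L2_add has_weak_deriv_add H2_weak_deriv H2_L2 assms)

lemma weak_deriv_cmult:
  assumes "f \<in> H2" "set bs \<subseteq> Basis" "length bs \<le> 2"
  shows "AE x in lborel. weak_deriv bs (\<lambda>x. a * f x) x = a * weak_deriv bs f x"
  by (intro weak_deriv_props(3) L2_cmult has_weak_deriv_cmult H2_weak_deriv assms)

lemma weak_laplacian_cong_AE:
  assumes "\<And>b. b \<in> Basis \<Longrightarrow> AE x in lborel. weak_deriv [b, b] f x = h b x"
  shows "AE x in lborel. weak_laplacian f x = (\<Sum>b\<in>Basis. h b x)"
proof -
  have "AE x in lborel. \<forall>b\<in>Basis. weak_deriv [b, b] f x = h b x"
    by (intro AE_finite_allI assms) auto
  then show ?thesis by eventually_elim (simp add: weak_laplacian_def)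
qed

section \<open>Eigenfunctions\<close>

definition energy :: "real \<Rightarrow> real \<Rightarrow> ('a::euclidean_space \<Rightarrow> complex) \<Rightarrow> ('a \<Rightarrow> complex) \<Rightarrow> complex" where
  "energy \<epsilon> \<alpha> f g = complex_of_real (\<epsilon>\<^sup>2) * L2_inner (weak_laplacian f) (weak_laplacian g) + grad_inner f g +
    complex_of_real \<alpha> * L2_inner f g"

lemma energy_add:
  assumes f: "f \<in> H2" "f' \<in> H2" and g: "g \<in> H2"
  shows "energy \<epsilon> \<alpha> (\<lambda>x. f x + f' x) g = energy \<epsilon> \<alpha> f g + energy \<epsilon> \<alpha> f' g"
proof -
  note ff = H2_add[OF f]
  have "AE x in lborel. weak_laplacian (\<lambda>x. f x + f' x) x = weak_laplacian f x + weak_laplacian f' x"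
    using weak_laplacian_cong_AE[of "\<lambda>x. f x + f' x" "\<lambda>b x. weak_deriv [b, b] f x + weak_deriv [b, b] f' x"] weak_deriv_add[OF f]
    by (simp add: weak_laplacian_def sum.distrib)
  then have 1: "L2_inner (weak_laplacian (\<lambda>x. f x + f' x)) (weak_laplacian g) =
      L2_inner (weak_laplacian f) (weak_laplacian g) + L2_inner (weak_laplacian f') (weak_laplacian g)"
    by (subst L2_inner_add[symmetric]) (intro weak_laplacian_L2 f g L2_inner_cong_AE L2_add ff; assumption)+
  have 2: "grad_inner (\<lambda>x. f x + f' x) g = grad_inner f g + grad_inner f' g"
    unfolding grad_inner_def sum.distrib[symmetric]
  proof (intro sum.cong refl)
    fix b :: 'a assume b: "b \<in> Basis"
    have W: "weak_deriv [b] u \<in> L2" if "u \<in> H2" for u using b that by (intro H2_weak_deriv) auto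
    have "L2_inner (weak_deriv [b] (\<lambda>x. f x + f' x)) (weak_deriv [b] g) = L2_inner (\<lambda>x. weak_deriv [b] f x + weak_deriv [b] f' x) (weak_deriv [b] g)"
      using b by (intro L2_inner_cong_AE W L2_add weak_deriv_add f g ff) auto
    then show "L2_inner (weak_deriv [b] (\<lambda>x. f x + f' x)) (weak_deriv [b] g) =
        L2_inner (weak_deriv [b] f) (weak_deriv [b] g) + L2_inner (weak_deriv [b] f') (weak_deriv [b] g)"
      by (simp add: L2_inner_add W f g)
  qed
  show ?thesis
    unfolding energy_def 1 2 L2_inner_add[OF f[THEN H2_L2] H2_L2[OF g]] by (simp add: algebra_simps)
qed

lemma energy_cmult:
  assumes f: "f \<in> H2" and g: "g \<in> H2"
  shows "energy \<epsilon> \<alpha> (\<lambda>x. a * f x) g = a * energy \<epsilon> \<alpha> f g"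
proof -
  note ff = H2_cmult[OF f, of a]
  have "AE x in lborel. weak_laplacian (\<lambda>x. a * f x) x = a * weak_laplacian f x"
    using weak_laplacian_cong_AE[of "\<lambda>x. a * f x" "\<lambda>b x. a * weak_deriv [b, b] f x"] weak_deriv_cmult[OF f]
    by (simp add: weak_laplacian_def sum_distrib_left)
  then have 1: "L2_inner (weak_laplacian (\<lambda>x. a * f x)) (weak_laplacian g) = a * L2_inner (weak_laplacian f) (weak_laplacian g)"
    by (subst L2_inner_cmult[symmetric]) (intro L2_inner_cong_AE weak_laplacian_L2 ff L2_cmult f g)
  have 2: "grad_inner (\<lambda>x. a * f x) g = a * grad_inner f g"
    unfolding grad_inner_def sum_distrib_left
  proof (intro sum.cong refl)
    fix b :: 'a assume b: "b \<in> Basis"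
    have W: "weak_deriv [b] u \<in> L2" if "u \<in> H2" for u using b that by (intro H2_weak_deriv) auto
    have "L2_inner (weak_deriv [b] (\<lambda>x. a * f x)) (weak_deriv [b] g) = L2_inner (\<lambda>x. a * weak_deriv [b] f x) (weak_deriv [b] g)"
      using b by (intro L2_inner_cong_AE W L2_cmult weak_deriv_cmult f g ff) auto
    then show "L2_inner (weak_deriv [b] (\<lambda>x. a * f x)) (weak_deriv [b] g) = a * L2_inner (weak_deriv [b] f) (weak_deriv [b] g)"
      by (simp add: L2_inner_cmult)
  qed
  show ?thesis
    unfolding energy_def 1 2 L2_inner_cmult by (simp add: algebra_simps)
qed

lemma energy_sum:
  assumes "finite I" "\<And>i. i \<in> I \<Longrightarrow> f i \<in> H2" "g \<in> H2"
  shows "energy \<epsilon> \<alpha> (\<lambda>x. \<Sum>i\<in>I. f i x) g = (\<Sum>i\<in>I. energy \<epsilon> \<alpha> (f i) g)"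
  using assms(1,2)
proof (induction I rule: finite_induct)
  case empty
  show ?case using energy_cmult[OF H2_zero assms(3), of _ _ 0] by simp
next
  case (insert i I)
  then show ?case using energy_add[of "f i" "\<lambda>x. \<Sum>i\<in>I. f i x" g] assms(3) by (simp add: H2_sum)
qed

text \<open>All three terms are nonnegative, and the last one controls the L2 norm because \<alpha>
  > 0.\<close>

lemma energy_self_eq_0:
  assumes "\<alpha> > 0" "f \<in> H2" "energy \<epsilon> \<alpha> f f = 0"
  shows "AE x in lborel. f x = 0"
proof -
  let ?n = "\<lambda>u. LINT x|lborel. (cmod (u x))\<^sup>2"
  have nn: "?n u \<ge> 0" for u :: "'a \<Rightarrow> complex" by simp
  have "complex_of_real (\<epsilon>\<^sup>2 * ?n (weak_laplacian f) + (\<Sum>b\<in>Basis. ?n (weak_deriv [b] f)) + \<alpha> * ?n f) = 0"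
    using assms(3) by (simp add: energy_def grad_inner_def L2_inner_self)
  then have "\<epsilon>\<^sup>2 * ?n (weak_laplacian f) + (\<Sum>b\<in>Basis. ?n (weak_deriv [b] f)) + \<alpha> * ?n f = 0"
    by (simp only: of_real_eq_0_iff)
  moreover have "\<epsilon>\<^sup>2 * ?n (weak_laplacian f) \<ge> 0" "(\<Sum>b\<in>Basis. ?n (weak_deriv [b] f)) \<ge> 0" "\<alpha> * ?n f \<ge> 0"
    using assms(1) by (auto intro!: sum_nonneg mult_nonneg_nonneg)
  ultimately have "\<alpha> * ?n f = 0" by linarith
  then have "?n f = 0" using assms(1) by simp
  then have "AE x in lborel. (cmod (f x))\<^sup>2 = 0"
    by (subst (asm) integral_nonneg_eq_0_iff_AE) (auto intro: L2_square_integrable H2_L2 assms(2))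
  then show ?thesis by simp
qed

text \<open>The time kernel is obtained inside the proof and disappears from the conclusions. The
  point value is conjugated because \<open>energy\<close> is antilinear in its second
  argument.\<close>

lemma
  fixes y :: "'a::euclidean_space"
  assumes d: "DIM('a) \<le> 3" and pos: "\<epsilon> > 0" "\<alpha> > 0"
  shows green_H2: "(\<lambda>x. green \<epsilon> \<alpha> (x - y)) \<in> H2"
    and green_continuous: "continuous_on UNIV (\<lambda>x::'a. green \<epsilon> \<alpha> (x - y))"
    and energy_green: "g \<in> H2 \<Longrightarrow> energy \<epsilon> \<alpha> (\<lambda>x. green \<epsilon> \<alpha> (x - y)) g = cnj (cont_rep g y)"
proof -
  obtain k k' c C where "resolvent_kernel \<epsilon> \<alpha> k k' c C"
    using resolvent_kernel_exists[OF pos] by blast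
  then interpret resolvent_kernel \<epsilon> \<alpha> k k' c C .
  let ?G = "\<lambda>bs x. complex_of_real (green_deriv bs (x - y))"
  have eq: "(\<lambda>x. green \<epsilon> \<alpha> (x - y)) = ?G []"
    by (simp add: green_eq_green_deriv[OF d])
  show H2: "(\<lambda>x. green \<epsilon> \<alpha> (x - y)) \<in> H2"
    unfolding eq by (rule green_deriv_H2[OF d])
  show "continuous_on UNIV (\<lambda>x::'a. green \<epsilon> \<alpha> (x - y))"
    unfolding eq by (intro continuous_on_of_real continuous_on_compose2[OF green_deriv_continuous[OF d]] continuous_intros) auto
  assume g: "g \<in> H2"
  have L: "?G bs \<in> L2" if "set bs \<subseteq> Basis" "length bs \<le> 2" for bs
    by (rule green_deriv_L2[OF d that(2,1)])
  have W: "AE x in lborel. weak_deriv bs (?G []) x = ?G bs x" if "set bs \<subseteq> Basis" "length bs \<le> 2" for bs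
    by (rule weak_deriv_props(3)[OF L[OF that] green_deriv_weak_deriv[OF d that(2,1)]])
  have "AE x in lborel. weak_laplacian (?G []) x = (\<Sum>b\<in>Basis. ?G [b, b] x)"
    by (rule weak_laplacian_cong_AE) (rule W, auto)
  then have "L2_inner (weak_laplacian (?G [])) (weak_laplacian g) = L2_inner (\<lambda>x. \<Sum>b\<in>Basis. ?G [b, b] x) (weak_laplacian g)"
    by (intro L2_inner_cong_AE weak_laplacian_L2 L2_sum L green_deriv_H2[OF d] g) auto
  also have "\<dots> = (\<Sum>b\<in>Basis. L2_inner (?G [b, b]) (weak_laplacian g))"
    by (intro L2_inner_sum L weak_laplacian_L2 g) auto
  finally have 1: "L2_inner (weak_laplacian (?G [])) (weak_laplacian g) =
      (\<Sum>b\<in>Basis. cnj (LINT x|lborel. ?G [b, b] x * weak_laplacian g x))"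
    by (simp only: L2_inner_of_real)
  have 2: "grad_inner (?G []) g = (\<Sum>b\<in>Basis. cnj (LINT x|lborel. ?G [b] x * weak_deriv [b] g x))"
    unfolding grad_inner_def L2_inner_of_real[symmetric]
    by (intro sum.cong refl L2_inner_cong_AE H2_weak_deriv L W green_deriv_H2[OF d] g) auto
  have "energy \<epsilon> \<alpha> (?G []) g = cnj (complex_of_real (\<epsilon>\<^sup>2) * (\<Sum>b\<in>Basis. LINT x|lborel. ?G [b, b] x * weak_laplacian g x) +
      (\<Sum>b\<in>Basis. LINT x|lborel. ?G [b] x * weak_deriv [b] g x) + complex_of_real \<alpha> * (LINT x|lborel. ?G [] x * g x))"
    unfolding energy_def 1 2 L2_inner_of_real complex_cnj_add complex_cnj_mult complex_cnj_complex_of_real cnj_sum ..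
  then show "energy \<epsilon> \<alpha> (\<lambda>x. green \<epsilon> \<alpha> (x - y)) g = cnj (cont_rep g y)"
    unfolding eq reproducing_identity[OF d g] .
qed

lemma energy_green_sum:
  fixes x :: "'N::finite \<Rightarrow> 'a::euclidean_space" and h :: "'N \<Rightarrow> complex"
  assumes d: "DIM('a) \<le> 3" and pos: "\<epsilon> > 0" "\<alpha> > 0"
  defines "u \<equiv> \<lambda>y. \<Sum>k\<in>UNIV. h k * green \<epsilon> \<alpha> (y - x k)"
  shows "u \<in> H2" "continuous_on UNIV u"
    "g \<in> H2 \<Longrightarrow> energy \<epsilon> \<alpha> u g = (\<Sum>k\<in>UNIV. h k * cnj (cont_rep g (x k)))"
proof -
  note G = green_H2[OF d pos] and E = energy_green[OF d pos]
  show "u \<in> H2" unfolding u_def by (intro H2_sum H2_cmult G)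
  show "continuous_on UNIV u" unfolding u_def by (intro continuous_intros green_continuous[OF d pos])
  assume g: "g \<in> H2"
  have "energy \<epsilon> \<alpha> u g = (\<Sum>k\<in>UNIV. energy \<epsilon> \<alpha> (\<lambda>y. h k * green \<epsilon> \<alpha> (y - x k)) g)"
    unfolding u_def by (intro energy_sum H2_cmult G g) simp
  also have "\<dots> = (\<Sum>k\<in>UNIV. h k * cnj (cont_rep g (x k)))"
    by (simp add: energy_cmult[OF G g] E[OF g])
  finally show "energy \<epsilon> \<alpha> u g = (\<Sum>k\<in>UNIV. h k * cnj (cont_rep g (x k)))" .
qed

text \<open>The term \<alpha> (f, g) is added to make the form definite and subtracted again;
  integration against a Dirac measure evaluates the continuous representatives.\<close>

lemma point_form_energy:
  fixes x :: "'N::finite \<Rightarrow> 'a::euclidean_space"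
  assumes d: "DIM('a) \<le> 3" and "f \<in> H2" "g \<in> H2"
  shows "point_form \<epsilon> c x f g = energy \<epsilon> \<alpha> f g - complex_of_real \<alpha> * L2_inner f g +
    (\<Sum>j\<in>UNIV. complex_of_real (c j) * cont_rep f (x j) * cnj (cont_rep g (x j)))"
proof -
  have [measurable]: "cont_rep f \<in> borel_measurable borel" "cont_rep g \<in> borel_measurable borel"
    by (intro borel_measurable_continuous_onI H2_cont_rep(1) assms)+
  have "(\<lambda>y. cont_rep f y * cnj (cont_rep g y)) \<in> borel_measurable borel"
    by (intro borel_measurable_continuous_onI continuous_intros H2_cont_rep(1) assms)
  then show ?thesis
    by (simp add: point_form_def energy_def point_integral_def integral_return mult.assoc)
qed

text \<open>For the eigenvalue -\<alpha> the two terms \<alpha> (f, g) cancel, leaving the weak form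
  of (-\<Delta> + \<epsilon>^2 \<Delta>^2 + \<alpha>) f = - \<Sum> c_j f(x_j) \<delta>_(x_j): the
  interaction becomes a finite sum of point sources.\<close>

lemma eigenfunction_point_operator_iff:
  fixes x :: "'N::finite \<Rightarrow> 'a::euclidean_space"
  assumes d: "DIM('a) \<le> 3"
  shows "eigenfunction (point_operator \<epsilon> c x) (complex_of_real (- \<alpha>)) f \<longleftrightarrow>
    f \<in> H2 \<and> (\<forall>g\<in>H2. energy \<epsilon> \<alpha> f g = (\<Sum>j\<in>UNIV. - (complex_of_real (c j) * cont_rep f (x j)) * cnj (cont_rep g (x j)))) \<and>
    \<not> (AE y in lborel. f y = 0)"
proof -
  have "point_form \<epsilon> c x f g = L2_inner (\<lambda>y. complex_of_real (- \<alpha>) * f y) g \<longleftrightarrow>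
      energy \<epsilon> \<alpha> f g = (\<Sum>j\<in>UNIV. - (complex_of_real (c j) * cont_rep f (x j)) * cnj (cont_rep g (x j)))"
    if "f \<in> H2" "g \<in> H2" for g
    unfolding point_form_energy[OF d that, of \<epsilon> c x \<alpha>] L2_inner_cmult
    by (simp add: sum_negf eq_neg_iff_add_eq_0)
  then show ?thesis
    unfolding eigenfunction_def point_operator_def form_operator_def
    using L2_cmult[OF H2_L2, of f "complex_of_real (- \<alpha>)"] by blast
qed

lemma green_matrix_mult:
  "(green_matrix \<epsilon> \<alpha> c x *v h) $ j = h $ j / complex_of_real (c j) + (\<Sum>k\<in>UNIV. h $ k * green \<epsilon> \<alpha> (x j - x k))"
proof -
  have "((if j = k then complex_of_real (1 / c k) else 0) + green \<epsilon> \<alpha> (x j - x k)) * h $ k =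
      (if j = k then h $ k / complex_of_real (c k) else 0) + h $ k * green \<epsilon> \<alpha> (x j - x k)" for k
    by (simp add: distrib_right)
  then show ?thesis
    by (simp only: green_matrix_def matrix_vector_mult_def vec_lambda_beta sum.distrib) simp
qed

lemma eigenfunction_green:
  fixes x :: "'N::finite \<Rightarrow> 'a::euclidean_space"
  assumes d: "DIM('a) \<le> 3" and pos: "\<epsilon> > 0" "\<alpha> > 0" and c: "\<And>j. c j \<noteq> 0"
    and f: "eigenfunction (point_operator \<epsilon> c x) (complex_of_real (- \<alpha>)) f"
  obtains h :: "complex^'N" where "green_matrix \<epsilon> \<alpha> c x *v h = 0" "h \<noteq> 0"
    "AE y in lborel. f y = (\<Sum>k\<in>UNIV. h $ k * green \<epsilon> \<alpha> (y - x k))"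
proof -
  have f2: "f \<in> H2" and E: "\<And>g. g \<in> H2 \<Longrightarrow> energy \<epsilon> \<alpha> f g = (\<Sum>j\<in>UNIV. - (complex_of_real (c j) * cont_rep f (x j)) * cnj (cont_rep g (x j)))"
    and nz: "\<not> (AE y in lborel. f y = 0)"
    using f unfolding eigenfunction_point_operator_iff[OF d] by auto
  define h :: "complex^'N" where "h = (\<chi> k. - (complex_of_real (c k) * cont_rep f (x k)))"
  define u where "u y = (\<Sum>k\<in>UNIV. h $ k * green \<epsilon> \<alpha> (y - x k))" for y
  note u = energy_green_sum[OF d pos, where h="\<lambda>k. h $ k" and x=x, folded u_def]
  let ?F = "\<lambda>y. f y + (- 1) * u y"
  have F: "?F \<in> H2" by (intro H2_add H2_cmult f2 u)
  \<comment> \<open>Both \<open>f\<close> and \<open>u\<close> represent the same functional on H2,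
    so their difference is orthogonal to everything, in particular to itself.\<close>
  have "energy \<epsilon> \<alpha> ?F ?F = energy \<epsilon> \<alpha> f ?F + (- 1) * energy \<epsilon> \<alpha> u ?F"
    unfolding energy_add[OF f2 H2_cmult[OF u(1)] F] energy_cmult[OF u(1) F] ..
  also have "\<dots> = 0" unfolding E[OF F] u(3)[OF F] by (simp add: h_def)
  finally have "AE y in lborel. ?F y = 0" by (rule energy_self_eq_0[OF pos(2) F])
  then have fu: "AE y in lborel. f y = u y" by eventually_elim simp
  then have "AE y in lborel. u y = f y" by eventually_elim simp
  then have cr: "cont_rep f = u" by (rule cont_rep_eqI[OF u(2)])
  show ?thesis
  proof (rule that[of h])
    have "(green_matrix \<epsilon> \<alpha> c x *v h) $ j = 0" for j
    proof -
      have "(green_matrix \<epsilon> \<alpha> c x *v h) $ j = h $ j / complex_of_real (c j) + u (x j)"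
        unfolding green_matrix_mult u_def ..
      also have "h $ j / complex_of_real (c j) = - u (x j)" using c[of j] by (simp add: h_def cr)
      finally show ?thesis by simp
    qed
    then show "green_matrix \<epsilon> \<alpha> c x *v h = 0" by (simp add: vec_eq_iff)
    show "h \<noteq> 0"
    proof
      assume "h = 0"
      then have "u = (\<lambda>y. 0)" by (simp add: u_def fun_eq_iff)
      then show False using fu nz by simp
    qed
    show "AE y in lborel. f y = (\<Sum>k\<in>UNIV. h $ k * green \<epsilon> \<alpha> (y - x k))"
      using fu unfolding u_def .
  qed
qed

text \<open>The kernel equation recovers \<open>h\<close> from the values of \<open>u\<close> at the
  points, h_j = - c_j u(x_j). This makes \<open>u\<close> solve the eigenvalue equation and also
  shows that \<open>u\<close> is not zero, since otherwise \<open>h\<close> would vanish.\<close>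

lemma eigenvalue_of_kernel:
  fixes x :: "'N::finite \<Rightarrow> 'a::euclidean_space" and h :: "complex^'N"
  assumes d: "DIM('a) \<le> 3" and pos: "\<epsilon> > 0" "\<alpha> > 0" and c: "\<And>j. c j \<noteq> 0"
    and h: "green_matrix \<epsilon> \<alpha> c x *v h = 0" "h \<noteq> 0"
  shows "eigenvalue (point_operator \<epsilon> c x) (complex_of_real (- \<alpha>))"
proof -
  define u where "u y = (\<Sum>k\<in>UNIV. h $ k * green \<epsilon> \<alpha> (y - x k))" for y
  note u = energy_green_sum[OF d pos, where h="\<lambda>k. h $ k" and x=x, folded u_def]
  have cr: "cont_rep u = u" by (rule cont_rep_eqI[OF u(2)]) simp
  have hk: "h $ j = - (complex_of_real (c j) * u (x j))" for j
  proof -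
    have "h $ j / complex_of_real (c j) + u (x j) = 0"
      using h(1) green_matrix_mult[of \<epsilon> \<alpha> c x h j] by (simp add: u_def)
    then show ?thesis using c[of j] by (simp add: field_simps add_eq_0_iff)
  qed
  have "\<not> (AE y in lborel. u y = 0)"
  proof
    assume "AE y in lborel. u y = 0"
    then have "u = (\<lambda>y. 0)" by (intro continuous_AE_eq[OF u(2)]) auto
    then have "h = 0" using hk by (simp add: vec_eq_iff)
    then show False using h(2) by simp
  qed
  moreover have "energy \<epsilon> \<alpha> u g = (\<Sum>j\<in>UNIV. - (complex_of_real (c j) * cont_rep u (x j)) * cnj (cont_rep g (x j)))" if "g \<in> H2" for g
    unfolding u(3)[OF that] cr hk[symmetric] ..
  ultimately have "eigenfunction (point_operator \<epsilon> c x) (complex_of_real (- \<alpha>)) u"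
    unfolding eigenfunction_point_operator_iff[OF d] using u(1) by blast
  then show ?thesis unfolding eigenvalue_def by blast
qed

lemma det_eq_0_iff_kernel:
  fixes A :: "'a::field^'n^'n"
  shows "det A = 0 \<longleftrightarrow> (\<exists>h. h \<noteq> 0 \<and> A *v h = 0)"
  using invertible_det_nz[of A] invertible_left_inverse[of A] matrix_left_invertible_ker[of A] by auto

theorem theorem8:
  fixes \<epsilon> :: real
    and c :: "'N::finite \<Rightarrow> real"
    and x :: "'N \<Rightarrow> real^'d"
  assumes "CARD('d) \<le> 3"
    and "\<epsilon> > 0"
    and "inj x"
    and "\<And>j. c j \<noteq> 0"
  shows "(\<forall>\<alpha>>0. eigenvalue (point_operator \<epsilon> c x) (complex_of_real (- \<alpha>)) \<longleftrightarrow>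
            det (green_matrix \<epsilon> \<alpha> c x) = 0) \<and>
         (\<forall>\<alpha>>0. eigenvalue (point_operator \<epsilon> c x) (complex_of_real (- \<alpha>)) \<longrightarrow>
            (\<forall>f. eigenfunction (point_operator \<epsilon> c x) (complex_of_real (- \<alpha>)) f \<longrightarrow>
               (\<exists>h :: complex^'N. green_matrix \<epsilon> \<alpha> c x *v h = 0 \<and>
                  (AE y in lborel. f y = (\<Sum>k\<in>UNIV. h $ k * green \<epsilon> \<alpha> (y - x k))))))"
proof -
  have d: "DIM(real^'d) \<le> 3" using assms(1) by simp
  \<comment> \<open>The additional information \<open>h \<noteq> 0\<close> feeds the determinant
    criterion in (a); the form of the eigenfunctions in (b) uses the rest.\<close>
  have ex: "\<exists>h :: complex^'N. green_matrix \<epsilon> \<alpha> c x *v h = 0 \<and> h \<noteq> 0 \<and>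
      (AE y in lborel. f y = (\<Sum>k\<in>UNIV. h $ k * green \<epsilon> \<alpha> (y - x k)))"
    if "\<alpha> > 0" "eigenfunction (point_operator \<epsilon> c x) (complex_of_real (- \<alpha>)) f" for \<alpha> f
    by (rule eigenfunction_green[OF d assms(2) that(1) assms(4) that(2)]) blast
  have "eigenvalue (point_operator \<epsilon> c x) (complex_of_real (- \<alpha>)) \<longleftrightarrow> det (green_matrix \<epsilon> \<alpha> c x) = 0"
    if \<alpha>: "\<alpha> > 0" for \<alpha>
    unfolding det_eq_0_iff_kernel
    using ex[OF \<alpha>] eigenvalue_of_kernel[OF d assms(2) \<alpha>, where x=x and c=c] assms(4)
    unfolding eigenvalue_def by blast
  then show ?thesis using ex by blast
qed

end
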